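(* Let $h_1\ge 1$ be an integer, let $r'_j$ ($j\ge 1$) be a sequence of positive integers with $r'_j\to\infty$, and put $r_j=j\,r'_j$. Let $T$ be the rank-one construction with initial height $h_1$, cutting parameters $r_j$, and spacer parameters $\bar s_j=(s_j(1),\dots,s_j(r_j))$ given by: for odd $j$, $s_j(i)=0$ for all $1\le i\le r_j$; for even $j$, $s_j(i)=0$ for $0<i\le r_j/2$ and $s_j(i)=h_j$ for $r_j/2<i\le r_j$, where $h_j$ is the height of the tower at stage $j$. Then the Poisson suspension $P(T)$ is rigid and has no roots.
   Context: Rank-one construction. Given an integer $h_1\ge1$, positive integers $r_j\to\infty$ and vectors of non-negative integers $\bar s_j=(s_j(1),\dots,s_j(r_j))$, $j\ge1$, a transformation $T$ is constructed inductively. At stage $j$ one has a system of disjoint half-intervals $C_j, TC_j,\dots,T^{h_j-1}C_j$ of equal length (at stage $1$, a system of $h_1$ such half-intervals), with $T$ acting as a parallel translation on $C_j,\dots,T^{h_j-2}C_j$ (each floor is mapped onto the next one). This system is called the tower of stage $j$, its height is $h_j$, and its union is denoted $X_j$. Represent $C_j$ as a disjoint union of half-intervals $C_j^i$, $i=1,\dots,r_j$, of equal length, and consider the columns $C_j^i,TC_j^i,\dots,T^{h_j-1}C_j^i$. Above the column with number $i$ add $s_j(i)$ new half-intervals (floors) of the same length as $C_j^i$, all added floors being disjoint from each other and from $X_j$. Extend $T$ by parallel translations so that the $i$-th superstructured column becomes $C_j^i,TC_j^i,\dots,T^{h_j+s_j(i)-1}C_j^i$, and so that for $0<i<r_j$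 the top floor of the $i$-th superstructured column is mapped by translation onto the lowest floor of the $(i+1)$-st: $T^{h_j+s_j(i)}C_j^i=C_j^{i+1}$. Put $C_{j+1}=C_j^1$; all floors of the superstructured columns then form the tower $C_{j+1},TC_{j+1},\dots,T^{h_{j+1}-1}C_{j+1}$ of stage $j+1$, of height $h_{j+1}=h_jr_j+\sum_{i=1}^{r_j}s_j(i)$. The partial definition of $T$ at stage $j$ is preserved at all later stages. As a result one obtains the space $X=\bigcup_j X_j$ and an invertible transformation $T:X\to X$ (defined modulo null sets) preserving the standard Lebesgue measure $\mu$ on $X$; $\mu$ is sigma-finite. An automorphism of a measure space is an invertible bi-measurable measure-preserving transformation; automorphisms and equalities between them are considered modulo null sets. Poisson suspension: let $X^*$ be the space of configurations on $X$ (integer-valued counting measures on $X$, i.e. countable collections of points) and let $\mu^*$ be the Poisson probability measure on $X^*$ with intensity $\mu$: for each measurable set $A$ with $\mu(A)<\infty$ the number of points of the configuration in $A$ is Poisson distributed with mean $\mu(A)$, and the numbers of points in pairwise disjoint sets are independent. $P(T)$ is the automorphism of the probability space $(X^*,\mu^* )$ that moves every point of the configuration by $T$. Rigid: an automorphism $S$ is rigid if there is a sequence of integers $n_i\to\infty$ with $S^{n_i}\to I$ strongly, as operators on $L_2$ of the measure space on which $S$ acts. Roots: an automorphism $S$ of a measure space has no roots if for no integer $n\ge 2$ there exists an automorphism $R$ of the same measure space with $R^n=S$. *)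

theory Defs
  imports "HOL-Probability.Probability"
begin

text \<open>Invertibility and all identities between transformations are understood modulo null sets.\<close>

definition automorphism :: "'a measure \<Rightarrow> ('a \<Rightarrow> 'a) \<Rightarrow> bool" where
  "automorphism M S \<longleftrightarrow>
     S \<in> measurable M M \<and> distr M M S = M \<and>
     (\<exists>S' \<in> measurable M M. distr M M S' = M \<and>
        (AE x in M. S' (S x) = x) \<and> (AE x in M. S (S' x) = x))"

text \<open>The operator on \<open>L\<^sub>2\<close> induced by \<open>S\<close> is \<open>f \<mapsto> f \<circ> S\<close>;
  for an automorphism all integrands in the limit below are integrable.\<close>

definition rigid :: "'a measure \<Rightarrow> ('a \<Rightarrow> 'a) \<Rightarrow> bool" where
  "rigid M S \<longleftrightarrow> automorphism M S \<and>
     (\<exists>n :: nat \<Rightarrow> nat. filterlim n at_top sequentially \<and>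
        (\<forall>f :: 'a \<Rightarrow> complex.
           f \<in> borel_measurable M \<longrightarrow> integrable M (\<lambda>x. (cmod (f x))\<^sup>2) \<longrightarrow>
           (\<lambda>i. \<integral>x. (cmod (f ((S ^^ n i) x) - f x))\<^sup>2 \<partial>M) \<longlonglongrightarrow> 0))"

definition no_roots :: "'a measure \<Rightarrow> ('a \<Rightarrow> 'a) \<Rightarrow> bool" where
  "no_roots M S \<longleftrightarrow>
     (\<forall>n \<ge> (2 :: nat). \<not> (\<exists>R. automorphism M R \<and> (AE x in M. (R ^^ n) x = S x)))"

text \<open>A configuration is the counting measure \<open>A \<mapsto> card {i \<in> I. x i \<in> A}\<close> of a finite or
  countably infinite family \<open>(x i)\<close>, \<open>i \<in> I \<subseteq> \<nat>\<close>, of points of \<open>M\<close> (repetitions allowed).\<close>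

definition configurations :: "'a measure \<Rightarrow> 'a measure set" where
  "configurations M =
     {distr (count_space I) M x | (I :: nat set) x. x \<in> I \<rightarrow> space M}"

text \<open>The sigma-algebra generated by the numbers of points in measurable sets, built in the same
  way as \<^const>\<open>subprob_algebra\<close>.\<close>

definition configuration_algebra :: "'a measure \<Rightarrow> 'a measure measure" where
  "configuration_algebra M =
     (SUP A \<in> sets M. vimage_algebra (configurations M) (\<lambda>\<omega>. emeasure \<omega> A) borel)"

text \<open>\<open>P\<close> is the Poisson probability measure with intensity \<open>M\<close>. The mean of the number of
  points in \<open>A\<close> may be \<open>0\<close>, hence the law is written out instead of using \<^const>\<open>poisson_pmf\<close>.\<close>

definition poisson_measure :: "'a measure \<Rightarrow> 'a measure measure \<Rightarrow> bool" where
  "poisson_measure M P \<longleftrightarrow>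
     prob_space P \<and> sets P = sets (configuration_algebra M) \<and>
     (\<forall>A \<in> sets M. emeasure M A < \<infinity> \<longrightarrow>
        (\<forall>n :: nat. measure P {\<omega> \<in> space P. emeasure \<omega> A = of_nat n} =
                    measure M A ^ n / fact n * exp (- measure M A))) \<and>
     (\<forall>A :: nat \<Rightarrow> 'a set. range A \<subseteq> sets M \<longrightarrow> disjoint_family A \<longrightarrow>
        prob_space.indep_vars P (\<lambda>_. borel) (\<lambda>i \<omega>. emeasure \<omega> (A i)) UNIV)"

definition poisson_suspension :: "'a measure \<Rightarrow> ('a \<Rightarrow> 'a) \<Rightarrow> 'a measure \<Rightarrow> 'a measure" where
  "poisson_suspension M T = (\<lambda>\<omega>. distr \<omega> M T)"

text \<open>Stages are indexed by \<open>j \<ge> 1\<close>. The tower of stage \<open>j\<close> has height \<open>h j\<close>, all its floors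
  have length \<open>w j\<close>, and its \<open>k\<close>-th floor \<open>T\<^sup>k C\<^sub>j\<close>, \<open>0 \<le> k < h j\<close>, has left endpoint \<open>a j k\<close>.\<close>

definition tower_floor :: "(nat \<Rightarrow> real) \<Rightarrow> (nat \<Rightarrow> nat \<Rightarrow> real) \<Rightarrow> nat \<Rightarrow> nat \<Rightarrow> real set" where
  "tower_floor w a j k = {a j k ..< a j k + w j}"

definition tower ::
  "(nat \<Rightarrow> nat) \<Rightarrow> (nat \<Rightarrow> real) \<Rightarrow> (nat \<Rightarrow> nat \<Rightarrow> real) \<Rightarrow> nat \<Rightarrow> real set" where
  "tower h w a j = (\<Union>k<h j. tower_floor w a j k)"

definition rank_one_space ::
  "(nat \<Rightarrow> nat) \<Rightarrow> (nat \<Rightarrow> real) \<Rightarrow> (nat \<Rightarrow> nat \<Rightarrow> real) \<Rightarrow> real measure" where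
  "rank_one_space h w a = restrict_space lborel (\<Union>j\<in>{1..}. tower h w a j)"

text \<open>The position, in the tower of stage \<open>j + 1\<close>, of the lowest floor \<open>C\<^sub>j\<^sup>i\<close> of the \<open>i\<close>-th
  superstructured column, \<open>1 \<le> i \<le> r\<^sub>j\<close>; in particular \<open>C\<^sub>j\<^sup>1\<close> has position \<open>0\<close>.\<close>

definition column_base :: "(nat \<Rightarrow> nat) \<Rightarrow> (nat \<Rightarrow> nat \<Rightarrow> nat) \<Rightarrow> nat \<Rightarrow> nat \<Rightarrow> nat" where
  "column_base h s j i = (\<Sum>l = 1..<i. h j + s j l)"

text \<open>The locale describes an arbitrary realization of the construction: neither the order of the
  pieces \<open>C\<^sub>j\<^sup>i\<close> inside \<open>C\<^sub>j\<close> nor the position of the added floors on the line is prescribed.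
  The values of \<open>T\<close> are prescribed on every floor except the top one of each tower, that is,
  everywhere on the space except for at most one point.\<close>

locale rank_one =
  fixes h\<^sub>1 :: nat
    and r :: "nat \<Rightarrow> nat"
    and s :: "nat \<Rightarrow> nat \<Rightarrow> nat"
    and h :: "nat \<Rightarrow> nat"
    and w :: "nat \<Rightarrow> real"
    and a :: "nat \<Rightarrow> nat \<Rightarrow> real"
    and T :: "real \<Rightarrow> real"
  assumes initial_height: "h\<^sub>1 \<ge> 1" "h 1 = h\<^sub>1"
    and cuts_pos: "\<And>j. j \<ge> 1 \<Longrightarrow> r j \<ge> 1"
    and cuts_unbounded: "filterlim r at_top sequentially"
    and height_step: "\<And>j. j \<ge> 1 \<Longrightarrow> h (Suc j) = h j * r j + (\<Sum>i = 1..r j. s j i)"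
    and length_pos: "\<And>j. j \<ge> 1 \<Longrightarrow> w j > 0"
    and floors_disjoint: "\<And>j. j \<ge> 1 \<Longrightarrow> disjoint_family_on (tower_floor w a j) {..<h j}"
    and base_cut: "\<And>j. j \<ge> 1 \<Longrightarrow>
      tower_floor w a j 0 = (\<Union>i\<in>{1..r j}. tower_floor w a (Suc j) (column_base h s j i))"
    and column_floors: "\<And>j i k. j \<ge> 1 \<Longrightarrow> i \<in> {1..r j} \<Longrightarrow> k < h j \<Longrightarrow>
      a (Suc j) (column_base h s j i + k) =
        a (Suc j) (column_base h s j i) + (a j k - a j 0)"
    and added_floors: "\<And>j i k. j \<ge> 1 \<Longrightarrow> i \<in> {1..r j} \<Longrightarrow> h j \<le> k \<Longrightarrow> k < h j + s j i \<Longrightarrow>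
      tower_floor w a (Suc j) (column_base h s j i + k) \<inter> tower h w a j = {}"
    and maps_space: "T \<in> space (rank_one_space h w a) \<rightarrow> space (rank_one_space h w a)"
    and translation: "\<And>j k x. j \<ge> 1 \<Longrightarrow> Suc k < h j \<Longrightarrow> x \<in> tower_floor w a j k \<Longrightarrow>
      T x = x + (a j (Suc k) - a j k)"

end

theory Submission
  imports Defs
begin

text \<open>Write \<open>h\<^sub>j\<close> for the height of the tower of stage \<open>j\<close>, \<open>N\<^sub>A\<close> for the number of points in \<open>A\<close> and \<open>S
  = P(T)\<close>. Three facts about \<open>T\<close> carry the proof.

  At an odd stage the columns are stacked without spacers, so \<open>T\<close> iterated \<open>h\<^sub>j\<close> times moves each
  column into the next one and tends to the identity (\<open>flat_limit\<close>). This passes to the suspension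
  (\<open>rigid_suspension\<close>), because the number of points in \<open>A\<close> changes only if a point lies in the
  small symmetric difference of \<open>A\<close> and its preimage.

  At an even stage the same power moves half of the columns into the next column and the other half
  out of the tower into fresh spacers, so it tends weakly to one half of the identity
  (\<open>half_limit\<close>). On the suspension the corresponding limit is the thinning operator: it acts as
  multiplication by \<open>1/2\<^sup>k\<close> on the \<open>k\<close>-th Wiener-Ito chaos. Every automorphism \<open>R\<close> that commutes
  with \<open>S\<close>, in particular every root of \<open>S\<close>, commutes with thinning and hence maps the first chaos
  to itself. No Fock space is needed to exploit this: for \<open>F = N\<^sub>A \<circ> R - \<mu>(A)\<close> and for the
  normalized exponential \<open>E\<^sub>z = (1 + z) ^ N\<^sub>B * exp (- z \<mu>(B))\<close> the scalar product of \<open>F\<close> with \<open>E\<^sub>z\<close>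
  is halved when \<open>z\<close> is halved; being differentiable at \<open>0\<close>, it is linear in \<open>z\<close>
  (\<open>corr_exp_vector\<close>). Letting \<open>z\<close> tend to infinity shows that the covariance of \<open>N\<^sub>A \<circ> R\<close> and \<open>N\<^sub>B\<close> is nonnegative (\<open>corr_nonneg\<close>);
  \<open>z = -1\<close>, the void events, shows that \<open>F\<close> lies in the closed span of the first chaos
  (\<open>compensated_R_closure\<close>). So \<open>R\<close> induces a positive unitary operator on \<open>L\<^sub>2\<close> of the intensity
  measure, and such an operator maps functions with disjoint supports to functions with disjoint
  supports.

  Finally, every \<open>m\<close> divides \<open>h\<^sub>j\<close> from some stage on, because \<open>r\<^sub>j\<close> is a multiple of \<open>j\<close>. From that
  stage on the index of a floor has a residue class modulo \<open>m\<close> that does not depend on the stage;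
  \<open>T\<close> adds one to it, and the powers of \<open>T\<close> act on each class ergodically. Since \<open>R\<close> commutes with
  \<open>S\<close> and respects disjointness, the covariances of \<open>N\<^sub>A \<circ> R\<close> with \<open>N\<^sub>B\<close> vanish unless the class of
  \<open>B\<close> is the class of \<open>A\<close> plus a constant \<open>c\<close> (\<open>corr_shift\<close>). Then the \<open>m\<close>-th power of \<open>R\<close> shifts
  classes by \<open>m c = 0\<close> (\<open>corr_power_shift\<close>), whereas \<open>S\<close> shifts them by \<open>-1\<close>, so \<open>R\<close> is not an
  \<open>m\<close>-th root of \<open>S\<close> when \<open>m \<ge> 2\<close> (\<open>not_root\<close>).\<close>

section \<open>Square-integrable functions\<close>

definition L2 :: "'a measure \<Rightarrow> ('a \<Rightarrow> real) set" where
  "L2 M = {f \<in> borel_measurable M. integrable M (\<lambda>x. (f x)\<^sup>2)}"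

definition norm2 :: "'a measure \<Rightarrow> ('a \<Rightarrow> real) \<Rightarrow> real" where
  "norm2 M f = sqrt (\<integral>x. (f x)\<^sup>2 \<partial>M)"

lemma L2_measurable: "f \<in> L2 M \<Longrightarrow> f \<in> borel_measurable M"
  and L2_square: "f \<in> L2 M \<Longrightarrow> integrable M (\<lambda>x. (f x)\<^sup>2)"
  by (auto simp: L2_def)

lemma norm2_nonneg [simp]: "0 \<le> norm2 M f"
  by (simp add: norm2_def)

lemma norm2_square: "(norm2 M f)\<^sup>2 = (\<integral>x. (f x)\<^sup>2 \<partial>M)"
  by (simp add: norm2_def)

lemma norm2_cong: "(\<And>x. x \<in> space M \<Longrightarrow> (f x)\<^sup>2 = (g x)\<^sup>2) \<Longrightarrow> norm2 M f = norm2 M g"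
  by (simp add: norm2_def cong: Bochner_Integration.integral_cong)

lemma L2_mult:
  assumes "f \<in> L2 M" "g \<in> L2 M"
  shows "integrable M (\<lambda>x. f x * g x)"
proof (rule Bochner_Integration.integrable_bound)
  show "integrable M (\<lambda>x. (f x)\<^sup>2 + (g x)\<^sup>2)"
    using assms by (auto simp: L2_def)
  show "(\<lambda>x. f x * g x) \<in> borel_measurable M"
    using assms by (auto simp: L2_def)
  have "\<bar>a * b\<bar> \<le> \<bar>a\<^sup>2 + b\<^sup>2\<bar>" for a b :: real
  proof -
    have "2 * (\<bar>a\<bar> * \<bar>b\<bar>) \<le> a\<^sup>2 + b\<^sup>2" "0 \<le> \<bar>a\<bar> * \<bar>b\<bar>"
      using sum_squares_bound[of "\<bar>a\<bar>" "\<bar>b\<bar>"] by (simp_all add: mult.assoc)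
    then have "\<bar>a\<bar> * \<bar>b\<bar> \<le> a\<^sup>2 + b\<^sup>2"
      by linarith
    then show ?thesis
      by (simp add: abs_mult)
  qed
  then show "AE x in M. norm (f x * g x) \<le> norm ((f x)\<^sup>2 + (g x)\<^sup>2)"
    by simp
qed

lemma L2_zero [simp]: "(\<lambda>_. 0) \<in> L2 M"
  by (simp add: L2_def)

lemma L2_cmult: "f \<in> L2 M \<Longrightarrow> (\<lambda>x. c * f x) \<in> L2 M"
  by (auto simp: L2_def power_mult_distrib)

lemma L2_add:
  assumes "f \<in> L2 M" "g \<in> L2 M"
  shows "(\<lambda>x. f x + g x) \<in> L2 M"
proof -
  have "integrable M (\<lambda>x. (f x)\<^sup>2 + (g x)\<^sup>2 + 2 * (f x * g x))"
    using L2_mult[OF assms] assms by (auto simp: L2_def)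
  then show ?thesis
    using assms by (auto simp: L2_def power2_sum mult.assoc)
qed

lemma L2_diff: "f \<in> L2 M \<Longrightarrow> g \<in> L2 M \<Longrightarrow> (\<lambda>x. f x - g x) \<in> L2 M"
  using L2_add[of f M "\<lambda>x. (-1) * g x"] L2_cmult[of g M "-1"] by simp

lemma L2_sum: "(\<And>i. i \<in> I \<Longrightarrow> f i \<in> L2 M) \<Longrightarrow> (\<lambda>x. \<Sum>i\<in>I. f i x) \<in> L2 M"
  by (induction I rule: infinite_finite_induct) (auto intro: L2_add)

lemma (in finite_measure) L2_bounded:
  assumes "f \<in> borel_measurable M" "AE x in M. \<bar>f x\<bar> \<le> B"
  shows "f \<in> L2 M"
proof -
  have "AE x in M. norm ((f x)\<^sup>2) \<le> B\<^sup>2"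
    using assms(2)
  proof (eventually_elim)
    case (elim x)
    then show ?case
      using abs_le_square_iff[of "f x" B] by simp
  qed
  then show ?thesis
    using assms(1) integrable_const_bound[of "\<lambda>x. (f x)\<^sup>2"] by (auto simp: L2_def)
qed

lemma (in finite_measure) L2_const [simp]: "(\<lambda>_. c) \<in> L2 M"
  by (rule L2_bounded[where B="\<bar>c\<bar>"]) auto

lemma (in finite_measure) L2_indicator: "S \<in> sets M \<Longrightarrow> indicator S \<in> L2 M"
  by (rule L2_bounded[where B=1]) (auto simp: indicator_def)

lemma (in finite_measure) L2_integrable: "f \<in> L2 M \<Longrightarrow> integrable M f"
  using L2_mult[of f M "\<lambda>_. 1"] by simp

lemma Cauchy_Schwarz_L2:
  assumes "f \<in> L2 M" "g \<in> L2 M"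
  shows "\<bar>\<integral>x. f x * g x \<partial>M\<bar> \<le> norm2 M f * norm2 M g"
proof -
  define p q s where "p = (\<integral>x. (f x)\<^sup>2 \<partial>M)" and "q = (\<integral>x. f x * g x \<partial>M)" and "s = (\<integral>x. (g x)\<^sup>2 \<partial>M)"
  have pos: "0 \<le> p + 2 * t * q + t\<^sup>2 * s" for t
  proof -
    have "0 \<le> (\<integral>x. (f x + t * g x)\<^sup>2 \<partial>M)"
      by simp
    also have "\<dots> = (\<integral>x. (f x)\<^sup>2 + 2 * t * (f x * g x) + t\<^sup>2 * (g x)\<^sup>2 \<partial>M)"
      by (intro Bochner_Integration.integral_cong) (auto simp: power2_eq_square algebra_simps)
    also have "\<dots> = p + 2 * t * q + t\<^sup>2 * s"
      using L2_mult[OF assms] L2_square[OF assms(1)] L2_square[OF assms(2)]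
      by (simp add: p_def q_def s_def)
    finally show ?thesis .
  qed
  have s0: "0 \<le> s"
    by (simp add: s_def)
  have "q\<^sup>2 \<le> p * s"
  proof (cases "s = 0")
    case True
    have "q = 0"
    proof (rule ccontr)
      assume "q \<noteq> 0"
      then show False
        using pos[of "- (p + 1) / (2 * q)"] True by (simp add: field_simps)
    qed
    then show ?thesis
      using True by simp
  next
    case False
    then show ?thesis
      \<comment> \<open>The quadratic polynomial attains its minimum at \<open>- q / s\<close>.\<close>
      using pos[of "- q / s"] s0
      by (simp add: field_simps power2_eq_square split: if_splits)
  qed
  then have "\<bar>q\<bar> \<le> sqrt (p * s)"
    by (metis real_sqrt_abs real_sqrt_le_mono)
  then show ?thesis
    by (simp add: norm2_def p_def q_def s_def real_sqrt_mult)
qed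

lemma norm2_triangle:
  assumes "f \<in> L2 M" "g \<in> L2 M"
  shows "norm2 M (\<lambda>x. f x + g x) \<le> norm2 M f + norm2 M g"
proof -
  have "(norm2 M (\<lambda>x. f x + g x))\<^sup>2 = (\<integral>x. (f x)\<^sup>2 + 2 * (f x * g x) + (g x)\<^sup>2 \<partial>M)"
    by (simp add: norm2_square power2_sum algebra_simps)
  also have "\<dots> = (norm2 M f)\<^sup>2 + 2 * (\<integral>x. f x * g x \<partial>M) + (norm2 M g)\<^sup>2"
    using L2_mult[OF assms] L2_square[OF assms(1)] L2_square[OF assms(2)]
    by (simp add: norm2_square)
  also have "\<dots> \<le> (norm2 M f)\<^sup>2 + 2 * (norm2 M f * norm2 M g) + (norm2 M g)\<^sup>2"
    using Cauchy_Schwarz_L2[OF assms] by linarith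
  also have "\<dots> = (norm2 M f + norm2 M g)\<^sup>2"
    by (simp add: power2_sum)
  finally show ?thesis
    by (rule power2_le_imp_le) simp
qed

lemma norm2_cmult: "norm2 M (\<lambda>x. c * f x) = \<bar>c\<bar> * norm2 M f"
  by (simp add: norm2_def power_mult_distrib real_sqrt_mult)

lemma norm2_triangle_diff:
  assumes "f \<in> L2 M" "g \<in> L2 M" "h \<in> L2 M"
  shows "norm2 M (\<lambda>x. f x - h x) \<le> norm2 M (\<lambda>x. f x - g x) + norm2 M (\<lambda>x. g x - h x)"
  using norm2_triangle[OF L2_diff[OF assms(1,2)] L2_diff[OF assms(2,3)]] by simp

lemma norm2_null:
  assumes "u \<longlonglongrightarrow> 0" "\<And>i. norm2 M (f i) \<le> u i"
  shows "(\<lambda>i. norm2 M (f i)) \<longlonglongrightarrow> 0"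
  using assms by (intro Lim_null_comparison[OF _ assms(1)]) auto

lemma norm2_cong_AE:
  assumes "f \<in> borel_measurable M" "g \<in> borel_measurable M" "AE x in M. f x = g x"
  shows "norm2 M f = norm2 M g"
  unfolding norm2_def using assms by (intro arg_cong[where f=sqrt] integral_cong_AE) auto

lemma norm2_le_orthogonal:
  assumes f: "f \<in> L2 M" and g: "g \<in> L2 M" and o: "(\<integral>x. f x * g x \<partial>M) = 0"
  shows "norm2 M f \<le> norm2 M (\<lambda>x. f x + g x)"
proof -
  have "(norm2 M (\<lambda>x. f x + g x))\<^sup>2 = (\<integral>x. (f x)\<^sup>2 + 2 * (f x * g x) + (g x)\<^sup>2 \<partial>M)"
    by (simp add: norm2_square power2_sum algebra_simps)
  also have "\<dots> = (norm2 M f)\<^sup>2 + (norm2 M g)\<^sup>2"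
    using L2_mult[OF f g] L2_square[OF f] L2_square[OF g] o by (simp add: norm2_square)
  finally have "(norm2 M f)\<^sup>2 \<le> (norm2 M (\<lambda>x. f x + g x))\<^sup>2"
    by simp
  then show ?thesis
    by (rule power2_le_imp_le) simp
qed

text \<open>Finite linear combinations, built one summand at a time: a property of all of them is then proved
  by induction on the number of summands.\<close>

inductive_set lspan :: "('a \<Rightarrow> real) set \<Rightarrow> ('a \<Rightarrow> real) set" for V where
  zero: "(\<lambda>_. 0) \<in> lspan V"
| step: "f \<in> V \<Longrightarrow> g \<in> lspan V \<Longrightarrow> (\<lambda>x. c * f x + g x) \<in> lspan V"

lemma lspan_base: "f \<in> V \<Longrightarrow> f \<in> lspan V"
  using lspan.step[OF _ lspan.zero, of f V 1] by simp

lemma lspan_add: "f \<in> lspan V \<Longrightarrow> g \<in> lspan V \<Longrightarrow> (\<lambda>x. f x + g x) \<in> lspan V"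
proof (induction rule: lspan.induct)
  case (step f g' c)
  then show ?case
    using lspan.step[of f V "\<lambda>x. g' x + g x" c] by (simp add: add.assoc)
qed simp

lemma lspan_cmult: "f \<in> lspan V \<Longrightarrow> (\<lambda>x. c * f x) \<in> lspan V"
proof (induction rule: lspan.induct)
  case (step f g d)
  then show ?case
    using lspan.step[of f V "\<lambda>x. c * g x" "c * d"] by (simp add: algebra_simps)
qed (simp add: lspan.zero)

lemma lspan_diff: "f \<in> lspan V \<Longrightarrow> g \<in> lspan V \<Longrightarrow> (\<lambda>x. f x - g x) \<in> lspan V"
  using lspan_add[of f V "\<lambda>x. (-1) * g x"] lspan_cmult[of g V "-1"] by simp

lemma lspan_mult:
  assumes "\<And>f g. f \<in> V \<Longrightarrow> g \<in> V \<Longrightarrow> (\<lambda>x. f x * g x) \<in> V"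
    and "f \<in> lspan V" "g \<in> lspan V"
  shows "(\<lambda>x. f x * g x) \<in> lspan V"
  using assms(2)
proof (induction rule: lspan.induct)
  case (step f f' c)
  have "(\<lambda>x. f x * g x) \<in> lspan V"
    using assms(3)
  proof (induction rule: lspan.induct)
    case (step h h' d)
    then show ?case
      using lspan.step[OF assms(1)[OF \<open>f \<in> V\<close> \<open>h \<in> V\<close>], of "\<lambda>x. f x * h' x" d]
      by (simp add: algebra_simps)
  qed (simp add: lspan.zero)
  then show ?case
    using lspan_add[OF lspan_cmult[of "\<lambda>x. f x * g x" V c] step.IH] by (simp add: algebra_simps)
qed (simp add: lspan.zero)

lemma lspan_L2: "V \<subseteq> L2 M \<Longrightarrow> f \<in> lspan V \<Longrightarrow> f \<in> L2 M"
  by (rotate_tac 1, induction rule: lspan.induct) (auto intro!: L2_add L2_cmult)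

definition L2_closure :: "'a measure \<Rightarrow> ('a \<Rightarrow> real) set \<Rightarrow> ('a \<Rightarrow> real) set" where
  "L2_closure M V = {f \<in> L2 M. \<forall>e>0. \<exists>g\<in>lspan V. norm2 M (\<lambda>x. f x - g x) < e}"

lemma L2_closureI:
  "f \<in> L2 M \<Longrightarrow> (\<And>e. e > 0 \<Longrightarrow> \<exists>g\<in>lspan V. norm2 M (\<lambda>x. f x - g x) < e) \<Longrightarrow> f \<in> L2_closure M V"
  by (simp add: L2_closure_def)

lemma L2_closure_L2: "f \<in> L2_closure M V \<Longrightarrow> f \<in> L2 M"
  by (simp add: L2_closure_def)

lemma L2_closureD:
  "f \<in> L2_closure M V \<Longrightarrow> e > 0 \<Longrightarrow> \<exists>g\<in>lspan V. norm2 M (\<lambda>x. f x - g x) < e"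
  by (simp add: L2_closure_def)

lemma L2_closure_zero: "(\<lambda>_. 0) \<in> L2_closure M V"
  by (rule L2_closureI) (auto intro!: bexI[of _ "\<lambda>_. 0"] lspan.zero simp: norm2_def)

lemma L2_closure_add:
  assumes V: "V \<subseteq> L2 M" and f: "f \<in> L2_closure M V" and g: "g \<in> L2_closure M V"
  shows "(\<lambda>x. f x + g x) \<in> L2_closure M V"
proof (rule L2_closureI)
  show "(\<lambda>x. f x + g x) \<in> L2 M"
    using f g by (intro L2_add L2_closure_L2)
  fix e :: real
  assume "e > 0"
  then obtain f' g' where *: "f' \<in> lspan V" "g' \<in> lspan V"
    "norm2 M (\<lambda>x. f x - f' x) < e / 2" "norm2 M (\<lambda>x. g x - g' x) < e / 2"
    using L2_closureD[OF f, of "e / 2"] L2_closureD[OF g, of "e / 2"] by auto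
  have "norm2 M (\<lambda>x. (f x - f' x) + (g x - g' x)) < e"
    using norm2_triangle[of "\<lambda>x. f x - f' x" M "\<lambda>x. g x - g' x"] *
    using L2_diff[OF L2_closure_L2[OF f] lspan_L2[OF V *(1)]] L2_diff[OF L2_closure_L2[OF g] lspan_L2[OF V *(2)]]
    by linarith
  then show "\<exists>h\<in>lspan V. norm2 M (\<lambda>x. f x + g x - h x) < e"
    using lspan_add[OF *(1,2)] by (intro bexI[of _ "\<lambda>x. f' x + g' x"]) (simp_all add: algebra_simps)
qed

lemma L2_closure_cmult:
  assumes V: "V \<subseteq> L2 M" and f: "f \<in> L2_closure M V"
  shows "(\<lambda>x. c * f x) \<in> L2_closure M V"
proof (rule L2_closureI)
  show "(\<lambda>x. c * f x) \<in> L2 M"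
    using f by (intro L2_cmult L2_closure_L2)
  fix e :: real
  assume "e > 0"
  then obtain f' where *: "f' \<in> lspan V" "norm2 M (\<lambda>x. f x - f' x) < e / (\<bar>c\<bar> + 1)"
    using L2_closureD[OF f, of "e / (\<bar>c\<bar> + 1)"] by auto
  have "norm2 M (\<lambda>x. c * f x - c * f' x) = \<bar>c\<bar> * norm2 M (\<lambda>x. f x - f' x)"
    using norm2_cmult[of M c "\<lambda>x. f x - f' x"] by (simp add: algebra_simps)
  also have "\<dots> \<le> (\<bar>c\<bar> + 1) * norm2 M (\<lambda>x. f x - f' x)"
    by (intro mult_right_mono) auto
  also have "\<dots> < e"
    using *(2) pos_less_divide_eq[of "\<bar>c\<bar> + 1" "norm2 M (\<lambda>x. f x - f' x)" e] by (simp add: mult.commute)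
  finally show "\<exists>h\<in>lspan V. norm2 M (\<lambda>x. c * f x - h x) < e"
    using lspan_cmult[OF *(1)] by (intro bexI[of _ "\<lambda>x. c * f' x"]) auto
qed

lemma L2_closure_sum:
  assumes "V \<subseteq> L2 M" "\<And>i. i \<in> I \<Longrightarrow> f i \<in> L2_closure M V"
  shows "(\<lambda>x. \<Sum>i\<in>I. f i x) \<in> L2_closure M V"
  using assms(2)
  by (induction I rule: infinite_finite_induct) (auto intro: L2_closure_add[OF assms(1)] L2_closure_zero)

lemma L2_closure_limit:
  assumes V: "V \<subseteq> L2 M" and f: "f \<in> L2 M"
    and *: "\<And>e. e > 0 \<Longrightarrow> \<exists>g\<in>L2_closure M V. norm2 M (\<lambda>x. f x - g x) < e"
  shows "f \<in> L2_closure M V"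
proof (rule L2_closureI[OF f])
  fix e :: real
  assume "e > 0"
  then obtain g where g: "g \<in> L2_closure M V" "norm2 M (\<lambda>x. f x - g x) < e / 2"
    using *[of "e / 2"] by auto
  then obtain h where h: "h \<in> lspan V" "norm2 M (\<lambda>x. g x - h x) < e / 2"
    using L2_closureD[of g M V "e / 2"] \<open>e > 0\<close> by auto
  have "norm2 M (\<lambda>x. f x - h x) < e"
    using norm2_triangle_diff[OF f L2_closure_L2[OF g(1)] lspan_L2[OF V h(1)]] g(2) h(2) by linarith
  with h(1) show "\<exists>h\<in>lspan V. norm2 M (\<lambda>x. f x - h x) < e"
    by auto
qed

text \<open>Simple functions are dense in \<open>L\<^sub>2\<close> and are linear combinations of indicators.\<close>

lemma L2_closure_UNIV:
  assumes V: "V \<subseteq> L2 M" and ind: "\<And>S. S \<in> sets M \<Longrightarrow> indicator S \<in> L2_closure M V"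
    and f: "f \<in> L2 M"
  shows "f \<in> L2_closure M V"
proof (rule L2_closure_limit[OF V f])
  have "\<exists>s. (\<forall>i. simple_function M (s i)) \<and> (\<forall>x\<in>space M. (\<lambda>i. s i x) \<longlonglongrightarrow> f x)
      \<and> (\<forall>i. \<forall>x\<in>space M. \<bar>s i x\<bar> \<le> 2 * \<bar>f x\<bar>)"
    using borel_measurable_implies_sequence_metric[OF L2_measurable[OF f], of 0] by simp
  then obtain s where s: "\<And>i. simple_function M (s i)"
    "\<And>x. x \<in> space M \<Longrightarrow> (\<lambda>i. s i x) \<longlonglongrightarrow> f x"
    "\<And>i x. x \<in> space M \<Longrightarrow> \<bar>s i x\<bar> \<le> 2 * \<bar>f x\<bar>"
    by blast
  have [measurable]: "f \<in> borel_measurable M" "\<And>i. s i \<in> borel_measurable M"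
    using L2_measurable[OF f] borel_measurable_simple_function[OF s(1)] by auto
  have cl: "(\<lambda>x. \<Sum>y\<in>s i ` space M. y * indicator (s i -` {y} \<inter> space M) x) \<in> L2_closure M V" for i
    using s(1)[of i] by (intro L2_closure_sum[OF V] L2_closure_cmult[OF V] ind) (auto simp: simple_function_def)
  have eq: "(\<Sum>y\<in>s i ` space M. y * indicator (s i -` {y} \<inter> space M) x) = s i x" if "x \<in> space M" for i x
  proof -
    have "(\<Sum>y\<in>s i ` space M. y * indicator (s i -` {y} \<inter> space M) x)
        = (\<Sum>y\<in>s i ` space M. if y = s i x then y else 0)"
      using that by (intro sum.cong) (auto simp: indicator_def)
    also have "\<dots> = s i x"
      using that s(1)[of i] by (simp add: simple_function_def)
    finally show ?thesis .
  qed
  have "(\<lambda>i. \<integral>x. (f x - s i x)\<^sup>2 \<partial>M) \<longlonglongrightarrow> (\<integral>x. 0 \<partial>M)"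
  proof (rule integral_dominated_convergence[where w="\<lambda>x. 9 * (f x)\<^sup>2"])
    show "integrable M (\<lambda>x. 9 * (f x)\<^sup>2)"
      using L2_square[OF f] by simp
    show "AE x in M. (\<lambda>i. (f x - s i x)\<^sup>2) \<longlonglongrightarrow> 0"
    proof (rule AE_I2)
      fix x
      assume "x \<in> space M"
      then have "(\<lambda>i. (f x - s i x)\<^sup>2) \<longlonglongrightarrow> (f x - f x)\<^sup>2"
        by (intro tendsto_intros s(2))
      then show "(\<lambda>i. (f x - s i x)\<^sup>2) \<longlonglongrightarrow> 0"
        by simp
    qed
    show "AE x in M. norm ((f x - s i x)\<^sup>2) \<le> 9 * (f x)\<^sup>2" for i
    proof (rule AE_I2)
      fix x
      assume "x \<in> space M"
      then have "\<bar>f x - s i x\<bar> \<le> \<bar>3 * f x\<bar>"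
        using s(3)[of x i] by auto
      then have "(f x - s i x)\<^sup>2 \<le> (3 * f x)\<^sup>2"
        by (simp only: abs_le_square_iff)
      then show "norm ((f x - s i x)\<^sup>2) \<le> 9 * (f x)\<^sup>2"
        by simp
    qed
  qed auto
  then have lim: "(\<lambda>i. norm2 M (\<lambda>x. f x - s i x)) \<longlonglongrightarrow> 0"
    unfolding norm2_def using tendsto_real_sqrt[of _ 0] by simp
  fix e :: real
  assume "e > 0"
  then obtain i where i: "norm2 M (\<lambda>x. f x - s i x) < e"
    using order_tendstoD(2)[OF lim] by (auto simp: eventually_sequentially)
  have "norm2 M (\<lambda>x. f x - (\<Sum>y\<in>s i ` space M. y * indicator (s i -` {y} \<inter> space M) x))
      = norm2 M (\<lambda>x. f x - s i x)"
    by (rule norm2_cong) (simp add: eq)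
  then show "\<exists>g\<in>L2_closure M V. norm2 M (\<lambda>x. f x - g x) < e"
    using cl[of i] i by (intro bexI[OF _ cl[of i]]) simp
qed

text \<open>On a norm-bounded sequence the scalar products with the elements of a total set decide about weak
  convergence, since a general \<open>F\<close> is replaced by a linear combination up to a uniformly small
  error.\<close>

lemma weak_convergence_L2:
  assumes V: "V \<subseteq> L2 M" and F: "F \<in> L2_closure M V"
    and W: "\<And>i. W i \<in> L2 M" "\<And>i. norm2 M (W i) \<le> B" and U: "U \<in> L2 M" "norm2 M U \<le> B"
    and lim: "\<And>v. v \<in> V \<Longrightarrow> (\<lambda>i. \<integral>x. v x * W i x \<partial>M) \<longlonglongrightarrow> (\<integral>x. v x * U x \<partial>M)"
  shows "(\<lambda>i. \<integral>x. F x * W i x \<partial>M) \<longlonglongrightarrow> (\<integral>x. F x * U x \<partial>M)"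
proof (rule LIMSEQ_I)
  fix e :: real
  assume e: "e > 0"
  have B: "B \<ge> 0"
    using U(2) norm2_nonneg[of M U] by linarith
  obtain g where g: "g \<in> lspan V" "norm2 M (\<lambda>x. F x - g x) < e / (3 * (B + 1))"
    using L2_closureD[OF F, of "e / (3 * (B + 1))"] e B by auto
  have gL: "g \<in> L2 M" and FL: "F \<in> L2 M"
    using lspan_L2[OF V g(1)] L2_closure_L2[OF F] by auto
  have glim: "(\<lambda>i. \<integral>x. g x * W i x \<partial>M) \<longlonglongrightarrow> (\<integral>x. g x * U x \<partial>M)"
    using g(1)
  proof (induction rule: lspan.induct)
    case (step v g c)
    have v: "v \<in> L2 M" "g \<in> L2 M"
      using step V lspan_L2[OF V] by auto
    have "(\<integral>x. (c * v x + g x) * X x \<partial>M) = c * (\<integral>x. v x * X x \<partial>M) + (\<integral>x. g x * X x \<partial>M)"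
      if "X \<in> L2 M" for X
      using L2_mult[OF v(1) that] L2_mult[OF v(2) that] by (simp add: distrib_right mult.assoc)
    then show ?case
      using step.IH lim[OF step(1)] W U by (simp add: tendsto_add tendsto_mult)
  qed simp
  have small: "\<bar>(\<integral>x. F x * X x \<partial>M) - (\<integral>x. g x * X x \<partial>M)\<bar> < e / 3" if X: "X \<in> L2 M" "norm2 M X \<le> B" for X
  proof -
    have "(\<integral>x. F x * X x \<partial>M) - (\<integral>x. g x * X x \<partial>M) = (\<integral>x. (F x - g x) * X x \<partial>M)"
      using L2_mult[OF FL X(1)] L2_mult[OF gL X(1)] by (simp add: left_diff_distrib)
    then have "\<bar>(\<integral>x. F x * X x \<partial>M) - (\<integral>x. g x * X x \<partial>M)\<bar> \<le> norm2 M (\<lambda>x. F x - g x) * norm2 M X"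
      using Cauchy_Schwarz_L2[OF L2_diff[OF FL gL] X(1)] by simp
    also have "\<dots> \<le> norm2 M (\<lambda>x. F x - g x) * (B + 1)"
      using X(2) by (intro mult_left_mono) auto
    also have "\<dots> < e / (3 * (B + 1)) * (B + 1)"
      using g(2) B by (intro mult_strict_right_mono) auto
    also have "\<dots> = e / 3"
      using B by (simp add: field_simps)
    finally show ?thesis .
  qed
  obtain n0 where "\<And>n. n \<ge> n0 \<Longrightarrow> \<bar>(\<integral>x. g x * W n x \<partial>M) - (\<integral>x. g x * U x \<partial>M)\<bar> < e / 3"
    using LIMSEQ_D[OF glim, of "e / 3"] e by auto
  then show "\<exists>n0. \<forall>n\<ge>n0. norm ((\<integral>x. F x * W n x \<partial>M) - (\<integral>x. F x * U x \<partial>M)) < e"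
  proof (intro exI[of _ n0] allI impI)
    fix n
    assume "n \<ge> n0" and *: "\<And>n. n \<ge> n0 \<Longrightarrow> \<bar>(\<integral>x. g x * W n x \<partial>M) - (\<integral>x. g x * U x \<partial>M)\<bar> < e / 3"
    then show "norm ((\<integral>x. F x * W n x \<partial>M) - (\<integral>x. F x * U x \<partial>M)) < e"
      unfolding real_norm_def
      using small[OF U] small[OF W(1)[of n] W(2)[of n]] *[OF \<open>n \<ge> n0\<close>] by linarith
  qed
qed

section \<open>Approximation of measurable sets by an algebra\<close>

lemma (in finite_measure) measure_sym_diff_triangle:
  assumes "A \<in> sets M" "B \<in> sets M" "C \<in> sets M"
  shows "measure M (sym_diff A C) \<le> measure M (sym_diff A B) + measure M (sym_diff B C)"
proof -
  have "measure M (sym_diff A C) \<le> measure M (sym_diff A B \<union> sym_diff B C)"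
    using assms by (intro finite_measure_mono) auto
  also have "\<dots> \<le> measure M (sym_diff A B) + measure M (sym_diff B C)"
    using assms by (intro measure_Un_le) auto
  finally show ?thesis .
qed

text \<open>Two measures are approximated at once, so that the lemma yields both density in one measure and
  the equality of two measures that agree on the algebra.\<close>

lemma approximable_sigma_algebra:
  fixes N N' :: "'a measure"
  assumes fin: "finite_measure N" "finite_measure N'" and eq: "sets N' = sets N"
    and sub: "\<B> \<subseteq> sets N" and empty: "{} \<in> \<B>"
    and compl: "\<And>B. B \<in> \<B> \<Longrightarrow> space N - B \<in> \<B>"
    and un: "\<And>B C. B \<in> \<B> \<Longrightarrow> C \<in> \<B> \<Longrightarrow> B \<union> C \<in> \<B>"
  shows "sigma_algebra (space N) {S \<in> sets N.
    \<forall>e>0. \<exists>B\<in>\<B>. measure N (sym_diff S B) < e \<and> measure N' (sym_diff S B) < e}" (is "sigma_algebra _ ?A")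
proof -
  interpret N: finite_measure N by fact
  interpret N': finite_measure N' by fact
  have approx: "\<exists>B\<in>\<B>. measure N (sym_diff S B) < e \<and> measure N' (sym_diff S B) < e" if "S \<in> ?A" "e > 0" for S e
    using that by auto
  have binary: "S \<union> T \<in> ?A" if S: "S \<in> ?A" and T: "T \<in> ?A" for S T
  proof -
    have "\<exists>B\<in>\<B>. measure N (sym_diff (S \<union> T) B) < e \<and> measure N' (sym_diff (S \<union> T) B) < e" if e: "e > 0" for e
    proof -
      obtain B C where B: "B \<in> \<B>" "measure N (sym_diff S B) < e / 2" "measure N' (sym_diff S B) < e / 2"
        and C: "C \<in> \<B>" "measure N (sym_diff T C) < e / 2" "measure N' (sym_diff T C) < e / 2"
        using approx[OF S, of "e / 2"] approx[OF T, of "e / 2"] e by auto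
      have m: "sym_diff S B \<in> sets N" "sym_diff T C \<in> sets N" "sym_diff (S \<union> T) (B \<union> C) \<in> sets N"
        using S T B(1) C(1) sub by auto
      have s: "sym_diff (S \<union> T) (B \<union> C) \<subseteq> sym_diff S B \<union> sym_diff T C"
        by auto
      have "measure N (sym_diff (S \<union> T) (B \<union> C)) \<le> measure N (sym_diff S B) + measure N (sym_diff T C)"
        using N.finite_measure_mono[OF s] measure_Un_le[OF m(1,2)] m by (auto intro: order_trans)
      moreover have "measure N' (sym_diff (S \<union> T) (B \<union> C)) \<le> measure N' (sym_diff S B) + measure N' (sym_diff T C)"
        using N'.finite_measure_mono[OF s] measure_Un_le[of "sym_diff S B" N' "sym_diff T C"] m eq
        by (auto intro: order_trans)
      ultimately show ?thesis
        using B C un[OF B(1) C(1)] by (intro bexI[of _ "B \<union> C"]) auto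
    qed
    then show ?thesis
      using S T by auto
  qed
  show ?thesis
    unfolding sigma_algebra_iff2
  proof (intro conjI ballI allI impI)
    show "?A \<subseteq> Pow (space N)"
      by (auto dest: sets.sets_into_space)
    show "{} \<in> ?A"
      using empty by (auto intro!: bexI[of _ "{}"])
    show "space N - S \<in> ?A" if S: "S \<in> ?A" for S
    proof -
      have "\<exists>B\<in>\<B>. measure N (sym_diff (space N - S) B) < e \<and> measure N' (sym_diff (space N - S) B) < e"
        if e: "e > 0" for e
      proof -
        obtain B where B: "B \<in> \<B>" "measure N (sym_diff S B) < e" "measure N' (sym_diff S B) < e"
          using approx[OF S e] by auto
        have "sym_diff (space N - S) (space N - B) = sym_diff S B"
          using S B(1) sub sets.sets_into_space by blast
        then show ?thesis
          using B compl[OF B(1)] by (intro bexI[of _ "space N - B"]) auto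
      qed
      then show ?thesis
        using S by auto
    qed
    show "(\<Union>i. S i) \<in> ?A" if S: "range S \<subseteq> ?A" for S :: "nat \<Rightarrow> 'a set"
    proof -
      have Sm: "S i \<in> sets N" for i
        using S by auto
      define U where "U n = (\<Union>i<n. S i)" for n
      have Um: "U n \<in> sets N" for n
        using Sm by (auto simp: U_def)
      have UA: "U n \<in> ?A" for n
      proof (induction n)
        case (Suc n)
        have "U (Suc n) = U n \<union> S n"
          by (auto simp: U_def less_Suc_eq)
        then show ?case
          using binary[OF Suc subsetD[OF S rangeI[of S n]]] by (simp only:)
      qed (use \<open>{} \<in> ?A\<close> in \<open>simp add: U_def\<close>)
      have inc: "incseq U" and Uun: "(\<Union>n. U n) = (\<Union>i. S i)"
        by (auto simp: U_def incseq_def intro: lessI) fastforce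
      have l: "(\<lambda>n. measure N (U n)) \<longlonglongrightarrow> measure N (\<Union>i. S i)"
        using N.finite_Lim_measure_incseq[of U] Um inc by (auto simp: Uun[symmetric])
      have l': "(\<lambda>n. measure N' (U n)) \<longlonglongrightarrow> measure N' (\<Union>i. S i)"
        using N'.finite_Lim_measure_incseq[of U] Um inc eq by (auto simp: Uun[symmetric])
      have "\<exists>B\<in>\<B>. measure N (sym_diff (\<Union>i. S i) B) < e \<and> measure N' (sym_diff (\<Union>i. S i) B) < e"
        if e: "e > 0" for e
      proof -
        have "\<forall>\<^sub>F n in sequentially. measure N (\<Union>i. S i) - e / 2 < measure N (U n)
            \<and> measure N' (\<Union>i. S i) - e / 2 < measure N' (U n)"
          using e by (intro eventually_conj order_tendstoD(1)[OF l] order_tendstoD(1)[OF l']) auto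
        then obtain n where n: "measure N (\<Union>i. S i) - e / 2 < measure N (U n)"
          "measure N' (\<Union>i. S i) - e / 2 < measure N' (U n)"
          by (auto simp: eventually_sequentially)
        obtain B where B: "B \<in> \<B>" "measure N (sym_diff (U n) B) < e / 2" "measure N' (sym_diff (U n) B) < e / 2"
          using approx[OF UA[of n], of "e / 2"] e by auto
        have Un: "U n \<subseteq> (\<Union>i. S i)" "(\<Union>i. S i) \<in> sets N"
          using Sm by (auto simp: U_def)
        have d: "sym_diff (\<Union>i. S i) (U n) = (\<Union>i. S i) - U n"
          using Un by auto
        have "measure N (sym_diff (\<Union>i. S i) (U n)) < e / 2" "measure N' (sym_diff (\<Union>i. S i) (U n)) < e / 2"
          unfolding d using n N.finite_measure_Diff[OF Un(2) Um Un(1)] N'.finite_measure_Diff[of "\<Union>i. S i" "U n"] Un Um eq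
          by auto
        then show ?thesis
          using B N.measure_sym_diff_triangle[OF Un(2) Um[of n], of B]
            N'.measure_sym_diff_triangle[of "\<Union>i. S i" "U n" B] Un(2) Um[of n] sub eq
          by (intro bexI[OF _ B(1)]) auto
      qed
      then show ?thesis
        using Sm by auto
    qed
  qed
qed

section \<open>Poisson measures\<close>

lemma fmeasurable_Int_sets: "A \<in> fmeasurable M \<Longrightarrow> B \<in> sets M \<Longrightarrow> A \<inter> B \<in> fmeasurable M"
  by (rule fmeasurableI2[of A]) auto

lemma exp_series: "(\<lambda>n. x ^ n / fact n) sums exp (x::real)"
  using exp_converges[of x] by (simp add: scaleR_conv_of_real divide_inverse mult.commute)

lemma exp_series_times_n: "(\<lambda>n. real n * (x ^ n / fact n)) sums (x * exp (x::real))"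
proof -
  have "(\<lambda>n. x * (x ^ n / fact n)) sums (x * exp x)"
    by (intro sums_mult exp_series)
  moreover have "x * (x ^ n / fact n) = real (Suc n) * (x ^ Suc n / fact (Suc n))" for n
    by (simp add: field_simps del: of_nat_Suc)
  ultimately show ?thesis
    using sums_Suc_imp[of "\<lambda>n. real n * (x ^ n / fact n)"] by simp
qed

lemma exp_series_times_n_square: "(\<lambda>n. (real n)\<^sup>2 * (x ^ n / fact n)) sums (x * exp x + x\<^sup>2 * exp (x::real))"
proof -
  have "(\<lambda>n. x * (real n * (x ^ n / fact n)) + x * (x ^ n / fact n)) sums (x * (x * exp x) + x * exp x)"
    by (intro sums_add sums_mult exp_series exp_series_times_n)
  moreover have "x * (real n * (x ^ n / fact n)) + x * (x ^ n / fact n) = (real (Suc n))\<^sup>2 * (x ^ Suc n / fact (Suc n))" for n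
    by (simp add: field_simps power2_eq_square del: of_nat_Suc) (simp add: algebra_simps)
  ultimately show ?thesis
    using sums_Suc_imp[of "\<lambda>n. (real n)\<^sup>2 * (x ^ n / fact n)"] by (simp add: power2_eq_square algebra_simps)
qed

text \<open>The rounding only changes the type: the measure of a set under a configuration is a natural number
  or infinite. In the latter case, which has probability zero for sets of finite intensity, the
  value is \<open>0\<close>.\<close>

definition points_in :: "'a set \<Rightarrow> 'a measure \<Rightarrow> nat" where
  "points_in A \<omega> = nat \<lfloor>measure \<omega> A\<rfloor>"

text \<open>The indicator is cut down to the space of configurations so that products of such functions are
  again of this form at every argument.\<close>

definition void :: "'a measure \<Rightarrow> 'a set \<Rightarrow> 'a measure \<Rightarrow> real" where
  "void M C = indicator {\<omega> \<in> configurations M. emeasure \<omega> C = 0}"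

text \<open>These functions span the first chaos.\<close>

definition compensated :: "'a measure \<Rightarrow> 'a set \<Rightarrow> 'a measure \<Rightarrow> real" where
  "compensated M A \<omega> = real (points_in A \<omega>) - measure M A"

text \<open>The normalized exponential vectors of Fock space; the scalar product of those with parameters \<open>z\<close>,
  \<open>A\<close> and \<open>y\<close>, \<open>B\<close> is \<open>exp (z y \<mu>(A \<inter> B))\<close>. For \<open>z = -1\<close> the vector is a multiple of the indicator
  of the event that \<open>A\<close> contains no point.\<close>

definition exp_vector :: "'a measure \<Rightarrow> real \<Rightarrow> 'a set \<Rightarrow> 'a measure \<Rightarrow> real" where
  "exp_vector M z A \<omega> = (1 + z) ^ points_in A \<omega> * exp (- z * measure M A)"

lemma configurations_sets: "\<omega> \<in> configurations M \<Longrightarrow> sets \<omega> = sets M"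
  by (auto simp: configurations_def)

lemma space_configuration_algebra: "space (configuration_algebra M) = configurations M"
  by (auto simp: configuration_algebra_def space_Sup_eq_UN)

lemma measurable_emeasure_configuration:
  "A \<in> sets M \<Longrightarrow> (\<lambda>\<omega>. emeasure \<omega> A) \<in> borel_measurable (configuration_algebra M)"
  by (auto intro!: measurable_Sup1 measurable_vimage_algebra1 simp: configuration_algebra_def)

lemma measurable_configuration_algebra:
  assumes "\<And>x. x \<in> space N \<Longrightarrow> K x \<in> configurations M"
    and "\<And>A. A \<in> sets M \<Longrightarrow> (\<lambda>x. emeasure (K x) A) \<in> borel_measurable N"
  shows "K \<in> measurable N (configuration_algebra M)"
  using assms by (auto intro!: measurable_Sup2 measurable_vimage_algebra2 simp: configuration_algebra_def)

lemma sets_configuration_algebra_subset: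
  assumes "space N = configurations M"
    and "\<And>A. A \<in> sets M \<Longrightarrow> (\<lambda>\<omega>. emeasure \<omega> A) \<in> borel_measurable N"
  shows "sets (configuration_algebra M) \<subseteq> sets N"
  unfolding configuration_algebra_def
proof (rule sets_Sup_in_sets)
  fix m
  assume "m \<in> (\<lambda>A. vimage_algebra (configurations M) (\<lambda>\<omega>. emeasure \<omega> A) borel) ` sets M"
  then obtain A where "A \<in> sets M" "m = vimage_algebra (configurations M) (\<lambda>\<omega>. emeasure \<omega> A) borel"
    by auto
  then show "space m = space N" "sets m \<subseteq> sets N"
    using assms sets_image_in_sets[of N "configurations M" "\<lambda>\<omega>. emeasure \<omega> A" borel] by simp_all
qed auto

lemma void_mult: "A \<in> sets M \<Longrightarrow> B \<in> sets M \<Longrightarrow> (\<lambda>\<omega>. void M A \<omega> * void M B \<omega>) = void M (A \<union> B)"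
proof
  fix \<omega>
  assume AB: "A \<in> sets M" "B \<in> sets M"
  show "void M A \<omega> * void M B \<omega> = void M (A \<union> B) \<omega>"
  proof (cases "\<omega> \<in> configurations M")
    case True
    then have "sets \<omega> = sets M"
      by (rule configurations_sets)
    then have "emeasure \<omega> (A \<union> B) = 0 \<longleftrightarrow> emeasure \<omega> A = 0 \<and> emeasure \<omega> B = 0"
      using AB emeasure_Un_null_set[of A \<omega> B] emeasure_mono[of A "A \<union> B" \<omega>] emeasure_mono[of B "A \<union> B" \<omega>]
      by (auto simp: null_sets_def)
    then show ?thesis
      by (auto simp: void_def indicator_def)
  qed (simp add: void_def)
qed

locale poisson_process = prob_space P for M :: "'a measure" and P :: "'a measure measure" +
  assumes poisson: "poisson_measure M P"
begin

lemma sets_P: "sets P = sets (configuration_algebra M)"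
  using poisson by (simp add: poisson_measure_def)

lemma space_P: "space P = configurations M"
  using sets_eq_imp_space_eq[OF sets_P] by (simp add: space_configuration_algebra)

lemma sets_point: "\<omega> \<in> space P \<Longrightarrow> sets \<omega> = sets M"
  by (simp add: space_P configurations_sets)

lemma measurable_emeasure_points [measurable]: "A \<in> sets M \<Longrightarrow> (\<lambda>\<omega>. emeasure \<omega> A) \<in> borel_measurable P"
  using measurable_emeasure_configuration[of A M] by (simp add: measurable_cong_sets[OF sets_P refl])

lemma measurable_points [measurable]: "A \<in> sets M \<Longrightarrow> points_in A \<in> measurable P (count_space UNIV)"
  unfolding points_in_def[abs_def] measure_def by measurable

lemma measurable_void [measurable]: "A \<in> sets M \<Longrightarrow> void M A \<in> borel_measurable P"
  unfolding void_def space_P[symmetric] by measurable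

lemma measurable_compensated [measurable]: "A \<in> sets M \<Longrightarrow> compensated M A \<in> borel_measurable P"
  unfolding compensated_def[abs_def] by (intro borel_measurable_diff borel_measurable_const) measurable

lemma measurable_exp_vector [measurable]: "A \<in> sets M \<Longrightarrow> exp_vector M z A \<in> borel_measurable P"
  unfolding exp_vector_def[abs_def] by (intro borel_measurable_times borel_measurable_const) measurable

text \<open>The Poisson probabilities of the finite values already add up to one.\<close>

lemma AE_points: 
  assumes A: "A \<in> fmeasurable M"
  shows "AE \<omega> in P. emeasure \<omega> A = of_nat (points_in A \<omega>)"
proof -
  have Am: "A \<in> sets M" "emeasure M A < \<infinity>"
    using A by (auto simp: fmeasurable_def)
  define E where "E n = {\<omega> \<in> space P. emeasure \<omega> A = of_nat n}" for n :: nat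
  have E: "E n \<in> sets P" for n
    unfolding E_def using Am by measurable
  have disj: "disjoint_family E"
    by (auto simp: disjoint_family_on_def E_def)
  have "prob (E n) = measure M A ^ n / fact n * exp (- measure M A)" for n
    using poisson Am by (simp add: poisson_measure_def E_def)
  moreover have "(\<lambda>n. prob (E n)) sums prob (\<Union>n. E n)"
    using E disj by (intro finite_measure_UNION) auto
  ultimately have "(\<lambda>n. measure M A ^ n / fact n * exp (- measure M A)) sums prob (\<Union>n. E n)"
    by simp
  moreover have "(\<lambda>n. measure M A ^ n / fact n * exp (- measure M A)) sums (exp (measure M A) * exp (- measure M A))"
    by (intro sums_mult2 exp_series)
  ultimately have "prob (\<Union>n. E n) = exp (measure M A) * exp (- measure M A)"
    by (rule sums_unique2)
  then have "prob (\<Union>n. E n) = 1"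
    by (simp add: exp_minus)
  then have "AE \<omega> in P. \<omega> \<in> (\<Union>n. E n)"
    using E by (intro AE_prob_1) auto
  then show ?thesis
  proof eventually_elim
    case (elim \<omega>)
    then obtain n where "emeasure \<omega> A = of_nat n"
      by (auto simp: E_def)
    moreover from this have "points_in A \<omega> = n"
      by (simp add: points_in_def measure_def)
    ultimately show ?case
      by simp
  qed
qed

lemma prob_points:
  assumes A: "A \<in> fmeasurable M"
  shows "prob {\<omega> \<in> space P. points_in A \<omega> = n} = measure M A ^ n / fact n * exp (- measure M A)"
proof -
  have [measurable]: "A \<in> sets M"
    using A by auto
  have "prob {\<omega> \<in> space P. points_in A \<omega> = n} = prob {\<omega> \<in> space P. emeasure \<omega> A = of_nat n}"
    by (rule finite_measure_eq_AE) (use AE_points[OF A] in \<open>auto\<close>)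
  then show ?thesis
    using poisson A by (simp add: poisson_measure_def fmeasurable_def)
qed

lemma integral_points:
  fixes g :: "nat \<Rightarrow> real"
  assumes A: "A \<in> fmeasurable M" and g: "\<And>n. 0 \<le> g n"
    and s: "(\<lambda>n. g n * (measure M A ^ n / fact n)) sums s"
  shows "has_bochner_integral P (\<lambda>\<omega>. g (points_in A \<omega>)) (s * exp (- measure M A))"
proof -
  have [measurable]: "A \<in> sets M"
    using A by auto
  define p where "p n = measure M A ^ n / fact n * exp (- measure M A)" for n
  have p0: "0 \<le> p n" for n
    by (simp add: p_def)
  have d: "distr P (count_space UNIV) (points_in A) = density (count_space UNIV) p"
  proof (rule measure_eqI_countable[where A=UNIV])
    fix n :: nat
    have "emeasure (distr P (count_space UNIV) (points_in A)) {n} = emeasure P {\<omega> \<in> space P. points_in A \<omega> = n}"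
      by (subst emeasure_distr) (auto intro!: arg_cong2[where f=emeasure])
    also have "\<dots> = ennreal (p n)"
      using prob_points[OF A] by (simp add: emeasure_eq_measure p_def)
    also have "\<dots> = emeasure (density (count_space UNIV) p) {n}"
      by (simp add: emeasure_density nn_integral_indicator_singleton[of n _ "\<lambda>n. ennreal (p n)"])
    finally show "emeasure (distr P (count_space UNIV) (points_in A)) {n} = emeasure (density (count_space UNIV) p) {n}" .
  qed auto
  have s': "(\<lambda>n. p n * g n) sums (s * exp (- measure M A))"
    using sums_mult2[OF s, of "exp (- measure M A)"] by (simp add: p_def mult_ac)
  have "integrable (count_space UNIV) (\<lambda>n. p n * g n)"
    using s' p0 g by (simp add: integrable_count_space_nat_iff sums_iff)
  then have "has_bochner_integral (count_space UNIV) (\<lambda>n. p n *\<^sub>R g n) (s * exp (- measure M A))"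
    using s' integral_count_space_nat[of "\<lambda>n. p n * g n"] by (simp add: has_bochner_integral_iff sums_iff)
  then have "has_bochner_integral (distr P (count_space UNIV) (points_in A)) g (s * exp (- measure M A))"
    unfolding d using p0 by (intro has_bochner_integral_density) auto
  then show ?thesis
    by (simp add: has_bochner_integral_iff integrable_distr_eq integral_distr)
qed

lemma integral_power_points:
  assumes A: "A \<in> fmeasurable M" and v: "0 \<le> v"
  shows "has_bochner_integral P (\<lambda>\<omega>. v ^ points_in A \<omega>) (exp ((v - 1) * measure M A))"
proof -
  have "(\<lambda>n. v ^ n * (measure M A ^ n / fact n)) sums exp (v * measure M A)"
    using exp_series[of "v * measure M A"] by (simp add: power_mult_distrib)
  then have "has_bochner_integral P (\<lambda>\<omega>. v ^ points_in A \<omega>) (exp (v * measure M A) * exp (- measure M A))"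
    using v by (intro integral_points[OF A, of "\<lambda>n. v ^ n"]) auto
  then show ?thesis
    by (simp add: mult_exp_exp left_diff_distrib)
qed

lemma integral_points_power_points:
  assumes A: "A \<in> fmeasurable M" and v: "0 \<le> v"
  shows "has_bochner_integral P (\<lambda>\<omega>. real (points_in A \<omega>) * v ^ points_in A \<omega>) (v * measure M A * exp ((v - 1) * measure M A))"
proof -
  have "(\<lambda>n. real n * v ^ n * (measure M A ^ n / fact n)) sums (v * measure M A * exp (v * measure M A))"
    using exp_series_times_n[of "v * measure M A"] by (simp add: power_mult_distrib mult.assoc)
  then have "has_bochner_integral P (\<lambda>\<omega>. real (points_in A \<omega>) * v ^ points_in A \<omega>)
      (v * measure M A * exp (v * measure M A) * exp (- measure M A))"
    using v by (intro integral_points[OF A, of "\<lambda>n. real n * v ^ n"]) auto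
  then show ?thesis
    by (simp add: mult_exp_exp left_diff_distrib mult.assoc)
qed

lemma integral_points_square:
  assumes A: "A \<in> fmeasurable M"
  shows "has_bochner_integral P (\<lambda>\<omega>. (real (points_in A \<omega>))\<^sup>2) (measure M A + (measure M A)\<^sup>2)"
  using integral_points[OF A, of "\<lambda>n. (real n)\<^sup>2", OF _ exp_series_times_n_square]
  by (simp add: distrib_right mult.assoc mult_exp_exp)

text \<open>Computations with overlapping sets will be reduced to pairs of disjoint pieces.\<close>

lemma indep_points:
  fixes f g :: "nat \<Rightarrow> real"
  assumes AB: "A \<in> sets M" "B \<in> sets M" "A \<inter> B = {}"
  shows "indep_var borel (\<lambda>\<omega>. f (points_in A \<omega>)) borel (\<lambda>\<omega>. g (points_in B \<omega>))"
proof -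
  define C :: "nat \<Rightarrow> 'a set" where "C i = (if i = 0 then A else if i = 1 then B else {})" for i
  have "range C \<subseteq> sets M" "disjoint_family C"
    using AB by (auto simp: C_def disjoint_family_on_def)
  then have "indep_vars (\<lambda>_. borel) (\<lambda>i \<omega>. emeasure \<omega> (C i)) UNIV"
    using poisson by (auto simp: poisson_measure_def)
  then have i: "indep_var (PiM {0} (\<lambda>_. borel)) (\<lambda>\<omega>. restrict (\<lambda>i. emeasure \<omega> (C i)) {0})
      (PiM {1} (\<lambda>_. borel)) (\<lambda>\<omega>. restrict (\<lambda>i. emeasure \<omega> (C i)) {1})"
    by (rule indep_var_restrict) auto
  define y :: "(nat \<Rightarrow> real) \<Rightarrow> nat \<Rightarrow> (nat \<Rightarrow> ennreal) \<Rightarrow> real" where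
    "y f i t = f (nat \<lfloor>enn2real (t i)\<rfloor>)" for f i t
  have y: "y f i \<in> borel_measurable (PiM {i} (\<lambda>_. borel))" for f i
    unfolding y_def[abs_def] by measurable
  show ?thesis
    using indep_var_compose[OF i y[of f 0] y[of g 1]]
    by (simp add: comp_def y_def C_def points_in_def measure_def)
qed

lemma AE_void:
  assumes "C \<in> fmeasurable M"
  shows "AE \<omega> in P. void M C \<omega> = 0 ^ points_in C \<omega>"
  using AE_points[OF assms] AE_space
  by eventually_elim (auto simp: void_def space_P indicator_def power_0_left)

lemma AE_points_Un:
  assumes "A \<in> fmeasurable M" "B \<in> fmeasurable M" "A \<inter> B = {}"
  shows "AE \<omega> in P. points_in (A \<union> B) \<omega> = points_in A \<omega> + points_in B \<omega>"
  using AE_points[OF assms(1)] AE_points[OF assms(2)] AE_points[OF fmeasurable.Un[OF assms(1,2)]] AE_space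
proof eventually_elim
  case (elim \<omega>)
  have "emeasure \<omega> (A \<union> B) = emeasure \<omega> A + emeasure \<omega> B"
    using assms sets_point[OF elim(4)] by (subst plus_emeasure) auto
  then have "of_nat (points_in (A \<union> B) \<omega>) = (of_nat (points_in A \<omega> + points_in B \<omega>) :: ennreal)"
    using elim by simp
  then show ?case
    using of_nat_eq_iff by blast
qed

lemma void_L2: "C \<in> sets M \<Longrightarrow> void M C \<in> L2 P"
  using measurable_void[of C] by (rule L2_bounded[where B=1]) (auto simp: void_def indicator_def)

text \<open>When \<open>C\<close> contains no point, the points of \<open>A\<close> lie in \<open>A - C\<close>, and their number is independent of
  what happens in \<open>C\<close>.\<close>

lemma integral_mult_void:
  fixes g :: "nat \<Rightarrow> real"
  assumes A: "A \<in> fmeasurable M" and C: "C \<in> fmeasurable M" and g: "integrable P (\<lambda>\<omega>. g (points_in (A - C) \<omega>))"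
  shows "(\<integral>\<omega>. g (points_in A \<omega>) * void M C \<omega> \<partial>P) = (\<integral>\<omega>. g (points_in (A - C) \<omega>) \<partial>P) * exp (- measure M C)"
proof -
  have [measurable]: "A \<in> sets M" "C \<in> sets M"
    using A C by auto
  have f: "A - C \<in> fmeasurable M" "A \<inter> C \<in> fmeasurable M" "C - A \<in> fmeasurable M"
    using A C by (auto intro: fmeasurable.Diff fmeasurable_Int_sets)
  have e: "(A - C) \<union> (A \<inter> C) = A" "(C - A) \<union> (A \<inter> C) = C"
    by auto
  have 1: "AE \<omega> in P. points_in A \<omega> = points_in (A - C) \<omega> + points_in (A \<inter> C) \<omega>"
    using AE_points_Un[OF f(1,2)] e by auto
  have 2: "AE \<omega> in P. points_in C \<omega> = points_in (C - A) \<omega> + points_in (A \<inter> C) \<omega>"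
    using AE_points_Un[OF f(3,2)] e by auto
  have "(\<integral>\<omega>. g (points_in A \<omega>) * void M C \<omega> \<partial>P) = (\<integral>\<omega>. g (points_in (A - C) \<omega>) * 0 ^ points_in C \<omega> \<partial>P)"
    using 1 2 AE_void[OF C] by (intro integral_cong_AE) (auto elim!: AE_mp simp: power_0_left)
  also have "\<dots> = (\<integral>\<omega>. g (points_in (A - C) \<omega>) \<partial>P) * (\<integral>\<omega>. 0 ^ points_in C \<omega> \<partial>P)"
    using indep_points[of "A - C" C g "\<lambda>n. 0 ^ n"] g integral_power_points[OF C, of 0]
    by (intro indep_var_lebesgue_integral) (auto simp: has_bochner_integral_iff)
  also have "(\<integral>\<omega>. 0 ^ points_in C \<omega> \<partial>P) = exp (- measure M C)"
    using integral_power_points[OF C, of 0] by (simp add: has_bochner_integral_iff)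
  finally show ?thesis .
qed

lemma integral_void: "C \<in> fmeasurable M \<Longrightarrow> (\<integral>\<omega>. void M C \<omega> \<partial>P) = exp (- measure M C)"
  using integral_mult_void[of "{}" C "\<lambda>_. 1"] by (simp add: prob_space)

lemma measure_Diff_Int: "A \<in> fmeasurable M \<Longrightarrow> C \<in> sets M \<Longrightarrow> measure M (A - C) = measure M A - measure M (A \<inter> C)"
  using measure_Diff[of M A "A \<inter> C"] by (auto simp: Diff_Int fmeasurable_def less_top)

lemma integral_exp_vector_void:
  assumes A: "A \<in> fmeasurable M" and C: "C \<in> fmeasurable M" and z: "z \<ge> -1"
  shows "(\<integral>\<omega>. void M C \<omega> * exp_vector M z A \<omega> \<partial>P) = exp (- measure M C - z * measure M (A \<inter> C))"
proof -
  have f: "A - C \<in> fmeasurable M"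
    using A C by (auto intro: fmeasurable.Diff)
  have h: "has_bochner_integral P (\<lambda>\<omega>. (1 + z) ^ points_in (A - C) \<omega>) (exp (z * measure M (A - C)))"
    using integral_power_points[OF f, of "1 + z"] z by simp
  have "(\<integral>\<omega>. void M C \<omega> * exp_vector M z A \<omega> \<partial>P) =
      exp (- z * measure M A) * (\<integral>\<omega>. (1 + z) ^ points_in A \<omega> * void M C \<omega> \<partial>P)"
    by (subst integral_mult_right_zero[symmetric]) (simp add: exp_vector_def mult_ac)
  also have "\<dots> = exp (- z * measure M A) * (exp (z * measure M (A - C)) * exp (- measure M C))"
    using integral_mult_void[OF A C, of "\<lambda>n. (1 + z) ^ n"] h by (simp add: has_bochner_integral_iff)
  also have "\<dots> = exp (- measure M C - z * measure M (A \<inter> C))"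
    using measure_Diff_Int[OF A, of C] C by (simp add: mult_exp_exp right_diff_distrib)
  finally show ?thesis .
qed

lemma compensated_L2: "A \<in> fmeasurable M \<Longrightarrow> compensated M A \<in> L2 P"
  unfolding compensated_def[abs_def]
  using integral_points_square[of A] by (intro L2_diff L2_const) (auto simp: L2_def has_bochner_integral_iff)

lemma points_L2: "A \<in> fmeasurable M \<Longrightarrow> (\<lambda>\<omega>. real (points_in A \<omega>)) \<in> L2 P"
  using integral_points_square[of A] by (auto simp: L2_def has_bochner_integral_iff)

lemma integral_real_points: "A \<in> fmeasurable M \<Longrightarrow> (\<integral>\<omega>. real (points_in A \<omega>) \<partial>P) = measure M A"
  using integral_points_power_points[of A 1] by (simp add: has_bochner_integral_iff)

lemma integral_compensated: "A \<in> fmeasurable M \<Longrightarrow> (\<integral>\<omega>. compensated M A \<omega> \<partial>P) = 0"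
  using integral_real_points[of A] L2_integrable[OF points_L2] by (simp add: compensated_def prob_space)

lemma integral_compensated_void:
  assumes A: "A \<in> fmeasurable M" and C: "C \<in> fmeasurable M"
  shows "(\<integral>\<omega>. compensated M A \<omega> * void M C \<omega> \<partial>P) = - exp (- measure M C) * measure M (A \<inter> C)"
proof -
  have f: "A - C \<in> fmeasurable M"
    using A C by (auto intro: fmeasurable.Diff)
  have "(\<integral>\<omega>. compensated M A \<omega> * void M C \<omega> \<partial>P) = 
      (\<integral>\<omega>. (real (points_in (A - C) \<omega>) - measure M A) \<partial>P) * exp (- measure M C)"
    unfolding compensated_def using L2_integrable[OF points_L2[OF f]]
    by (intro integral_mult_void[OF A C, of "\<lambda>n. real n - measure M A"]) auto
  also have "(\<integral>\<omega>. (real (points_in (A - C) \<omega>) - measure M A) \<partial>P) = - measure M (A \<inter> C)"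
    using L2_integrable[OF points_L2[OF f]] integral_real_points[OF f] measure_Diff_Int[OF A, of C] C by (simp add: prob_space)
  finally show ?thesis
    by simp
qed

lemma AE_compensated_Un:
  assumes "A \<in> fmeasurable M" "B \<in> fmeasurable M" "A \<inter> B = {}"
  shows "AE \<omega> in P. compensated M (A \<union> B) \<omega> = compensated M A \<omega> + compensated M B \<omega>"
  using AE_points_Un[OF assms] by eventually_elim (use measure_Un3[OF assms(1,2)] assms(3) in \<open>simp add: compensated_def\<close>)

lemma integral_compensated_square:
  assumes A: "A \<in> fmeasurable M"
  shows "(\<integral>\<omega>. compensated M A \<omega> * compensated M A \<omega> \<partial>P) = measure M A"
proof -
  have "(\<integral>\<omega>. compensated M A \<omega> * compensated M A \<omega> \<partial>P) = 
    (\<integral>\<omega>. (real (points_in A \<omega>))\<^sup>2 - 2 * measure M A * real (points_in A \<omega>) + (measure M A)\<^sup>2 \<partial>P)"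
    by (intro Bochner_Integration.integral_cong) (auto simp: compensated_def power2_eq_square algebra_simps)
  also have "\<dots> = measure M A"
    using integral_points_square[OF A] L2_integrable[OF points_L2[OF A]] integral_real_points[OF A]
    by (simp add: has_bochner_integral_iff prob_space power2_eq_square)
  finally show ?thesis .
qed

lemma integral_compensated_disjoint:
  assumes A: "A \<in> fmeasurable M" and B: "B \<in> fmeasurable M" and d: "A \<inter> B = {}"
  shows "(\<integral>\<omega>. compensated M A \<omega> * compensated M B \<omega> \<partial>P) = 0"
proof -
  have "indep_var borel (compensated M A) borel (compensated M B)"
    using indep_points[of A B "\<lambda>n. real n - measure M A" "\<lambda>n. real n - measure M B"] A B d
    by (auto simp: compensated_def[abs_def])
  then have "(\<integral>\<omega>. compensated M A \<omega> * compensated M B \<omega> \<partial>P) =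
      (\<integral>\<omega>. compensated M A \<omega> \<partial>P) * (\<integral>\<omega>. compensated M B \<omega> \<partial>P)"
    by (rule indep_var_lebesgue_integral) (intro L2_integrable compensated_L2 A B)+
  then show ?thesis
    by (simp add: integral_compensated[OF A])
qed

lemma integral_compensated_mult:
  assumes A: "A \<in> fmeasurable M" and B: "B \<in> fmeasurable M"
  shows "(\<integral>\<omega>. compensated M A \<omega> * compensated M B \<omega> \<partial>P) = measure M (A \<inter> B)"
proof -
  define p q s where "p = compensated M (A - B)" and "q = compensated M (A \<inter> B)" and "s = compensated M (B - A)"
  have f: "A - B \<in> fmeasurable M" "A \<inter> B \<in> fmeasurable M" "B - A \<in> fmeasurable M"
    using A B by (auto intro: fmeasurable.Diff fmeasurable_Int_sets)
  have e: "(A - B) \<union> (A \<inter> B) = A" "(B - A) \<union> (A \<inter> B) = B"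
    by auto
  have d: "(A - B) \<inter> (A \<inter> B) = {}" "(B - A) \<inter> (A \<inter> B) = {}" "(A - B) \<inter> (B - A) = {}" "(A \<inter> B) \<inter> (B - A) = {}"
    by auto
  have L: "p \<in> L2 P" "q \<in> L2 P" "s \<in> L2 P"
    using f by (auto simp: p_def q_def s_def compensated_L2)
  have [measurable]: "A \<in> sets M" "B \<in> sets M"
    using A B by auto
  have [measurable]: "p \<in> borel_measurable P" "q \<in> borel_measurable P" "s \<in> borel_measurable P"
    using L by (auto dest: L2_measurable)
  have "(\<integral>\<omega>. compensated M A \<omega> * compensated M B \<omega> \<partial>P) = (\<integral>\<omega>. (p \<omega> + q \<omega>) * (s \<omega> + q \<omega>) \<partial>P)"
    using AE_compensated_Un[OF f(1,2) d(1)] AE_compensated_Un[OF f(3,2) d(2)] unfolding e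
    by (intro integral_cong_AE) (auto elim!: AE_mp simp: p_def q_def s_def)
  also have "\<dots> = (\<integral>\<omega>. p \<omega> * s \<omega> + p \<omega> * q \<omega> + q \<omega> * s \<omega> + q \<omega> * q \<omega> \<partial>P)"
    by (simp add: algebra_simps)
  also have "\<dots> = (\<integral>\<omega>. p \<omega> * s \<omega> \<partial>P) + (\<integral>\<omega>. p \<omega> * q \<omega> \<partial>P) + (\<integral>\<omega>. q \<omega> * s \<omega> \<partial>P) + (\<integral>\<omega>. q \<omega> * q \<omega> \<partial>P)"
    using L2_mult[of _ P] L by simp
  also have "\<dots> = measure M (A \<inter> B)"
    using integral_compensated_disjoint[OF f(1,2) d(1)] integral_compensated_disjoint[OF f(1,3) d(3)]
      integral_compensated_disjoint[OF f(2,3) d(4)] integral_compensated_square[OF f(2)]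
    by (simp add: p_def q_def s_def)
  finally show ?thesis .
qed

lemma exp_vector_square:
  assumes A: "A \<in> fmeasurable M" and z: "z \<ge> -1"
  shows "has_bochner_integral P (\<lambda>\<omega>. (exp_vector M z A \<omega>)\<^sup>2) (exp (z\<^sup>2 * measure M A))"
proof -
  have "has_bochner_integral P (\<lambda>\<omega>. ((1 + z)\<^sup>2) ^ points_in A \<omega> * (exp (- z * measure M A))\<^sup>2)
      (exp (((1 + z)\<^sup>2 - 1) * measure M A) * (exp (- z * measure M A))\<^sup>2)"
    by (intro has_bochner_integral_mult_left integral_power_points[OF A]) auto
  moreover have "exp (((1 + z)\<^sup>2 - 1) * measure M A) * (exp (- z * measure M A))\<^sup>2 = exp (z\<^sup>2 * measure M A)"
    by (simp add: power2_eq_square mult_exp_exp algebra_simps)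
  moreover have "((1 + z)\<^sup>2) ^ n * (exp (- z * measure M A))\<^sup>2 = ((1 + z) ^ n * exp (- z * measure M A))\<^sup>2" for n
    by (simp add: power_mult_distrib power_mult[symmetric] mult.commute)
  ultimately show ?thesis
    by (simp add: exp_vector_def)
qed

lemma exp_vector_L2: "A \<in> fmeasurable M \<Longrightarrow> z \<ge> -1 \<Longrightarrow> exp_vector M z A \<in> L2 P"
  using exp_vector_square[of A z] by (auto simp: L2_def has_bochner_integral_iff)

lemma norm2_exp_vector: "A \<in> fmeasurable M \<Longrightarrow> z \<ge> -1 \<Longrightarrow> norm2 P (exp_vector M z A) = sqrt (exp (z\<^sup>2 * measure M A))"
  using exp_vector_square[of A z] by (simp add: norm2_def has_bochner_integral_iff)

lemma norm2_compensated: "A \<in> fmeasurable M \<Longrightarrow> norm2 P (compensated M A) = sqrt (measure M A)"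
  using integral_compensated_square[of A] by (simp add: norm2_def power2_eq_square)

lemma integral_exp_vector: "A \<in> fmeasurable M \<Longrightarrow> z \<ge> -1 \<Longrightarrow> (\<integral>\<omega>. exp_vector M z A \<omega> \<partial>P) = 1"
  using has_bochner_integral_mult_left[OF integral_power_points[of A "1 + z"], of "exp (- z * measure M A)"]
  by (simp add: has_bochner_integral_iff exp_vector_def[abs_def] mult_exp_exp)

lemma integral_exp_vector_compensated:
  assumes A: "A \<in> fmeasurable M" and z: "z \<ge> -1"
  shows "(\<integral>\<omega>. exp_vector M z A \<omega> * compensated M A \<omega> \<partial>P) = z * measure M A"
proof -
  have i: "has_bochner_integral P (\<lambda>\<omega>. real (points_in A \<omega>) * (1 + z) ^ points_in A \<omega> * exp (- z * measure M A))
      ((1 + z) * measure M A * exp ((1 + z - 1) * measure M A) * exp (- z * measure M A))"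
    using z by (intro has_bochner_integral_mult_left integral_points_power_points[OF A]) auto
  have e: "(1 + z) * measure M A * exp ((1 + z - 1) * measure M A) * exp (- z * measure M A) = (1 + z) * measure M A"
    by (simp add: mult_exp_exp mult.assoc)
  have "(\<integral>\<omega>. exp_vector M z A \<omega> * compensated M A \<omega> \<partial>P) = 
      (\<integral>\<omega>. real (points_in A \<omega>) * (1 + z) ^ points_in A \<omega> * exp (- z * measure M A) - measure M A * exp_vector M z A \<omega> \<partial>P)"
    by (intro Bochner_Integration.integral_cong) (auto simp: exp_vector_def compensated_def algebra_simps)
  also have "\<dots> = (1 + z) * measure M A - measure M A"
    using i[unfolded e] integral_exp_vector[OF A z] L2_integrable[OF exp_vector_L2[OF A z]]
    by (simp add: has_bochner_integral_iff)
  finally show ?thesis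
    by (simp add: algebra_simps)
qed

text \<open>The probability of at least two points is \<open>1 - (1 + \<mu>) exp (- \<mu>)\<close>, and \<open>exp (- \<mu>) \<ge> 1 - \<mu>\<close>.\<close>

lemma prob_multiple:
  assumes A: "A \<in> fmeasurable M"
  shows "prob {\<omega> \<in> space P. points_in A \<omega> \<ge> 2} \<le> (measure M A)\<^sup>2"
proof -
  have [measurable]: "A \<in> sets M"
    using A by auto
  let ?m = "measure M A"
  have "{\<omega> \<in> space P. points_in A \<omega> \<ge> 2} = space P - ({\<omega> \<in> space P. points_in A \<omega> = 0} \<union> {\<omega> \<in> space P. points_in A \<omega> = 1})"
    by auto
  then have "prob {\<omega> \<in> space P. points_in A \<omega> \<ge> 2} = 1 - prob ({\<omega> \<in> space P. points_in A \<omega> = 0} \<union> {\<omega> \<in> space P. points_in A \<omega> = 1})"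
    by (simp add: prob_compl)
  also have "prob ({\<omega> \<in> space P. points_in A \<omega> = 0} \<union> {\<omega> \<in> space P. points_in A \<omega> = 1}) = exp (- ?m) + ?m * exp (- ?m)"
    by (subst finite_measure_Union) (auto simp: prob_points[OF A])
  also have "1 - (exp (- ?m) + ?m * exp (- ?m)) = 1 - (1 + ?m) * exp (- ?m)"
    by (simp add: algebra_simps)
  also have "\<dots> \<le> 1 - (1 + ?m) * (1 - ?m)"
    using exp_ge_add_one_self[of "- ?m"] by (intro diff_left_mono mult_left_mono) auto
  also have "\<dots> = ?m\<^sup>2"
    by (simp add: power2_eq_square algebra_simps)
  finally show ?thesis .
qed

lemma AE_points_UN:
  assumes D: "\<forall>k<n. D k \<in> fmeasurable M" "disjoint_family_on D {..<n::nat}"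
  shows "AE \<omega> in P. points_in (\<Union>k<n. D k) \<omega> = (\<Sum>k<n. points_in (D k) \<omega>)"
  using assms
proof (induction n)
  case 0
  show ?case
    by (simp add: points_in_def)
next
  case (Suc n)
  have u: "(\<Union>k<Suc n. D k) = (\<Union>k<n. D k) \<union> D n"
    by (auto simp: less_Suc_eq)
  have "(\<Union>k<n. D k) \<in> fmeasurable M"
    using Suc(2) by (intro fmeasurable.finite_UN) auto
  moreover have "(\<Union>k<n. D k) \<inter> D n = {}"
  proof -
    have "D k \<inter> D n = {}" if "k < n" for k
      using that by (intro disjoint_family_onD[OF Suc(3)]) auto
    then show ?thesis
      by auto
  qed
  ultimately have "AE \<omega> in P. points_in (\<Union>k<Suc n. D k) \<omega> = points_in (\<Union>k<n. D k) \<omega> + points_in (D n) \<omega>"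
    unfolding u using Suc(2) by (intro AE_points_Un) auto
  moreover have "AE \<omega> in P. points_in (\<Union>k<n. D k) \<omega> = (\<Sum>k<n. points_in (D k) \<omega>)"
    using Suc.prems by (intro Suc.IH) (auto simp: disjoint_family_on_def)
  ultimately show ?case
    by eventually_elim simp
qed

end

section \<open>Void events generate\<close>

text \<open>For a sigma-finite measure this expresses that there are no atoms.\<close>

definition finely_divisible :: "'a measure \<Rightarrow> bool" where
  "finely_divisible M \<longleftrightarrow> sigma_finite_measure M \<and> (\<forall>C\<in>fmeasurable M. \<forall>e>0. \<exists>D n. (\<forall>k<n. D k \<in> fmeasurable M)
     \<and> disjoint_family_on D {..<n::nat} \<and> C = (\<Union>k<n. D k) \<and> (\<Sum>k<n. (measure M (D k))\<^sup>2) < e)"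

text \<open>The events that are determined by finitely many void events, expressed through their indicators.\<close>

definition void_algebra :: "'a measure \<Rightarrow> 'a measure set set" where
  "void_algebra M = {B \<in> sets (configuration_algebra M). indicator B \<in> lspan (void M ` fmeasurable M)}"

lemma void_empty: "void M {} = indicator (configurations M)"
  by (auto simp: void_def)

lemma lspan_void_mult:
  "f \<in> lspan (void M ` fmeasurable M) \<Longrightarrow> g \<in> lspan (void M ` fmeasurable M) \<Longrightarrow>
    (\<lambda>\<omega>. f \<omega> * g \<omega>) \<in> lspan (void M ` fmeasurable M)"
  by (rule lspan_mult) (auto simp: void_mult intro!: imageI)

lemma void_algebra_empty: "{} \<in> void_algebra M"
proof -
  have e: "(indicator {} :: _ \<Rightarrow> real) = (\<lambda>_. 0)"
    by auto
  have "indicator {} \<in> lspan (void M ` fmeasurable M)"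
    unfolding e by (rule lspan.zero)
  then show ?thesis
    unfolding void_algebra_def by blast
qed

lemma void_algebra_compl: 
  assumes "B \<in> void_algebra M"
  shows "configurations M - B \<in> void_algebra M"
proof -
  have B: "B \<in> sets (configuration_algebra M)" "indicator B \<in> lspan (void M ` fmeasurable M)"
    using assms by (auto simp: void_algebra_def)
  have "B \<subseteq> configurations M"
    using sets.sets_into_space[OF B(1)] by (simp add: space_configuration_algebra)
  then have "(indicator (configurations M - B) :: _ \<Rightarrow> real) = (\<lambda>\<omega>. void M {} \<omega> - indicator B \<omega>)"
    by (auto simp: void_empty indicator_def fun_eq_iff)
  moreover have "(\<lambda>\<omega>. void M {} \<omega> - indicator B \<omega>) \<in> lspan (void M ` fmeasurable M)"
    by (intro lspan_diff[OF lspan_base B(2)]) auto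
  ultimately show ?thesis
    using sets.compl_sets[OF B(1)] by (simp add: void_algebra_def space_configuration_algebra)
qed

lemma void_algebra_Int:
  "B \<in> void_algebra M \<Longrightarrow> C \<in> void_algebra M \<Longrightarrow> B \<inter> C \<in> void_algebra M"
  using lspan_void_mult[of "indicator B" M "indicator C"]
  by (auto simp: void_algebra_def indicator_inter_arith[abs_def])

lemma void_algebra_Un:
  assumes "B \<in> void_algebra M" "C \<in> void_algebra M"
  shows "B \<union> C \<in> void_algebra M"
proof -
  have "(indicator (B \<union> C) :: _ \<Rightarrow> real) = (\<lambda>\<omega>. (indicator B \<omega> + indicator C \<omega>) - indicator B \<omega> * indicator C \<omega>)"
    by (auto simp: indicator_def fun_eq_iff)
  moreover have "(\<lambda>\<omega>. (indicator B \<omega> + indicator C \<omega>) - indicator B \<omega> * indicator C \<omega>) \<in> lspan (void M ` fmeasurable M)"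
    using assms unfolding void_algebra_def by (intro lspan_diff lspan_add lspan_void_mult) auto
  ultimately show ?thesis
    using assms unfolding void_algebra_def by (auto simp only: mem_Collect_eq intro: sets.Un)
qed

lemma void_event: "C \<in> fmeasurable M \<Longrightarrow> {\<omega> \<in> configurations M. emeasure \<omega> C = 0} \<in> void_algebra M"
  using measurable_sets[OF measurable_emeasure_configuration[of C M], of "{0}"]
  by (auto simp: void_algebra_def void_def[symmetric] space_configuration_algebra vimage_def Int_def conj_commute intro!: lspan_base)

text \<open>The number of non-void sets among finitely many is determined by the void events; induction on the
  number of sets avoids a case distinction over subfamilies.\<close>

lemma void_algebra_count:
  assumes "\<forall>k<n::nat. D k \<in> fmeasurable M"
  shows "{\<omega> \<in> configurations M. (\<Sum>k<n. if emeasure \<omega> (D k) = 0 then 0 else 1) = (l::nat)} \<in> void_algebra M"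
  using assms
proof (induction n arbitrary: l)
  case 0
  then show ?case
    using void_algebra_empty[of M] void_algebra_compl[OF void_algebra_empty, of M] by (cases l) auto
next
  case (Suc n)
  let ?E = "\<lambda>n l. {\<omega> \<in> configurations M. (\<Sum>k<n. if emeasure \<omega> (D k) = 0 then 0::nat else 1) = l}"
  let ?V = "{\<omega> \<in> configurations M. emeasure \<omega> (D n) = 0}"
  have V: "?V \<in> void_algebra M"
    using Suc.prems by (intro void_event) auto
  have "?E (Suc n) l = (?E n l \<inter> ?V) \<union> (if l = 0 then {} else ?E n (l - 1) \<inter> (configurations M - ?V))"
    by (cases l) (auto split: if_splits)
  moreover have E: "?E n l \<in> void_algebra M" for l
    using Suc.prems by (intro Suc.IH) auto
  have "(?E n l \<inter> ?V) \<union> (if l = 0 then {} else ?E n (l - 1) \<inter> (configurations M - ?V)) \<in> void_algebra M"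
    using void_algebra_Int[OF E V] void_algebra_Int[OF E void_algebra_compl[OF V]] void_algebra_empty[of M]
    by (intro void_algebra_Un) (simp_all split: if_splits)
  ultimately show ?case
    by (simp only:)
qed

text \<open>If \<open>C\<close> is cut into small pieces, it is unlikely that a piece contains two points, and otherwise
  the number of points in \<open>C\<close> is the number of pieces that are not void.\<close>

lemma (in poisson_process) count_event_approximation:
  assumes C: "C = (\<Union>k<n. D k)" and D: "\<forall>k<n. D k \<in> fmeasurable M" "disjoint_family_on D {..<n::nat}"
  shows "prob (sym_diff {\<omega> \<in> space P. points_in C \<omega> = l}
      {\<omega> \<in> configurations M. (\<Sum>k<n. if emeasure \<omega> (D k) = 0 then 0 else 1) = l}) \<le> (\<Sum>k<n. (measure M (D k))\<^sup>2)"
proof -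
  let ?E = "{\<omega> \<in> configurations M. (\<Sum>k<n. if emeasure \<omega> (D k) = 0 then 0 else 1) = l}"
  let ?U = "\<Union>k\<in>{..<n}. {\<omega> \<in> space P. points_in (D k) \<omega> \<ge> 2}"
  have [measurable]: "D k \<in> sets M" if "k < n" for k
    using D(1) that by auto
  have U: "?U \<in> sets P"
    by (intro sets.finite_UN) auto
  have "AE \<omega> in P. \<forall>k\<in>{..<n}. emeasure \<omega> (D k) = of_nat (points_in (D k) \<omega>)"
    using D(1) by (intro AE_finite_allI AE_points) auto
  with AE_points_UN[OF D] have "AE \<omega> in P. \<omega> \<in> sym_diff {\<omega> \<in> space P. points_in C \<omega> = l} ?E \<longrightarrow> \<omega> \<in> ?U"
  proof eventually_elim
    case (elim \<omega>)
    have "(\<Sum>k<n. points_in (D k) \<omega>) = (\<Sum>k<n. if emeasure \<omega> (D k) = 0 then 0 else 1)" if "\<omega> \<notin> ?U" "\<omega> \<in> space P"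
    proof (rule sum.cong[OF refl])
      fix k
      assume k: "k \<in> {..<n}"
      then have "\<not> 2 \<le> points_in (D k) \<omega>"
        using that by blast
      then have "points_in (D k) \<omega> = 0 \<or> points_in (D k) \<omega> = 1"
        by auto
      then show "points_in (D k) \<omega> = (if emeasure \<omega> (D k) = 0 then 0 else 1)"
        using elim k by auto
    qed
    moreover have "points_in C \<omega> = (\<Sum>k<n. points_in (D k) \<omega>)"
      unfolding C by (rule elim(1))
    ultimately show ?case
      unfolding space_P by fastforce
  qed
  then have "prob (sym_diff {\<omega> \<in> space P. points_in C \<omega> = l} ?E) \<le> prob ?U"
    using U by (rule finite_measure_mono_AE)
  also have "\<dots> \<le> (\<Sum>k<n. prob {\<omega> \<in> space P. points_in (D k) \<omega> \<ge> 2})"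
    by (intro finite_measure_subadditive_finite) auto
  also have "\<dots> \<le> (\<Sum>k<n. (measure M (D k))\<^sup>2)"
    using D(1) by (intro sum_mono prob_multiple) auto
  finally show ?thesis .
qed

text \<open>The events that are approximable by void events form a sigma-algebra. It contains the events \<open>N\<^sub>C
  = l\<close> for \<open>C\<close> of finite intensity, hence makes all the functions \<open>N\<^sub>C\<close> measurable, first up to a
  null set for \<open>C\<close> of finite intensity and then for all \<open>C\<close> by exhaustion.\<close>

lemma void_approximation:
  assumes P: "poisson_measure M P" and Q: "poisson_measure M Q" and M: "finely_divisible M"
    and S: "S \<in> sets (configuration_algebra M)" and e: "e > 0"
  shows "\<exists>B\<in>void_algebra M. measure P (sym_diff S B) < e \<and> measure Q (sym_diff S B) < e"
proof -
  interpret P: poisson_process M P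
    using P by (auto simp: poisson_process_def poisson_process_axioms_def poisson_measure_def)
  interpret Q: poisson_process M Q
    using Q by (auto simp: poisson_process_def poisson_process_axioms_def poisson_measure_def)
  interpret M: sigma_finite_measure M
    using M by (simp add: finely_divisible_def)
  define \<A> where "\<A> = {S \<in> sets P. \<forall>e>0. \<exists>B\<in>void_algebra M. measure P (sym_diff S B) < e \<and> measure Q (sym_diff S B) < e}"
  have "sigma_algebra (space P) \<A>"
    unfolding \<A>_def
  proof (rule approximable_sigma_algebra[OF P.finite_measure_axioms Q.finite_measure_axioms])
    show "sets Q = sets P"
      by (simp add: P.sets_P Q.sets_P)
    show "void_algebra M \<subseteq> sets P"
      by (auto simp: P.sets_P void_algebra_def)
  qed (use void_algebra_empty void_algebra_compl void_algebra_Un in \<open>auto simp: P.space_P\<close>)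
  then interpret A: sigma_algebra "space P" \<A> .
  define N where "N = sigma (space P) \<A>"
  have N: "space N = configurations M" "sets N = \<A>"
    using A.space_closed A.sets_measure_of_eq by (auto simp: N_def P.space_P space_measure_of_conv)
  have null: "S \<in> \<A>" if "S \<in> sets P" "measure P S = 0" "measure Q S = 0" for S
    using that by (auto simp: \<A>_def intro!: bexI[OF _ void_algebra_empty])
  have points_in: "{\<omega> \<in> space P. points_in C \<omega> = l} \<in> \<A>" if C: "C \<in> fmeasurable M" for C l
  proof -
    have [measurable]: "C \<in> sets M"
      using C by auto
    have "\<exists>B\<in>void_algebra M. measure P (sym_diff {\<omega> \<in> space P. points_in C \<omega> = l} B) < e
        \<and> measure Q (sym_diff {\<omega> \<in> space P. points_in C \<omega> = l} B) < e" if "e > 0" for e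
    proof -
      have "\<exists>D n. (\<forall>k<n. D k \<in> fmeasurable M) \<and> disjoint_family_on D {..<n::nat}
          \<and> C = (\<Union>k<n. D k) \<and> (\<Sum>k<n. (measure M (D k))\<^sup>2) < e"
        using M C \<open>e > 0\<close> by (simp add: finely_divisible_def)
      then obtain D n where D: "\<forall>k<n. D k \<in> fmeasurable M" "disjoint_family_on D {..<n::nat}"
        "C = (\<Union>k<n. D k)" "(\<Sum>k<n. (measure M (D k))\<^sup>2) < e"
        by (elim exE conjE) (rule that)
      show ?thesis
        using P.count_event_approximation[OF D(3,1,2), of l] Q.count_event_approximation[OF D(3,1,2), of l] D(4)
        unfolding P.space_P Q.space_P by (intro bexI[OF _ void_algebra_count[OF D(1), of l]]) auto
    qed
    then show ?thesis
      by (auto simp: \<A>_def)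
  qed
  have fin: "(\<lambda>\<omega>. emeasure \<omega> C) \<in> borel_measurable N" if C: "C \<in> fmeasurable M" for C
  proof (rule measurableI)
    fix S :: "ennreal set"
    assume S[measurable]: "S \<in> sets borel"
    have [measurable]: "C \<in> sets M"
      using C by auto
    define Z where "Z = {\<omega> \<in> space P. emeasure \<omega> C \<noteq> of_nat (points_in C \<omega>)}"
    have Z[measurable]: "Z \<in> sets P"
      unfolding Z_def by measurable
    have Zn: "measure P Z = 0" "measure Q Z = 0"
      using P.AE_points[OF C] Q.AE_points[OF C] Z unfolding Z_def
      by (simp_all add: AE_iff_measurable[OF _ refl] measure_def P.sets_P Q.sets_P P.space_P Q.space_P)
    have 1: "(\<Union>l\<in>{l. of_nat l \<in> S}. {\<omega> \<in> space P. points_in C \<omega> = l}) \<in> \<A>"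
      using points_in[OF C] by (intro A.countable_UN'') auto
    have m: "{\<omega> \<in> space P. emeasure \<omega> C \<in> S} \<inter> Z \<in> sets P"
      by measurable
    have "measure P ({\<omega> \<in> space P. emeasure \<omega> C \<in> S} \<inter> Z) \<le> 0" "measure Q ({\<omega> \<in> space P. emeasure \<omega> C \<in> S} \<inter> Z) \<le> 0"
      using Zn Z P.finite_measure_mono[of "{\<omega> \<in> space P. emeasure \<omega> C \<in> S} \<inter> Z" Z]
        Q.finite_measure_mono[of "{\<omega> \<in> space P. emeasure \<omega> C \<in> S} \<inter> Z" Z] by (auto simp: P.sets_P Q.sets_P)
    then have 2: "{\<omega> \<in> space P. emeasure \<omega> C \<in> S} \<inter> Z \<in> \<A>"
      using m by (intro null) (auto simp: measure_le_0_iff)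
    have "(\<lambda>\<omega>. emeasure \<omega> C) -` S \<inter> space N =
        ((\<Union>l\<in>{l. of_nat l \<in> S}. {\<omega> \<in> space P. points_in C \<omega> = l}) - Z) \<union> ({\<omega> \<in> space P. emeasure \<omega> C \<in> S} \<inter> Z)"
      by (auto simp: Z_def N P.space_P)
    also have "\<dots> \<in> \<A>"
      using 1 2 null[OF Z Zn] by auto
    finally show "(\<lambda>\<omega>. emeasure \<omega> C) -` S \<inter> space N \<in> sets N"
      by (simp add: N)
  qed simp
  have "sets (configuration_algebra M) \<subseteq> sets N"
  proof (rule sets_configuration_algebra_subset[OF N(1)])
    fix C
    assume C: "C \<in> sets M"
    obtain F where F: "range F \<subseteq> sets M" "(\<Union>i. F i) = space M" "\<And>i. emeasure M (F i) \<noteq> \<infinity>" "incseq F"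
      using M.sigma_finite_incseq by blast
    have Fi: "F i \<in> fmeasurable M" for i
      using F(1,3) by (auto simp: fmeasurable_def less_top)
    have "emeasure \<omega> C = (SUP i. emeasure \<omega> (F i \<inter> C))" if "\<omega> \<in> space N" for \<omega>
    proof -
      have s: "sets \<omega> = sets M"
        using that by (simp add: N configurations_sets)
      have u: "(\<Union>i. F i \<inter> C) = C"
        using F(2) sets.sets_into_space[OF C] by auto
      have "incseq (\<lambda>i. F i \<inter> C)"
        using F(4) by (auto simp: incseq_def)
      moreover have "range (\<lambda>i. F i \<inter> C) \<subseteq> sets \<omega>"
        using F(1) C s by auto
      ultimately show ?thesis
        using SUP_emeasure_incseq[of "\<lambda>i. F i \<inter> C" \<omega>] unfolding u by simp
    qed
    moreover have "(\<lambda>\<omega>. SUP i. emeasure \<omega> (F i \<inter> C)) \<in> borel_measurable N"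
      by (intro borel_measurable_SUP fin fmeasurable_Int_sets Fi C) auto
    ultimately show "(\<lambda>\<omega>. emeasure \<omega> C) \<in> borel_measurable N"
      by (simp cong: measurable_cong)
  qed
  then show ?thesis
    using S e N by (auto simp: \<A>_def)
qed

text \<open>The probabilities of void events are prescribed, so the two measures agree on the algebra that
  they generate, and by simultaneous approximation everywhere.\<close>

lemma poisson_measure_unique:
  assumes P: "poisson_measure M P" and Q: "poisson_measure M Q" and M: "finely_divisible M"
  shows "P = Q"
proof (rule measure_eqI)
  interpret P: poisson_process M P
    using P by (auto simp: poisson_process_def poisson_process_axioms_def poisson_measure_def)
  interpret Q: poisson_process M Q
    using Q by (auto simp: poisson_process_def poisson_process_axioms_def poisson_measure_def)
  show eq: "sets P = sets Q"
    by (simp add: P.sets_P Q.sets_P)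
  have lsp: "integrable P f \<and> integrable Q f \<and> integral\<^sup>L P f = integral\<^sup>L Q f" if "f \<in> lspan (void M ` fmeasurable M)" for f
    using that
  proof (induction rule: lspan.induct)
    case (step f g c)
    then obtain C where C: "C \<in> fmeasurable M" "f = void M C"
      by auto
    have "integrable P f" "integrable Q f" "integral\<^sup>L P f = integral\<^sup>L Q f"
      using C P.L2_integrable[OF P.void_L2[of C]] Q.L2_integrable[OF Q.void_L2[of C]] P.integral_void[of C] Q.integral_void[of C]
      by auto
    then show ?case
      using step.IH by auto
  qed simp
  then have B: "measure P B = measure Q B" if "B \<in> void_algebra M" for B
  proof -
    have "B \<in> sets P" "B \<in> sets Q" "integral\<^sup>L P (indicator B :: _ \<Rightarrow> real) = integral\<^sup>L Q (indicator B)"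
      using that lsp[of "indicator B"] by (auto simp: void_algebra_def P.sets_P Q.sets_P)
    then show ?thesis
      by simp
  qed
  fix S
  assume S: "S \<in> sets P"
  have "\<bar>measure P S - measure Q S\<bar> \<le> 0 + e" if e: "e > 0" for e
  proof -
    obtain B where *: "B \<in> void_algebra M" "measure P (sym_diff S B) < e / 2" "measure Q (sym_diff S B) < e / 2"
      using void_approximation[OF P Q M, of S "e / 2"] e S by (auto simp: P.sets_P)
    have m: "S \<in> sets P" "B \<in> sets P" "S \<in> sets Q" "B \<in> sets Q"
      using *(1) S by (auto simp: void_algebra_def P.sets_P Q.sets_P)
    have "\<bar>measure P S - measure P B\<bar> \<le> measure P (sym_diff S B)"
      using P.measure_sym_diff_triangle[OF m(1,2), of "{}"] P.measure_sym_diff_triangle[OF m(2,1), of "{}"]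
      by (simp add: Un_commute)
    moreover have "\<bar>measure Q S - measure Q B\<bar> \<le> measure Q (sym_diff S B)"
      using Q.measure_sym_diff_triangle[OF m(3,4), of "{}"] Q.measure_sym_diff_triangle[OF m(4,3), of "{}"]
      by (simp add: Un_commute)
    ultimately show ?thesis
      using * B[OF *(1)] by linarith
  qed
  then have "measure P S = measure Q S"
    using field_le_epsilon[of "\<bar>measure P S - measure Q S\<bar>" 0] by auto
  then show "emeasure P S = emeasure Q S"
    by (simp add: P.emeasure_eq_measure Q.emeasure_eq_measure)
qed

lemma (in poisson_process) void_dense:
  assumes M: "finely_divisible M" and f: "f \<in> L2 P"
  shows "f \<in> L2_closure P (void M ` fmeasurable M)"
proof (rule L2_closure_UNIV[OF _ _ f])
  show V: "void M ` fmeasurable M \<subseteq> L2 P"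
    by (auto simp: void_L2)
  fix S
  assume S: "S \<in> sets P"
  show "indicator S \<in> L2_closure P (void M ` fmeasurable M)"
  proof (rule L2_closureI[OF L2_indicator[OF S]])
    fix e :: real
    assume e: "e > 0"
    obtain B where B: "B \<in> void_algebra M" "prob (sym_diff S B) < e\<^sup>2"
      using void_approximation[OF poisson poisson M, of S "e\<^sup>2"] S e by (auto simp: sets_P)
    have "(indicator S \<omega> - indicator B \<omega>)\<^sup>2 = (indicator (sym_diff S B) \<omega> :: real)" for \<omega>
      by (auto simp: indicator_def)
    moreover have "sym_diff S B \<in> sets P"
      using S B by (auto simp: void_algebra_def sets_P)
    ultimately have "norm2 P (\<lambda>\<omega>. indicator S \<omega> - indicator B \<omega>) = sqrt (prob (sym_diff S B))"
      by (simp add: norm2_def)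
    also have "\<dots> < e"
      using B(2) e real_sqrt_less_mono[OF B(2)] by simp
    finally show "\<exists>g\<in>lspan (void M ` fmeasurable M). norm2 P (\<lambda>x. indicator S x - g x) < e"
      using B(1) by (intro bexI[of _ "indicator B"]) (auto simp: void_algebra_def)
  qed
qed

section \<open>Automorphisms and suspensions\<close>

text \<open>An automorphism together with a chosen inverse modulo null sets.\<close>

definition inverse_pair :: "'a measure \<Rightarrow> ('a \<Rightarrow> 'a) \<Rightarrow> ('a \<Rightarrow> 'a) \<Rightarrow> bool" where
  "inverse_pair M S S' \<longleftrightarrow> S \<in> measurable M M \<and> S' \<in> measurable M M \<and> distr M M S = M \<and> distr M M S' = M \<and>
     (AE x in M. S' (S x) = x) \<and> (AE x in M. S (S' x) = x)"

lemma automorphism_iff: "automorphism M S \<longleftrightarrow> (\<exists>S'. inverse_pair M S S')"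
  by (auto simp: automorphism_def inverse_pair_def)

lemma inverse_pair_sym: "inverse_pair M S S' \<Longrightarrow> inverse_pair M S' S"
  by (auto simp: inverse_pair_def)

lemma inverse_pair_measurable: "inverse_pair M S S' \<Longrightarrow> S \<in> measurable M M"
  and inverse_pair_AE: "inverse_pair M S S' \<Longrightarrow> AE x in M. S' (S x) = x"
  by (auto simp: inverse_pair_def)

lemma AE_preserving:
  assumes "S \<in> measurable M M" "distr M M S = M" "AE x in M. Q x"
  shows "AE x in M. Q (S x)"
  by (rule AE_distrD[OF assms(1)]) (subst assms(2), rule assms(3))

lemma inverse_pair_comp:
  assumes S: "inverse_pair M S S'" and R: "inverse_pair M R R'"
  shows "inverse_pair M (S \<circ> R) (R' \<circ> S')"
proof -
  have m: "S \<in> measurable M M" "S' \<in> measurable M M" "R \<in> measurable M M" "R' \<in> measurable M M"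
    and d: "distr M M S = M" "distr M M S' = M" "distr M M R = M" "distr M M R' = M"
    and a: "AE x in M. S' (S x) = x" "AE x in M. S (S' x) = x" "AE x in M. R' (R x) = x" "AE x in M. R (R' x) = x"
    using assms by (auto simp: inverse_pair_def)
  have "distr M M (S \<circ> R) = M" "distr M M (R' \<circ> S') = M"
    using distr_distr[of S M M R M] distr_distr[of R' M M S' M] m d by simp_all
  moreover have "AE x in M. (R' \<circ> S') ((S \<circ> R) x) = x"
    using a(3) AE_preserving[OF m(3) d(3) a(1)] by eventually_elim simp
  moreover have "AE x in M. (S \<circ> R) ((R' \<circ> S') x) = x"
    using a(2) AE_preserving[OF m(2) d(2) a(4)] by eventually_elim simp
  ultimately show ?thesis
    using m by (auto simp: inverse_pair_def)
qed

lemma inverse_pair_funpow: "inverse_pair M S S' \<Longrightarrow> inverse_pair M (S ^^ n) (S' ^^ n)"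
proof (induction n)
  case 0
  then show ?case
    by (auto simp: inverse_pair_def distr_id[unfolded id_def] id_def)
next
  case (Suc n)
  then show ?case
    using inverse_pair_comp[of M S S' "S ^^ n" "S' ^^ n"] by (simp add: funpow_Suc_right del: funpow.simps) (simp add: funpow_swap1 comp_def)
qed

lemma integral_preserving:
  fixes f :: "'a \<Rightarrow> 'b :: {banach, second_countable_topology}"
  assumes S: "inverse_pair M S S'" and f: "f \<in> borel_measurable M"
  shows "(\<integral>x. f (S x) \<partial>M) = (\<integral>x. f x \<partial>M)"
  using integral_distr[of S M M f] S f by (simp add: inverse_pair_def)

lemma integral_adjoint:
  fixes f g :: "'a \<Rightarrow> real"
  assumes S: "inverse_pair M S S'" and fg [measurable]: "f \<in> borel_measurable M" "g \<in> borel_measurable M"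
  shows "(\<integral>x. f (S x) * g x \<partial>M) = (\<integral>x. f x * g (S' x) \<partial>M)"
proof -
  have [measurable]: "S \<in> measurable M M" "S' \<in> measurable M M"
    using S by (auto simp: inverse_pair_def)
  have "(\<integral>x. f (S x) * g x \<partial>M) = (\<integral>x. f (S x) * g (S' (S x)) \<partial>M)"
    using inverse_pair_AE[OF S] by (intro integral_cong_AE) auto
  also have "\<dots> = (\<integral>x. f x * g (S' x) \<partial>M)"
    using integral_preserving[OF S, of "\<lambda>x. f x * g (S' x)"] by simp
  finally show ?thesis .
qed

lemma L2_preserving:
  assumes S: "inverse_pair M S S'" and f: "f \<in> L2 M"
  shows "(\<lambda>x. f (S x)) \<in> L2 M" "norm2 M (\<lambda>x. f (S x)) = norm2 M f"
proof -
  have [measurable]: "S \<in> measurable M M" "f \<in> borel_measurable M"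
    using S f by (auto simp: inverse_pair_def L2_def)
  have "integrable (distr M M S) (\<lambda>x. (f x)\<^sup>2)"
    using S f by (simp add: inverse_pair_def L2_def)
  then show "(\<lambda>x. f (S x)) \<in> L2 M"
    by (simp add: L2_def integrable_distr_eq)
  show "norm2 M (\<lambda>x. f (S x)) = norm2 M f"
    using integral_preserving[OF S, of "\<lambda>x. (f x)\<^sup>2"] by (simp add: norm2_def)
qed

lemma AE_commute_funpow:
  assumes S: "inverse_pair M S S'" and c: "AE x in M. R (S x) = S (R x)"
  shows "AE x in M. R ((S ^^ n) x) = (S ^^ n) (R x)"
proof (induction n)
  case (Suc n)
  have "AE x in M. R (S ((S ^^ n) x)) = S (R ((S ^^ n) x))"
    using inverse_pair_funpow[OF S, of n] by (intro AE_preserving[OF _ _ c]) (auto simp: inverse_pair_def)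
  with Suc show ?case
    by eventually_elim simp
qed simp

lemma AE_root_commute:
  assumes R: "inverse_pair M R R'" and n: "AE x in M. (R ^^ n) x = S x"
  shows "AE x in M. R (S x) = S (R x)"
proof -
  have "AE x in M. (R ^^ n) (R x) = S (R x)"
    using R by (intro AE_preserving[OF _ _ n]) (auto simp: inverse_pair_def)
  with n show ?thesis
    by eventually_elim (metis funpow_swap1)
qed

lemma measure_vimage_preserving:
  "inverse_pair M S S' \<Longrightarrow> A \<in> sets M \<Longrightarrow> emeasure M (S -` A \<inter> space M) = emeasure M A"
  using emeasure_distr[of S M M A] by (simp add: inverse_pair_def)

lemma fmeasurable_vimage:
  "inverse_pair M S S' \<Longrightarrow> A \<in> fmeasurable M \<Longrightarrow> S -` A \<inter> space M \<in> fmeasurable M"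
  using measure_vimage_preserving[of M S S' A] by (auto simp: fmeasurable_def inverse_pair_def)

lemma measure_vimage_adjoint:
  assumes S: "inverse_pair M S S'" and AB: "A \<in> sets M" "B \<in> sets M"
  shows "measure M ((S' -` A \<inter> space M) \<inter> B) = measure M (A \<inter> (S -` B \<inter> space M))"
proof -
  have [measurable]: "S \<in> measurable M M" "S' \<in> measurable M M"
    using S by (auto simp: inverse_pair_def)
  have sp: "S x \<in> space M" if "x \<in> space M" for x
    using that measurable_space[of S M M] by simp
  have m: "(S' -` A \<inter> space M) \<inter> B \<in> sets M"
    using AB by auto
  have "emeasure M ((S' -` A \<inter> space M) \<inter> B) = emeasure M (S -` ((S' -` A \<inter> space M) \<inter> B) \<inter> space M)"
    using measure_vimage_preserving[OF S m] by simp
  also have "\<dots> = emeasure M (A \<inter> (S -` B \<inter> space M))"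
    using inverse_pair_AE[OF S] AB m sets.sets_into_space[OF AB(1)]
    by (intro emeasure_eq_AE) (auto intro: sp)
  finally show ?thesis
    by (simp add: measure_def)
qed

lemma suspension_configuration:
  assumes "\<omega> \<in> configurations M" "T \<in> measurable M M"
  shows "poisson_suspension M T \<omega> \<in> configurations M"
proof -
  obtain I :: "nat set" and x where x: "x \<in> I \<rightarrow> space M" "\<omega> = distr (count_space I) M x"
    using assms(1) by (auto simp: configurations_def)
  have "distr \<omega> M T = distr (count_space I) M (T \<circ> x)"
    using x assms(2) by (auto simp: distr_distr)
  moreover have "T \<circ> x \<in> I \<rightarrow> space M"
    using x(1) measurable_space[OF assms(2)] by (auto simp: Pi_iff)
  ultimately show ?thesis
    by (auto simp: poisson_suspension_def configurations_def)
qed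

lemma emeasure_suspension:
  assumes "\<omega> \<in> configurations M" "T \<in> measurable M M" "A \<in> sets M"
  shows "emeasure (poisson_suspension M T \<omega>) A = emeasure \<omega> (T -` A \<inter> space M)"
proof -
  have s: "sets \<omega> = sets M"
    using assms(1) by (rule configurations_sets)
  then show ?thesis
    using assms(2,3) by (simp add: poisson_suspension_def emeasure_distr measurable_cong_sets[OF s refl] sets_eq_imp_space_eq[OF s])
qed

lemma suspension_funpow:
  assumes "\<omega> \<in> configurations M" "T \<in> measurable M M"
  shows "(poisson_suspension M T ^^ n) \<omega> = poisson_suspension M (T ^^ n) \<omega>"
proof (induction n)
  case 0
  have s: "sets M = sets \<omega>"
    using assms(1) by (simp add: configurations_sets)
  show ?case
    using distr_id2[OF s] by (simp add: poisson_suspension_def id_def)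
next
  case (Suc n)
  have s: "sets \<omega> = sets M"
    using assms(1) by (rule configurations_sets)
  have "T ^^ n \<in> measurable M M"
    using assms(2) by (induction n) (auto simp: measurable_ident id_def intro: measurable_comp[unfolded comp_def] simp: comp_def)
  then have "distr (distr \<omega> M (T ^^ n)) M T = distr \<omega> M (T \<circ> (T ^^ n))"
    using assms(2) by (intro distr_distr) (simp_all add: measurable_cong_sets[OF s refl])
  then show ?case
    using Suc by (simp add: poisson_suspension_def comp_def)
qed

context poisson_process
begin

lemma suspension_measurable:
  assumes T [measurable]: "T \<in> measurable M M"
  shows "poisson_suspension M T \<in> measurable P P"
proof -
  have "poisson_suspension M T \<in> measurable P (configuration_algebra M)"
  proof (rule measurable_configuration_algebra)
    show "poisson_suspension M T \<omega> \<in> configurations M" if "\<omega> \<in> space P" for \<omega>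
      using that T by (intro suspension_configuration) (auto simp: space_P)
    fix A
    assume A[measurable]: "A \<in> sets M"
    have "(\<lambda>\<omega>. emeasure \<omega> (T -` A \<inter> space M)) \<in> borel_measurable P"
      by measurable
    then show "(\<lambda>\<omega>. emeasure (poisson_suspension M T \<omega>) A) \<in> borel_measurable P"
      using T A by (subst measurable_cong[of P _ "\<lambda>\<omega>. emeasure \<omega> (T -` A \<inter> space M)"])
        (simp_all add: emeasure_suspension space_P)
  qed
  then show ?thesis
    by (simp add: measurable_cong_sets[OF refl sets_P])
qed

text \<open>The image of a Poisson measure under the suspension satisfies the defining conditions of a Poisson
  measure with the same intensity, which is unique.\<close>

lemma suspension_preserving:
  assumes T: "T \<in> measurable M M" "distr M M T = M" and M: "finely_divisible M"
  shows "distr P P (poisson_suspension M T) = P"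
proof -
  let ?S = "poisson_suspension M T"
  define Q where "Q = distr P P ?S"
  have S[measurable]: "?S \<in> measurable P P"
    using T(1) by (rule suspension_measurable)
  interpret Q: prob_space Q
    unfolding Q_def by (rule prob_space_distr) measurable
  have sQ: "sets Q = sets P" "space Q = space P"
    by (auto simp: Q_def)
  have em: "emeasure (?S \<omega>) A = emeasure \<omega> (T -` A \<inter> space M)" if "\<omega> \<in> space P" "A \<in> sets M" for \<omega> A
    using that T by (simp add: emeasure_suspension space_P)
  have pre: "T -` A \<inter> space M \<in> sets M" "emeasure M (T -` A \<inter> space M) = emeasure M A" if "A \<in> sets M" for A
    using that T emeasure_distr[OF T(1) that] measurable_sets[OF T(1) that] by auto
  have "poisson_measure M Q"
    unfolding poisson_measure_def
  proof (intro conjI ballI impI allI)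
    show "prob_space Q"
      by (rule Q.prob_space_axioms)
    show "sets Q = sets (configuration_algebra M)"
      by (simp add: sQ sets_P)
    show "measure Q {\<omega> \<in> space Q. emeasure \<omega> A = of_nat n} = measure M A ^ n / fact n * exp (- measure M A)"
      if A: "A \<in> sets M" "emeasure M A < \<infinity>" for A and n :: nat
    proof -
      have [measurable]: "A \<in> sets M"
        by fact
      have "measure Q {\<omega> \<in> space Q. emeasure \<omega> A = of_nat n} = prob (?S -` {\<omega> \<in> space P. emeasure \<omega> A = of_nat n} \<inter> space P)"
        unfolding sQ unfolding Q_def by (rule measure_distr) measurable
      also have "?S -` {\<omega> \<in> space P. emeasure \<omega> A = of_nat n} \<inter> space P = 
          {\<omega> \<in> space P. emeasure \<omega> (T -` A \<inter> space M) = of_nat n}"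
        using em[OF _ A(1)] measurable_space[OF S] by auto
      also have "prob \<dots> = measure M (T -` A \<inter> space M) ^ n / fact n * exp (- measure M (T -` A \<inter> space M))"
        using poisson pre[OF A(1)] A(2) by (simp add: poisson_measure_def)
      also have "measure M (T -` A \<inter> space M) = measure M A"
        using pre[OF A(1)] by (simp add: measure_def)
      finally show ?thesis .
    qed
    show "Q.indep_vars (\<lambda>_. borel) (\<lambda>i \<omega>. emeasure \<omega> (A i)) UNIV"
      if A: "range A \<subseteq> sets M" "disjoint_family A" for A :: "nat \<Rightarrow> 'a set"
    proof -
      have Am[measurable]: "A i \<in> sets M" for i
        using A(1) by auto
      have "disjoint_family (\<lambda>i. T -` A i \<inter> space M)" "range (\<lambda>i. T -` A i \<inter> space M) \<subseteq> sets M"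
        using A(2) pre(1)[OF Am] by (auto simp: disjoint_family_on_def)
      then have "indep_vars (\<lambda>_. borel) (\<lambda>i \<omega>. emeasure \<omega> (T -` A i \<inter> space M)) UNIV"
        using poisson by (auto simp: poisson_measure_def)
      then have "distr P (\<Pi>\<^sub>M i\<in>UNIV. borel) (\<lambda>\<omega>. \<lambda>i\<in>UNIV. emeasure \<omega> (T -` A i \<inter> space M)) =
          (\<Pi>\<^sub>M i\<in>UNIV. distr P borel (\<lambda>\<omega>. emeasure \<omega> (T -` A i \<inter> space M)))"
        using pre(1)[OF Am] by (subst (asm) indep_vars_iff_distr_eq_PiM') auto
      moreover have "distr Q borel (\<lambda>\<omega>. emeasure \<omega> (A i)) = distr P borel (\<lambda>\<omega>. emeasure \<omega> (T -` A i \<inter> space M))" for i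
        unfolding Q_def using em[OF _ Am] by (subst distr_distr) (auto intro!: distr_cong)
      moreover have "distr Q (\<Pi>\<^sub>M i\<in>UNIV. borel) (\<lambda>\<omega>. \<lambda>i\<in>UNIV. emeasure \<omega> (A i)) =
          distr P (\<Pi>\<^sub>M i\<in>UNIV. borel) (\<lambda>\<omega>. \<lambda>i\<in>UNIV. emeasure \<omega> (T -` A i \<inter> space M))"
        unfolding Q_def using em[OF _ Am] by (subst distr_distr) (auto intro!: distr_cong measurable_restrict)
      moreover have "Q.random_variable borel (\<lambda>\<omega>. emeasure \<omega> (A i))" for i
        using measurable_emeasure_points[OF Am] by (simp add: Q_def)
      ultimately show ?thesis
        by (subst Q.indep_vars_iff_distr_eq_PiM') simp_all
    qed
  qed
  then have "P = Q"
    by (intro poisson_measure_unique[OF poisson _ M])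
  then show ?thesis
    by (simp add: Q_def)
qed

lemma suspension_inverse:
  assumes T: "inverse_pair M T T'" 
  shows "AE \<omega> in P. poisson_suspension M T' (poisson_suspension M T \<omega>) = \<omega>"
proof -
  have m: "T \<in> measurable M M" "T' \<in> measurable M M"
    using T by (auto simp: inverse_pair_def)
  obtain N where N: "{x \<in> space M. T' (T x) \<noteq> x} \<subseteq> N" "N \<in> sets M" "emeasure M N = 0"
    using inverse_pair_AE[OF T] by (auto elim: AE_E)
  have Nf: "N \<in> fmeasurable M"
    using N by (auto simp: fmeasurable_def)
  \<comment> \<open>Almost no configuration has a point in the null set \<open>N\<close>, where \<open>T'\<close> fails to invert \<open>T\<close>.\<close>
  have "AE \<omega> in P. points_in N \<omega> = 0"
  proof -
    have "measure M N = 0"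
      using N(3) by (simp add: measure_def)
    then have "prob {\<omega> \<in> space P. points_in N \<omega> = 0} = 1"
      using prob_points[OF Nf, of 0] by simp
    then show ?thesis
      using AE_prob_1 by fastforce
  qed
  with AE_points[OF Nf] AE_space show ?thesis
  proof eventually_elim
    case (elim \<omega>)
    have s: "sets \<omega> = sets M" "space \<omega> = space M"
      using sets_point[OF elim(2)] sets_eq_imp_space_eq by auto
    have "poisson_suspension M T' (poisson_suspension M T \<omega>) = distr \<omega> M (T' \<circ> T)"
      unfolding poisson_suspension_def using m by (intro distr_distr) (simp_all add: measurable_cong_sets[OF s(1) refl])
    also have "\<dots> = distr \<omega> M (\<lambda>x. x)"
    proof (rule distr_cong_AE)
      show "AE x in \<omega>. (T' \<circ> T) x = x"
        using N(1,2) elim s by (intro AE_I[of _ _ N]) auto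
    qed (use m s in \<open>auto simp: measurable_cong_sets[OF s(1) refl]\<close>)
    also have "\<dots> = \<omega>"
      using s using distr_id2[of M \<omega>] by (simp add: id_def)
    finally show ?case .
  qed
qed

lemma suspension_pair:
  assumes "inverse_pair M T T'" "finely_divisible M"
  shows "inverse_pair P (poisson_suspension M T) (poisson_suspension M T')"
  using assms suspension_measurable[of T] suspension_measurable[of T'] suspension_preserving[of T] suspension_preserving[of T']
    suspension_inverse[of T T'] suspension_inverse[of T' T] inverse_pair_sym[of M T T']
  by (auto simp: inverse_pair_def)

lemma points_suspension:
  assumes "\<omega> \<in> space P" "T \<in> measurable M M" "A \<in> sets M"
  shows "points_in A (poisson_suspension M T \<omega>) = points_in (T -` A \<inter> space M) \<omega>"
  using assms emeasure_suspension[of \<omega> M T A] by (simp add: points_in_def measure_def space_P)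

section \<open>Rigidity of suspensions\<close>

lemma point_functionals_suspension:
  assumes "inverse_pair M T T'" "A \<in> sets M" "\<omega> \<in> space P"
  shows compensated_suspension:
      "compensated M A ((poisson_suspension M T ^^ n) \<omega>) = compensated M ((T ^^ n) -` A \<inter> space M) \<omega>"
    and exp_vector_suspension: "exp_vector M z A ((poisson_suspension M T ^^ n) \<omega>) = exp_vector M z ((T ^^ n) -` A \<inter> space M) \<omega>"
    and void_suspension: "void M A ((poisson_suspension M T ^^ n) \<omega>) = void M ((T ^^ n) -` A \<inter> space M) \<omega>"
proof -
  have T: "T \<in> measurable M M" "T ^^ n \<in> measurable M M"
    using assms(1) inverse_pair_funpow[OF assms(1), of n] by (auto simp: inverse_pair_def)
  have \<omega>: "\<omega> \<in> configurations M"
    using assms(3) by (simp add: space_P)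
  have S: "(poisson_suspension M T ^^ n) \<omega> = poisson_suspension M (T ^^ n) \<omega>"
    using suspension_funpow[OF \<omega> T(1)] .
  have m: "measure M ((T ^^ n) -` A \<inter> space M) = measure M A"
    using measure_vimage_preserving[OF inverse_pair_funpow[OF assms(1)] assms(2), of n] by (simp add: measure_def)
  show "compensated M A ((poisson_suspension M T ^^ n) \<omega>) = compensated M ((T ^^ n) -` A \<inter> space M) \<omega>"
    and "exp_vector M z A ((poisson_suspension M T ^^ n) \<omega>) = exp_vector M z ((T ^^ n) -` A \<inter> space M) \<omega>"
    unfolding S compensated_def exp_vector_def m points_suspension[OF assms(3) T(2) assms(2)] by simp_all
  show "void M A ((poisson_suspension M T ^^ n) \<omega>) = void M ((T ^^ n) -` A \<inter> space M) \<omega>"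
    unfolding S void_def indicator_def
    using emeasure_suspension[OF \<omega> T(2) assms(2)] suspension_configuration[OF \<omega> T(2)] \<omega> by simp
qed

text \<open>The void indicators of \<open>A\<close> and of its preimage differ only on configurations with a point in the
  symmetric difference. So the convergence holds on void indicators, which are total, and extends to
  \<open>L\<^sub>2\<close> because composition with the suspension is isometric.\<close>

lemma rigid_suspension:
  assumes T: "inverse_pair M T T'" and M: "finely_divisible M" and n: "filterlim n at_top sequentially"
    and lim: "\<And>A. A \<in> fmeasurable M \<Longrightarrow> (\<lambda>i. measure M (((T ^^ n i) -` A \<inter> space M) \<inter> A)) \<longlonglongrightarrow> measure M A"
  shows "rigid P (poisson_suspension M T)"
proof -
  let ?S = "poisson_suspension M T"
  have S: "inverse_pair P ?S (poisson_suspension M T')"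
    by (rule suspension_pair[OF T M])
  note Sn = inverse_pair_funpow[OF S]
  define V where "V = void M ` fmeasurable M"
  have V: "V \<subseteq> L2 P"
    by (auto simp: V_def void_L2)
  have voids: "(\<lambda>i. norm2 P (\<lambda>\<omega>. v ((?S ^^ n i) \<omega>) - v \<omega>)) \<longlonglongrightarrow> 0" if v: "v \<in> V" for v
  proof -
    obtain C where C: "C \<in> fmeasurable M" "v = void M C"
      using v by (auto simp: V_def)
    define Ci where "Ci i = (T ^^ n i) -` C \<inter> space M" for i
    have Cf: "Ci i \<in> fmeasurable M" for i
      unfolding Ci_def by (rule fmeasurable_vimage[OF inverse_pair_funpow[OF T] C(1)])
    have m: "measure M (Ci i) = measure M C" for i
      using measure_vimage_preserving[OF inverse_pair_funpow[OF T], of C "n i"] C(1) by (simp add: Ci_def measure_def fmeasurableD)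
    have "(norm2 P (\<lambda>\<omega>. v ((?S ^^ n i) \<omega>) - v \<omega>))\<^sup>2 = 2 * exp (- measure M C) - 2 * exp (measure M (Ci i \<inter> C) - 2 * measure M C)" for i
    proof -
      have sq: "void M A \<omega> * void M A \<omega> = void M A \<omega>" for A \<omega>
        by (simp add: void_def indicator_def)
      have "(norm2 P (\<lambda>\<omega>. v ((?S ^^ n i) \<omega>) - v \<omega>))\<^sup>2 = (\<integral>\<omega>. (void M (Ci i) \<omega> - void M C \<omega>)\<^sup>2 \<partial>P)"
        unfolding norm2_square C(2) using void_suspension[OF T fmeasurableD[OF C(1)]]
        by (intro Bochner_Integration.integral_cong) (auto simp: Ci_def)
      also have "\<dots> = (\<integral>\<omega>. void M (Ci i) \<omega> + void M C \<omega> - 2 * void M (Ci i \<union> C) \<omega> \<partial>P)"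
        using void_mult[of "Ci i" M C] Cf[of i] C(1)
        by (intro Bochner_Integration.integral_cong) (auto simp: power2_eq_square algebra_simps sq fun_eq_iff)
      also have "\<dots> = exp (- measure M (Ci i)) + exp (- measure M C) - 2 * exp (- measure M (Ci i \<union> C))"
        using Cf[of i] C(1) fmeasurable.Un[OF Cf[of i] C(1)]
        by (simp add: integral_void L2_integrable void_L2 fmeasurableD)
      also have "measure M (Ci i \<union> C) = 2 * measure M C - measure M (Ci i \<inter> C)"
        using measure_Un3[OF Cf[of i] C(1)] by (simp add: m)
      finally show ?thesis
        by (simp add: m)
    qed
    moreover have "(\<lambda>i. 2 * exp (- measure M C) - 2 * exp (measure M (Ci i \<inter> C) - 2 * measure M C))
        \<longlonglongrightarrow> 2 * exp (- measure M C) - 2 * exp (measure M C - 2 * measure M C)"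
      using lim[OF C(1)] unfolding Ci_def by (intro tendsto_intros)
    ultimately have "(\<lambda>i. (norm2 P (\<lambda>\<omega>. v ((?S ^^ n i) \<omega>) - v \<omega>))\<^sup>2) \<longlonglongrightarrow> 0"
      by simp
    then show ?thesis
      using tendsto_real_sqrt[of "\<lambda>i. (norm2 P (\<lambda>\<omega>. v ((?S ^^ n i) \<omega>) - v \<omega>))\<^sup>2" 0] by simp
  qed
  have span: "(\<lambda>i. norm2 P (\<lambda>\<omega>. g ((?S ^^ n i) \<omega>) - g \<omega>)) \<longlonglongrightarrow> 0" if "g \<in> lspan V" for g
    using that
  proof (induction rule: lspan.induct)
    case zero
    then show ?case
      by (simp add: norm2_def)
  next
    case (step v g c)
    have v: "v \<in> L2 P" and g: "g \<in> L2 P"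
      using step V lspan_L2[OF V] by auto
    have d: "(\<lambda>\<omega>. u ((?S ^^ n i) \<omega>) - u \<omega>) \<in> L2 P" if "u \<in> L2 P" for u i
      using L2_preserving(1)[OF Sn that] that by (intro L2_diff)
    have "norm2 P (\<lambda>\<omega>. (c * v ((?S ^^ n i) \<omega>) + g ((?S ^^ n i) \<omega>)) - (c * v \<omega> + g \<omega>)) \<le>
        \<bar>c\<bar> * norm2 P (\<lambda>\<omega>. v ((?S ^^ n i) \<omega>) - v \<omega>) + norm2 P (\<lambda>\<omega>. g ((?S ^^ n i) \<omega>) - g \<omega>)" for i
      using norm2_triangle[OF L2_cmult[OF d[OF v, of i], of c] d[OF g, of i]] norm2_cmult[of P c "\<lambda>\<omega>. v ((?S ^^ n i) \<omega>) - v \<omega>"]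
      by (simp add: algebra_simps)
    moreover have "(\<lambda>i. \<bar>c\<bar> * norm2 P (\<lambda>\<omega>. v ((?S ^^ n i) \<omega>) - v \<omega>) + norm2 P (\<lambda>\<omega>. g ((?S ^^ n i) \<omega>) - g \<omega>)) \<longlonglongrightarrow> \<bar>c\<bar> * 0 + 0"
      by (intro tendsto_intros voids step)
    ultimately show ?case
      by (intro norm2_null[where u="\<lambda>i. \<bar>c\<bar> * norm2 P (\<lambda>\<omega>. v ((?S ^^ n i) \<omega>) - v \<omega>) + norm2 P (\<lambda>\<omega>. g ((?S ^^ n i) \<omega>) - g \<omega>)"]) simp_all
  qed
  have real: "(\<lambda>i. norm2 P (\<lambda>\<omega>. f ((?S ^^ n i) \<omega>) - f \<omega>)) \<longlonglongrightarrow> 0" if f: "f \<in> L2 P" for f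
  proof (rule LIMSEQ_I)
    fix e :: real
    assume e: "e > 0"
    obtain g where g: "g \<in> lspan V" "norm2 P (\<lambda>\<omega>. f \<omega> - g \<omega>) < e / 3"
      using L2_closureD[OF void_dense[OF M f], of "e / 3"] e by (auto simp: V_def)
    have gL: "g \<in> L2 P"
      using lspan_L2[OF V g(1)] .
    obtain i0 where i0: "\<And>i. i \<ge> i0 \<Longrightarrow> norm2 P (\<lambda>\<omega>. g ((?S ^^ n i) \<omega>) - g \<omega>) < e / 3"
      using LIMSEQ_D[OF span[OF g(1)], of "e / 3"] e by auto
    have "norm2 P (\<lambda>\<omega>. f ((?S ^^ n i) \<omega>) - f \<omega>) < e" if "i \<ge> i0" for i
    proof -
      note L = L2_preserving(1)[OF Sn[of "n i"] f] L2_preserving(1)[OF Sn[of "n i"] gL]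
      have 1: "norm2 P (\<lambda>\<omega>. f ((?S ^^ n i) \<omega>) - g ((?S ^^ n i) \<omega>)) = norm2 P (\<lambda>\<omega>. f \<omega> - g \<omega>)"
        using L2_preserving(2)[OF Sn[of "n i"] L2_diff[OF f gL]] .
      have 2: "norm2 P (\<lambda>\<omega>. g \<omega> - f \<omega>) = norm2 P (\<lambda>\<omega>. f \<omega> - g \<omega>)"
        by (rule norm2_cong) (simp add: power2_commute)
      show ?thesis
        using norm2_triangle_diff[OF L(1) L(2) f] norm2_triangle_diff[OF L(2) gL f] 1 2 g(2) i0[OF that] by linarith
    qed
    then show "\<exists>i0. \<forall>i\<ge>i0. norm (norm2 P (\<lambda>\<omega>. f ((?S ^^ n i) \<omega>) - f \<omega>) - 0) < e"
      by (intro exI[of _ i0]) simp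
  qed
  show ?thesis
    unfolding rigid_def
  proof (intro conjI exI[of _ n] allI impI n)
    show "automorphism P ?S"
      using S by (auto simp: automorphism_iff)
    fix f :: "'a measure \<Rightarrow> complex"
    assume f: "f \<in> borel_measurable P" "integrable P (\<lambda>x. (cmod (f x))\<^sup>2)"
    have Re: "(\<lambda>x. Re (f x)) \<in> L2 P" and Im: "(\<lambda>x. Im (f x)) \<in> L2 P"
      using f by (auto simp: L2_def cmod_power2 intro!: Bochner_Integration.integrable_bound[OF f(2)])
    have "(\<integral>x. (cmod (f ((?S ^^ n i) x) - f x))\<^sup>2 \<partial>P) =
        (norm2 P (\<lambda>x. Re (f ((?S ^^ n i) x)) - Re (f x)))\<^sup>2 + (norm2 P (\<lambda>x. Im (f ((?S ^^ n i) x)) - Im (f x)))\<^sup>2" for i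
      unfolding norm2_square
      using L2_square[OF L2_diff[OF L2_preserving(1)[OF Sn Re] Re]] L2_square[OF L2_diff[OF L2_preserving(1)[OF Sn Im] Im]]
      by (subst Bochner_Integration.integral_add[symmetric]) (auto simp: cmod_power2)
    moreover have "(\<lambda>i. (norm2 P (\<lambda>x. Re (f ((?S ^^ n i) x)) - Re (f x)))\<^sup>2 + (norm2 P (\<lambda>x. Im (f ((?S ^^ n i) x)) - Im (f x)))\<^sup>2) \<longlonglongrightarrow> 0\<^sup>2 + 0\<^sup>2"
      by (intro tendsto_intros real[OF Re] real[OF Im])
    ultimately show "(\<lambda>i. \<integral>x. (cmod (f ((?S ^^ n i) x) - f x))\<^sup>2 \<partial>P) \<longlonglongrightarrow> 0"
      by simp
  qed
qed

section \<open>The centralizer acts on the first chaos\<close>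

text \<open>The covariance of \<open>N\<^sub>A \<circ> R\<close> and \<open>N\<^sub>B\<close> when \<open>R\<close> preserves the measure. It is the matrix
  coefficient, at the indicators of \<open>A\<close> and \<open>B\<close>, of the operator that \<open>R\<close> induces on the first
  chaos.\<close>

definition corr :: "('a measure \<Rightarrow> 'a measure) \<Rightarrow> 'a set \<Rightarrow> 'a set \<Rightarrow> real" where
  "corr R A B = (\<integral>\<omega>. compensated M A (R \<omega>) * compensated M B \<omega> \<partial>P)"

text \<open>Weak convergence only has to be tested against void indicators, and their scalar products with the
  first chaos depend on the sets through the measures of intersections.\<close>

lemma compensated_weak_limit:
  assumes M: "finely_divisible M" and A: "A \<in> fmeasurable M" and Ai: "\<And>i. Ai i \<in> fmeasurable M" "\<And>i. measure M (Ai i) = measure M A"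
    and lim: "\<And>C. C \<in> fmeasurable M \<Longrightarrow> (\<lambda>i. measure M (Ai i \<inter> C)) \<longlonglongrightarrow> measure M (A \<inter> C) / 2"
    and G: "G \<in> L2 P"
  shows "(\<lambda>i. \<integral>\<omega>. G \<omega> * compensated M (Ai i) \<omega> \<partial>P) \<longlonglongrightarrow> (\<integral>\<omega>. G \<omega> * compensated M A \<omega> \<partial>P) / 2"
proof -
  have "(\<lambda>i. \<integral>\<omega>. G \<omega> * compensated M (Ai i) \<omega> \<partial>P) \<longlonglongrightarrow> (\<integral>\<omega>. G \<omega> * (1 / 2 * compensated M A \<omega>) \<partial>P)"
  proof (rule weak_convergence_L2[OF _ void_dense[OF M G]])
    show "void M ` fmeasurable M \<subseteq> L2 P"
      by (auto simp: void_L2)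
    show "compensated M (Ai i) \<in> L2 P" "norm2 P (compensated M (Ai i)) \<le> sqrt (measure M A)" for i
      using Ai[of i] by (simp_all add: compensated_L2 norm2_compensated)
    show "(\<lambda>\<omega>. 1 / 2 * compensated M A \<omega>) \<in> L2 P"
      by (intro L2_cmult compensated_L2 A)
    show "norm2 P (\<lambda>\<omega>. 1 / 2 * compensated M A \<omega>) \<le> sqrt (measure M A)"
      unfolding norm2_cmult norm2_compensated[OF A] by simp
    fix v
    assume "v \<in> void M ` fmeasurable M"
    then obtain C where C: "C \<in> fmeasurable M" "v = void M C"
      by auto
    have "(\<lambda>i. - exp (- measure M C) * measure M (Ai i \<inter> C)) \<longlonglongrightarrow> - exp (- measure M C) * (measure M (A \<inter> C) / 2)"
      by (intro tendsto_intros lim C)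
    moreover have "(\<integral>\<omega>. v \<omega> * compensated M B \<omega> \<partial>P) = - exp (- measure M C) * measure M (B \<inter> C)" if "B \<in> fmeasurable M" for B
      using integral_compensated_void[OF that C(1)] C(2) by (simp add: mult.commute)
    moreover have "(\<integral>\<omega>. v \<omega> * (1 / 2 * compensated M A \<omega>) \<partial>P) = 1 / 2 * (\<integral>\<omega>. v \<omega> * compensated M A \<omega> \<partial>P)"
      by (subst integral_mult_right_zero[symmetric]) (simp add: mult_ac)
    ultimately show "(\<lambda>i. \<integral>\<omega>. v \<omega> * compensated M (Ai i) \<omega> \<partial>P) \<longlonglongrightarrow> (\<integral>\<omega>. v \<omega> * (1 / 2 * compensated M A \<omega>) \<partial>P)"
      using Ai A by simp
  qed
  moreover have "(\<integral>\<omega>. G \<omega> * (1 / 2 * compensated M A \<omega>) \<partial>P) = (\<integral>\<omega>. G \<omega> * compensated M A \<omega> \<partial>P) / 2"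
    by (subst integral_divide_zero[symmetric]) (simp add: mult_ac)
  ultimately show ?thesis
    by simp
qed

text \<open>The weak limit maps an exponential vector to the one with half the parameter: on the \<open>k\<close>-th chaos,
  where the exponential vector is homogeneous of degree \<open>k\<close> in \<open>z\<close>, it multiplies by \<open>1/2\<^sup>k\<close>.\<close>

lemma exp_vector_weak_limit:
  assumes M: "finely_divisible M" and A: "A \<in> fmeasurable M" and Ai: "\<And>i. Ai i \<in> fmeasurable M" "\<And>i. measure M (Ai i) = measure M A"
    and lim: "\<And>C. C \<in> fmeasurable M \<Longrightarrow> (\<lambda>i. measure M (Ai i \<inter> C)) \<longlonglongrightarrow> measure M (A \<inter> C) / 2"
    and G: "G \<in> L2 P" and z: "z \<ge> -1"
  shows "(\<lambda>i. \<integral>\<omega>. G \<omega> * exp_vector M z (Ai i) \<omega> \<partial>P) \<longlonglongrightarrow> (\<integral>\<omega>. G \<omega> * exp_vector M (z / 2) A \<omega> \<partial>P)"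
proof (rule weak_convergence_L2[OF _ void_dense[OF M G]])
  have z2: "z / 2 \<ge> -1"
    using z by simp
  show "void M ` fmeasurable M \<subseteq> L2 P"
    by (auto simp: void_L2)
  show "exp_vector M z (Ai i) \<in> L2 P" "norm2 P (exp_vector M z (Ai i)) \<le> sqrt (exp (z\<^sup>2 * measure M A))" for i
    using Ai[of i] z by (simp_all add: exp_vector_L2 norm2_exp_vector)
  show "exp_vector M (z / 2) A \<in> L2 P"
    using A z2 by (rule exp_vector_L2)
  have "z\<^sup>2 / 4 * measure M A \<le> z\<^sup>2 * measure M A"
    by (intro mult_right_mono) auto
  then show "norm2 P (exp_vector M (z / 2) A) \<le> sqrt (exp (z\<^sup>2 * measure M A))"
    unfolding norm2_exp_vector[OF A z2] by (simp add: power_divide)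
  fix v
  assume "v \<in> void M ` fmeasurable M"
  then obtain C where C: "C \<in> fmeasurable M" "v = void M C"
    by auto
  have "(\<lambda>i. exp (- measure M C - z * measure M (Ai i \<inter> C))) \<longlonglongrightarrow> exp (- measure M C - z * (measure M (A \<inter> C) / 2))"
    by (intro tendsto_intros lim C)
  then show "(\<lambda>i. \<integral>\<omega>. v \<omega> * exp_vector M z (Ai i) \<omega> \<partial>P) \<longlonglongrightarrow> (\<integral>\<omega>. v \<omega> * exp_vector M (z / 2) A \<omega> \<partial>P)"
    using integral_exp_vector_void[OF Ai(1) C(1) z] integral_exp_vector_void[OF A C(1) z2] C(2) by simp
qed

text \<open>All moments that occur are explicit, so the distance between the difference quotient at \<open>z = 0\<close>
  and the derivative is computed exactly instead of being estimated by dominated convergence.\<close>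

lemma exp_vector_derivative:
  assumes B: "B \<in> fmeasurable M" and t: "t > 0" "t * z \<ge> -1"
  shows "(norm2 P (\<lambda>\<omega>. (exp_vector M (t * z) B \<omega> - 1) / t - z * compensated M B \<omega>))\<^sup>2
    = (exp (t\<^sup>2 * (z\<^sup>2 * measure M B)) - 1) / t\<^sup>2 - z\<^sup>2 * measure M B"
proof -
  let ?E = "exp_vector M (t * z) B" and ?F = "compensated M B"
  note EL = exp_vector_L2[OF B t(2)] and FL = compensated_L2[OF B]
  note int = L2_mult[OF EL EL] L2_mult[OF EL FL] L2_mult[OF FL FL] L2_integrable[OF EL] L2_integrable[OF FL]
  have "(norm2 P (\<lambda>\<omega>. (?E \<omega> - 1) / t - z * ?F \<omega>))\<^sup>2 =
      (\<integral>\<omega>. (?E \<omega> * ?E \<omega> - 2 * ?E \<omega> + 1) / t\<^sup>2 - 2 * z / t * (?E \<omega> * ?F \<omega>) + 2 * z / t * ?F \<omega> + z\<^sup>2 * (?F \<omega> * ?F \<omega>) \<partial>P)"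
    unfolding norm2_square using t(1)
    by (intro Bochner_Integration.integral_cong) (auto simp: power2_eq_square field_simps)
  also have "\<dots> = ((\<integral>\<omega>. ?E \<omega> * ?E \<omega> \<partial>P) - 2 * (\<integral>\<omega>. ?E \<omega> \<partial>P) + 1) / t\<^sup>2
      - 2 * z / t * (\<integral>\<omega>. ?E \<omega> * ?F \<omega> \<partial>P) + 2 * z / t * (\<integral>\<omega>. ?F \<omega> \<partial>P) + z\<^sup>2 * (\<integral>\<omega>. ?F \<omega> * ?F \<omega> \<partial>P)"
    using int by (simp add: prob_space)
  also have "\<dots> = (exp ((t * z)\<^sup>2 * measure M B) - 2 + 1) / t\<^sup>2 - 2 * z / t * (t * z * measure M B) + z\<^sup>2 * measure M B"
    using exp_vector_square[OF B t(2)] integral_exp_vector[OF B t(2)] integral_exp_vector_compensated[OF B t(2)]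
      integral_compensated[OF B] integral_compensated_square[OF B]
    by (simp add: has_bochner_integral_iff power2_eq_square)
  also have "\<dots> = (exp (t\<^sup>2 * (z\<^sup>2 * measure M B)) - 1) / t\<^sup>2 - z\<^sup>2 * measure M B"
    using t(1) by (simp add: power_mult_distrib power2_eq_square mult.assoc)
  finally show ?thesis .
qed

text \<open>Exponential vectors are differentiable in \<open>L\<^sub>2\<close> at \<open>z = 0\<close>, and the derivative is the element of
  the first chaos.\<close>

lemma exp_vector_derivative_limit:
  assumes B: "B \<in> fmeasurable M" and z: "z \<ge> -1" and G: "G \<in> L2 P"
  shows "(\<lambda>i. ((\<integral>\<omega>. G \<omega> * exp_vector M (z / 2 ^ i) B \<omega> \<partial>P) - (\<integral>\<omega>. G \<omega> \<partial>P)) * 2 ^ i)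
    \<longlonglongrightarrow> z * (\<integral>\<omega>. G \<omega> * compensated M B \<omega> \<partial>P)"
proof -
  define t :: "nat \<Rightarrow> real" where "t i = 1 / 2 ^ i" for i
  have t: "t i > 0" "t i \<le> 1" for i
    by (simp_all add: t_def)
  have tz: "t i * z \<ge> -1" for i
  proof (cases "z \<ge> 0")
    case True
    then have "0 \<le> t i * z"
      using t[of i] by simp
    then show ?thesis
      by linarith
  next
    case False
    then have "1 * z \<le> t i * z"
      using t[of i] by (intro mult_right_mono_neg) auto
    then show ?thesis
      using z by linarith
  qed
  define D where "D i \<omega> = (exp_vector M (t i * z) B \<omega> - 1) / t i - z * compensated M B \<omega>" for i \<omega>
  define c where "c = z\<^sup>2 * measure M B"
  have c: "c \<ge> 0"
    by (simp add: c_def)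
  have tlim: "t \<longlonglongrightarrow> 0"
    unfolding t_def using LIMSEQ_divide_realpow_zero[of 2 1] by simp
  have DL: "D i \<in> L2 P" for i
  proof -
    have "(\<lambda>\<omega>. 1 / t i * (exp_vector M (t i * z) B \<omega> - 1) - z * compensated M B \<omega>) \<in> L2 P"
      by (intro L2_diff L2_cmult exp_vector_L2 compensated_L2 L2_const B tz)
    then show ?thesis
      by (simp add: D_def[abs_def])
  qed
  have "\<forall>\<^sub>F i in sequentially. (norm2 P (D i))\<^sup>2 \<le> (t i)\<^sup>2 * c\<^sup>2"
  proof -
    have "(\<lambda>i. (t i)\<^sup>2 * c) \<longlonglongrightarrow> 0\<^sup>2 * c"
      by (intro tendsto_intros tlim)
    then have "\<forall>\<^sub>F i in sequentially. (t i)\<^sup>2 * c < 1"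
      by (intro order_tendstoD(2)) auto
    then show ?thesis
    proof eventually_elim
      case (elim i)
      let ?y = "(t i)\<^sup>2 * c"
      have "exp ?y \<le> 1 + ?y + ?y\<^sup>2"
        using elim c by (intro exp_bound) auto
      then have "(exp ?y - 1) / (t i)\<^sup>2 \<le> (?y + ?y\<^sup>2) / (t i)\<^sup>2"
        by (intro divide_right_mono) auto
      also have "\<dots> = c + (t i)\<^sup>2 * c\<^sup>2"
        using t(1)[of i] by (simp add: power2_eq_square field_simps)
      finally show ?case
        using exp_vector_derivative[OF B t(1) tz] by (simp add: D_def[abs_def] c_def)
    qed
  qed
  then have bound: "\<forall>\<^sub>F i in sequentially. norm (norm2 P (D i)) \<le> t i * c"
  proof eventually_elim
    case (elim i)
    then have "(norm2 P (D i))\<^sup>2 \<le> (t i * c)\<^sup>2"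
      by (simp add: power_mult_distrib)
    moreover have "0 \<le> t i * c"
      using t(1)[of i] c by simp
    ultimately have "norm2 P (D i) \<le> t i * c"
      by (rule power2_le_imp_le)
    then show ?case
      by simp
  qed
  have "(\<lambda>i. t i * c) \<longlonglongrightarrow> 0"
    using tendsto_mult_right[OF tlim, of c] by simp
  with bound have Dlim: "(\<lambda>i. norm2 P (D i)) \<longlonglongrightarrow> 0"
    by (rule Lim_null_comparison)
  have "(\<lambda>i. \<integral>\<omega>. G \<omega> * D i \<omega> \<partial>P) \<longlonglongrightarrow> 0"
  proof (rule Lim_null_comparison)
    show "\<forall>\<^sub>F i in sequentially. norm (\<integral>\<omega>. G \<omega> * D i \<omega> \<partial>P) \<le> norm2 P G * norm2 P (D i)"
      using Cauchy_Schwarz_L2[OF G DL] by simp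
    show "(\<lambda>i. norm2 P G * norm2 P (D i)) \<longlonglongrightarrow> 0"
      using tendsto_mult_left[OF Dlim, of "norm2 P G"] by simp
  qed
  moreover have "((\<integral>\<omega>. G \<omega> * exp_vector M (z / 2 ^ i) B \<omega> \<partial>P) - (\<integral>\<omega>. G \<omega> \<partial>P)) * 2 ^ i =
      (\<integral>\<omega>. G \<omega> * D i \<omega> \<partial>P) + z * (\<integral>\<omega>. G \<omega> * compensated M B \<omega> \<partial>P)" for i
  proof -
    have "(\<integral>\<omega>. G \<omega> * D i \<omega> \<partial>P) = (\<integral>\<omega>. (G \<omega> * exp_vector M (t i * z) B \<omega> - G \<omega>) / t i - z * (G \<omega> * compensated M B \<omega>) \<partial>P)"
      using t(1)[of i] by (intro Bochner_Integration.integral_cong) (auto simp: D_def field_simps)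
    also have "\<dots> = ((\<integral>\<omega>. G \<omega> * exp_vector M (t i * z) B \<omega> \<partial>P) - (\<integral>\<omega>. G \<omega> \<partial>P)) / t i - z * (\<integral>\<omega>. G \<omega> * compensated M B \<omega> \<partial>P)"
      using L2_mult[OF G exp_vector_L2[OF B tz]] L2_mult[OF G compensated_L2[OF B]] L2_integrable[OF G] by simp
    finally show ?thesis
      by (simp add: t_def)
  qed
  ultimately show ?thesis
    using tendsto_add[of "\<lambda>i. \<integral>\<omega>. G \<omega> * D i \<omega> \<partial>P" 0 sequentially "\<lambda>_. z * (\<integral>\<omega>. G \<omega> * compensated M B \<omega> \<partial>P)"] by simp
qed

end

text \<open>The sequence \<open>n\<close> is one along which \<open>T\<close> tends weakly to half of the identity, and \<open>R\<close> is an
  automorphism in the centralizer of the suspension of \<open>T\<close>.\<close>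

locale suspension_centralizer = poisson_process M P for M :: "'a measure" and P +
  fixes T T' :: "'a \<Rightarrow> 'a" and n :: "nat \<Rightarrow> nat"
    and R R' :: "'a measure \<Rightarrow> 'a measure"
  assumes divisible: "finely_divisible M"
    and T: "inverse_pair M T T'"
    and half: "\<And>A B. A \<in> fmeasurable M \<Longrightarrow> B \<in> fmeasurable M \<Longrightarrow>
      (\<lambda>i. measure M (((T ^^ n i) -` A \<inter> space M) \<inter> B)) \<longlonglongrightarrow> measure M (A \<inter> B) / 2"
    and R: "inverse_pair P R R'"
    and commute: "AE \<omega> in P. R (poisson_suspension M T \<omega>) = poisson_suspension M T (R \<omega>)"
begin

abbreviation "S \<equiv> poisson_suspension M T"
abbreviation "S' \<equiv> poisson_suspension M T'"

lemma S: "inverse_pair P S S'"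
  by (rule suspension_pair[OF T divisible])

lemma R_measurable [measurable]: "R \<in> measurable P P" "R' \<in> measurable P P"
  using R by (auto simp: inverse_pair_def)

lemma compensated_R_L2: "A \<in> fmeasurable M \<Longrightarrow> (\<lambda>\<omega>. compensated M A (R \<omega>)) \<in> L2 P"
  by (rule L2_preserving(1)[OF R compensated_L2])

lemma vimage_measure: "A \<in> fmeasurable M \<Longrightarrow> measure M ((T ^^ m) -` A \<inter> space M) = measure M A"
  using measure_vimage_preserving[OF inverse_pair_funpow[OF T], of A m] by (simp add: measure_def fmeasurableD)

lemma vimage_measure': "A \<in> fmeasurable M \<Longrightarrow> measure M ((T' ^^ m) -` A \<inter> space M) = measure M A"
  using measure_vimage_preserving[OF inverse_pair_funpow[OF inverse_pair_sym[OF T]], of A m] by (simp add: measure_def fmeasurableD)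

lemma half':
  assumes "A \<in> fmeasurable M" "B \<in> fmeasurable M"
  shows "(\<lambda>i. measure M (((T' ^^ n i) -` A \<inter> space M) \<inter> B)) \<longlonglongrightarrow> measure M (A \<inter> B) / 2"
  using half[OF assms(2,1)] measure_vimage_adjoint[OF inverse_pair_funpow[OF T], of A B] assms
  by (simp add: Int_commute fmeasurableD)

text \<open>The scalar product of \<open>(N\<^sub>A - \<mu>(A)) \<circ> R \<circ> S\<^sup>n\<close> with an exponential vector has two limits. If the
  power of \<open>S\<close> is moved to the exponential vector, the parameter is halved; if it is commuted past
  \<open>R\<close>, the element of the first chaos is halved.\<close>

lemma exp_vector_halving:
  assumes A: "A \<in> fmeasurable M" and B: "B \<in> fmeasurable M" and z: "z \<ge> -1"
  shows "(\<integral>\<omega>. compensated M A (R \<omega>) * exp_vector M (z / 2) B \<omega> \<partial>P) = (\<integral>\<omega>. compensated M A (R \<omega>) * exp_vector M z B \<omega> \<partial>P) / 2"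
proof -
  have [measurable]: "A \<in> sets M" "B \<in> sets M"
    using A B by auto
  have pre: "(T ^^ m) -` A \<inter> space M \<in> fmeasurable M" "(T' ^^ m) -` B \<inter> space M \<in> fmeasurable M" for m
    using fmeasurable_vimage[OF inverse_pair_funpow[OF T] A] fmeasurable_vimage[OF inverse_pair_funpow[OF inverse_pair_sym[OF T]] B]
    by auto
  define J where "J i = (\<integral>\<omega>. compensated M A (R ((S ^^ n i) \<omega>)) * exp_vector M z B \<omega> \<partial>P)" for i
  have Sm: "S ^^ m \<in> measurable P P" "S' ^^ m \<in> measurable P P" for m
    using inverse_pair_funpow[OF S, of m] by (auto simp: inverse_pair_def)
  have "J i = (\<integral>\<omega>. compensated M A (R \<omega>) * exp_vector M z ((T' ^^ n i) -` B \<inter> space M) \<omega> \<partial>P)" for i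
  proof -
    have "J i = (\<integral>\<omega>. compensated M A (R \<omega>) * exp_vector M z B ((S' ^^ n i) \<omega>) \<partial>P)"
      unfolding J_def by (rule integral_adjoint[OF inverse_pair_funpow[OF S], of "\<lambda>\<omega>. compensated M A (R \<omega>)"]) auto
    also have "\<dots> = (\<integral>\<omega>. compensated M A (R \<omega>) * exp_vector M z ((T' ^^ n i) -` B \<inter> space M) \<omega> \<partial>P)"
      using exp_vector_suspension[OF inverse_pair_sym[OF T] fmeasurableD[OF B]]
      by (intro Bochner_Integration.integral_cong) auto
    finally show ?thesis .
  qed
  then have "(\<lambda>i. J i) \<longlonglongrightarrow> (\<integral>\<omega>. compensated M A (R \<omega>) * exp_vector M (z / 2) B \<omega> \<partial>P)"
    using exp_vector_weak_limit[OF divisible B pre(2) vimage_measure'[OF B] half'[OF B] compensated_R_L2[OF A] z] by simp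
  moreover have "J i = (\<integral>\<omega>. exp_vector M z B (R' \<omega>) * compensated M ((T ^^ n i) -` A \<inter> space M) \<omega> \<partial>P)" for i
  proof -
    have "J i = (\<integral>\<omega>. compensated M A ((S ^^ n i) (R \<omega>)) * exp_vector M z B \<omega> \<partial>P)"
      unfolding J_def using AE_commute_funpow[OF S commute, of "n i"] Sm[of "n i"]
      by (intro integral_cong_AE) auto
    also have "\<dots> = (\<integral>\<omega>. compensated M A ((S ^^ n i) \<omega>) * exp_vector M z B (R' \<omega>) \<partial>P)"
      using Sm[of "n i"] by (intro integral_adjoint[OF R, of "\<lambda>\<omega>. compensated M A ((S ^^ n i) \<omega>)"]) auto
    also have "\<dots> = (\<integral>\<omega>. exp_vector M z B (R' \<omega>) * compensated M ((T ^^ n i) -` A \<inter> space M) \<omega> \<partial>P)"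
      using compensated_suspension[OF T fmeasurableD[OF A]]
      by (intro Bochner_Integration.integral_cong) (auto simp: mult.commute)
    finally show ?thesis .
  qed
  then have "(\<lambda>i. J i) \<longlonglongrightarrow> (\<integral>\<omega>. exp_vector M z B (R' \<omega>) * compensated M A \<omega> \<partial>P) / 2"
    using compensated_weak_limit[OF divisible A pre(1) vimage_measure[OF A] half[OF A]
        L2_preserving(1)[OF inverse_pair_sym[OF R] exp_vector_L2[OF B z]]] by simp
  moreover have "(\<integral>\<omega>. exp_vector M z B (R' \<omega>) * compensated M A \<omega> \<partial>P) = (\<integral>\<omega>. compensated M A (R \<omega>) * exp_vector M z B \<omega> \<partial>P)"
    using integral_adjoint[OF R, of "compensated M A" "exp_vector M z B"] by (simp add: mult.commute)
  ultimately show ?thesis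
    using LIMSEQ_unique[of J "\<integral>\<omega>. compensated M A (R \<omega>) * exp_vector M (z / 2) B \<omega> \<partial>P"] by (simp only:)
qed

lemma integral_compensated_R: "A \<in> fmeasurable M \<Longrightarrow> (\<integral>\<omega>. compensated M A (R \<omega>) \<partial>P) = 0"
  using integral_preserving[OF R, of "compensated M A"] integral_compensated[of A] by (simp add: fmeasurableD)

text \<open>A function \<open>g\<close> with \<open>g (z / 2) = g z / 2\<close> that is differentiable at \<open>0\<close> is linear.\<close>

lemma corr_exp_vector:
  assumes A: "A \<in> fmeasurable M" and B: "B \<in> fmeasurable M" and z: "z \<ge> -1"
  shows "(\<integral>\<omega>. compensated M A (R \<omega>) * exp_vector M z B \<omega> \<partial>P) = z * corr R A B"
proof -
  define g where "g z = (\<integral>\<omega>. compensated M A (R \<omega>) * exp_vector M z B \<omega> \<partial>P)" for z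
  have "z / 2 ^ i \<ge> -1 \<and> g (z / 2 ^ i) * 2 ^ i = g z" for i
  proof (induction i)
    case (Suc i)
    then have "g (z / 2 ^ i / 2) = g (z / 2 ^ i) / 2"
      unfolding g_def by (intro exp_vector_halving A B) simp
    moreover have "z / 2 ^ i / 2 \<ge> -1"
    proof -
      have "-1 \<le> x \<Longrightarrow> -1 \<le> x / 2" for x :: real
        by linarith
      then show ?thesis
        using Suc by blast
    qed
    moreover have "z / 2 ^ Suc i = z / 2 ^ i / 2"
      by simp
    ultimately show ?case
      using Suc by (simp only: power_Suc) simp
  qed (use z in simp)
  moreover have "(\<lambda>i. (g (z / 2 ^ i) - 0) * 2 ^ i) \<longlonglongrightarrow> z * corr R A B"
    using exp_vector_derivative_limit[OF B z compensated_R_L2[OF A]] integral_compensated_R[OF A] by (simp add: g_def corr_def)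
  ultimately have "(\<lambda>i::nat. g z) \<longlonglongrightarrow> z * corr R A B"
    by simp
  then show ?thesis
    unfolding g_def by (simp add: LIMSEQ_const_iff)
qed

text \<open>The scalar product of the nonnegative functions \<open>N\<^sub>A \<circ> R\<close> and \<open>E\<^sub>z\<close> is \<open>\<mu>(A) + z * corr R A B\<close> for
  every \<open>z \<ge> 0\<close>, which forbids a negative slope.\<close>

lemma corr_nonneg:
  assumes A: "A \<in> fmeasurable M" and B: "B \<in> fmeasurable M"
  shows "0 \<le> corr R A B"
proof (rule ccontr)
  assume neg: "\<not> 0 \<le> corr R A B"
  have *: "0 \<le> z * corr R A B + measure M A" if z: "z \<ge> 0" for z
  proof -
    note L = L2_mult[OF compensated_R_L2[OF A] exp_vector_L2[OF B, of z]] L2_integrable[OF exp_vector_L2[OF B, of z]]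
    have "0 \<le> (\<integral>\<omega>. real (points_in A (R \<omega>)) * exp_vector M z B \<omega> \<partial>P)"
      using z by (intro integral_nonneg_AE) (auto simp: exp_vector_def)
    also have "\<dots> = (\<integral>\<omega>. compensated M A (R \<omega>) * exp_vector M z B \<omega> + measure M A * exp_vector M z B \<omega> \<partial>P)"
      by (intro Bochner_Integration.integral_cong) (auto simp: compensated_def algebra_simps)
    also have "\<dots> = z * corr R A B + measure M A"
      using L z corr_exp_vector[OF A B, of z] integral_exp_vector[OF B, of z] by simp
    finally show ?thesis .
  qed
  \<comment> \<open>At this parameter the affine function would have the value \<open>-1\<close>.\<close>
  have "0 \<le> (measure M A + 1) / - corr R A B"
    using neg by (intro divide_nonneg_pos) (auto simp: add_nonneg_nonneg)
  from *[OF this] show False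
    using neg by (simp add: field_simps)
qed

lemma corr_void:
  assumes A: "A \<in> fmeasurable M" and B: "B \<in> fmeasurable M"
  shows "(\<integral>\<omega>. compensated M A (R \<omega>) * void M B \<omega> \<partial>P) = - exp (- measure M B) * corr R A B"
proof -
  have [measurable]: "A \<in> sets M" "B \<in> sets M"
    using A B by auto
  have "(\<integral>\<omega>. compensated M A (R \<omega>) * void M B \<omega> \<partial>P) = (\<integral>\<omega>. exp (- measure M B) * (compensated M A (R \<omega>) * exp_vector M (-1) B \<omega>) \<partial>P)"
    using AE_void[OF B] by (intro integral_cong_AE) (auto simp: exp_vector_def mult_exp_exp exp_minus)
  also have "\<dots> = - exp (- measure M B) * corr R A B"
    using corr_exp_vector[OF A B, of "-1"] by simp
  finally show ?thesis .
qed

text \<open>Replacing each void indicator in a linear combination \<open>G\<close> by its component \<open>- exp (- \<mu>(B)) (N\<^sub>B -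
  \<mu>(B))\<close> in the first chaos gives \<open>H\<close> with \<open>H - G\<close> orthogonal to \<open>H\<close> and, by the linearity in \<open>z\<close>,
  to \<open>F = (N\<^sub>A - \<mu>(A)) \<circ> R\<close>. So \<open>H\<close> is at least as close to \<open>F\<close> as \<open>G\<close> is, and void indicators are
  total.\<close>

lemma compensated_R_closure:
  assumes A: "A \<in> fmeasurable M"
  shows "(\<lambda>\<omega>. compensated M A (R \<omega>)) \<in> L2_closure P (compensated M ` fmeasurable M)"
proof (rule L2_closureI[OF compensated_R_L2[OF A]])
  define F where "F = (\<lambda>\<omega>. compensated M A (R \<omega>))"
  define W where "W = compensated M ` fmeasurable M"
  define V where "V = void M ` fmeasurable M"
  have V: "V \<subseteq> L2 P" and W: "W \<subseteq> L2 P" and FL: "F \<in> L2 P"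
    using compensated_R_L2[OF A] by (auto simp: V_def W_def F_def void_L2 compensated_L2)
  have proj: "\<exists>H\<in>lspan W. \<forall>\<Phi>\<in>insert F W. (\<integral>\<omega>. \<Phi> \<omega> * G \<omega> \<partial>P) = (\<integral>\<omega>. \<Phi> \<omega> * H \<omega> \<partial>P)" if "G \<in> lspan V" for G
    using that
  proof (induction rule: lspan.induct)
    case zero
    show ?case
      by (intro bexI[OF _ lspan.zero]) auto
  next
    case (step v G c)
    then obtain H where H: "H \<in> lspan W" "\<And>\<Phi>. \<Phi> \<in> insert F W \<Longrightarrow> (\<integral>\<omega>. \<Phi> \<omega> * G \<omega> \<partial>P) = (\<integral>\<omega>. \<Phi> \<omega> * H \<omega> \<partial>P)"
      by auto
    obtain B where B: "B \<in> fmeasurable M" "v = void M B"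
      using step by (auto simp: V_def)
    define d where "d = - exp (- measure M B)"
    have vL: "v \<in> L2 P" "compensated M B \<in> L2 P" and GL: "G \<in> L2 P" and HL: "H \<in> L2 P"
      using B step lspan_L2[OF V] lspan_L2[OF W H(1)] by (auto simp: void_L2 compensated_L2)
    have "(\<integral>\<omega>. \<Phi> \<omega> * (c * v \<omega> + G \<omega>) \<partial>P) = (\<integral>\<omega>. \<Phi> \<omega> * ((c * d) * compensated M B \<omega> + H \<omega>) \<partial>P)" if \<Phi>: "\<Phi> \<in> insert F W" for \<Phi>
    proof -
      have \<Phi>L: "\<Phi> \<in> L2 P"
        using \<Phi> FL W by auto
      have "(\<integral>\<omega>. \<Phi> \<omega> * v \<omega> \<partial>P) = d * (\<integral>\<omega>. \<Phi> \<omega> * compensated M B \<omega> \<partial>P)"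
        using \<Phi> corr_void[OF A B(1)] integral_compensated_void[OF _ B(1)] integral_compensated_mult[OF _ B(1)]
        by (auto simp: F_def W_def B(2) d_def corr_def)
      moreover have "(\<integral>\<omega>. \<Phi> \<omega> * (x * f \<omega> + g \<omega>) \<partial>P) = x * (\<integral>\<omega>. \<Phi> \<omega> * f \<omega> \<partial>P) + (\<integral>\<omega>. \<Phi> \<omega> * g \<omega> \<partial>P)"
        if "f \<in> L2 P" "g \<in> L2 P" for f g x
      proof -
        have "(\<integral>\<omega>. \<Phi> \<omega> * (x * f \<omega> + g \<omega>) \<partial>P) = (\<integral>\<omega>. x * (\<Phi> \<omega> * f \<omega>) + \<Phi> \<omega> * g \<omega> \<partial>P)"
          by (simp add: algebra_simps)
        also have "\<dots> = x * (\<integral>\<omega>. \<Phi> \<omega> * f \<omega> \<partial>P) + (\<integral>\<omega>. \<Phi> \<omega> * g \<omega> \<partial>P)"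
          using L2_mult[OF \<Phi>L that(1)] L2_mult[OF \<Phi>L that(2)] by simp
        finally show ?thesis .
      qed
      ultimately show ?thesis
        using H(2)[OF \<Phi>] vL GL HL by simp
    qed
    moreover have "(\<lambda>\<omega>. (c * d) * compensated M B \<omega> + H \<omega>) \<in> lspan W"
      using B H(1) by (intro lspan.step) (auto simp: W_def)
    ultimately show ?case
      by (intro bexI[where x="\<lambda>\<omega>. (c * d) * compensated M B \<omega> + H \<omega>"] ballI)
  qed
  fix e :: real
  assume e: "e > 0"
  obtain G where G: "G \<in> lspan V" "norm2 P (\<lambda>\<omega>. F \<omega> - G \<omega>) < e"
    using L2_closureD[OF void_dense[OF divisible FL] e] by (auto simp: V_def)
  obtain H where H: "H \<in> lspan W" "\<And>\<Phi>. \<Phi> \<in> insert F W \<Longrightarrow> (\<integral>\<omega>. \<Phi> \<omega> * G \<omega> \<partial>P) = (\<integral>\<omega>. \<Phi> \<omega> * H \<omega> \<partial>P)"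
    using proj[OF G(1)] by auto
  have GL: "G \<in> L2 P" and HL: "H \<in> L2 P"
    using lspan_L2[OF V G(1)] lspan_L2[OF W H(1)] .
  have orth: "(\<integral>\<omega>. \<Phi> \<omega> * (H \<omega> - G \<omega>) \<partial>P) = 0" if "\<Phi> \<in> insert F W" for \<Phi>
  proof -
    have "\<Phi> \<in> L2 P"
      using that FL W by auto
    then show ?thesis
      using H(2)[OF that] L2_mult[of \<Phi> P H] L2_mult[of \<Phi> P G] HL GL by (simp add: right_diff_distrib)
  qed
  have orthW: "(\<integral>\<omega>. \<Phi> \<omega> * (H \<omega> - G \<omega>) \<partial>P) = 0" if "\<Phi> \<in> lspan W" for \<Phi>
    using that
  proof (induction rule: lspan.induct)
    case (step f g c)
    have "(\<integral>\<omega>. (c * f \<omega> + g \<omega>) * (H \<omega> - G \<omega>) \<partial>P) = (\<integral>\<omega>. c * (f \<omega> * (H \<omega> - G \<omega>)) + g \<omega> * (H \<omega> - G \<omega>) \<partial>P)"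
      by (simp add: algebra_simps)
    also have "\<dots> = c * (\<integral>\<omega>. f \<omega> * (H \<omega> - G \<omega>) \<partial>P) + (\<integral>\<omega>. g \<omega> * (H \<omega> - G \<omega>) \<partial>P)"
      using L2_mult[of f P "\<lambda>\<omega>. H \<omega> - G \<omega>"] L2_mult[of g P "\<lambda>\<omega>. H \<omega> - G \<omega>"] step(1,2) W lspan_L2[OF W] L2_diff[OF HL GL]
      by auto
    finally show ?case
      using step.IH orth[of f] step(1) by simp
  qed simp
  have "(\<integral>\<omega>. (F \<omega> - H \<omega>) * (H \<omega> - G \<omega>) \<partial>P) = 0"
    using L2_mult[OF FL L2_diff[OF HL GL]] L2_mult[OF HL L2_diff[OF HL GL]] orth[of F] orthW[OF H(1)]
    by (simp add: left_diff_distrib)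
  then have "norm2 P (\<lambda>\<omega>. F \<omega> - H \<omega>) \<le> norm2 P (\<lambda>\<omega>. F \<omega> - G \<omega>)"
    using norm2_le_orthogonal[OF L2_diff[OF FL HL] L2_diff[OF HL GL]] by simp
  then show "\<exists>H\<in>lspan (compensated M ` fmeasurable M). norm2 P (\<lambda>\<omega>. compensated M A (R \<omega>) - H \<omega>) < e"
    using G(2) H(1) unfolding F_def W_def by (intro bexI[of _ H]) linarith+
qed

section \<open>Covariances under an automorphism of the centralizer\<close>

lemma corr_integrable: "A \<in> fmeasurable M \<Longrightarrow> B \<in> fmeasurable M \<Longrightarrow> integrable P (\<lambda>\<omega>. compensated M A (R \<omega>) * compensated M B \<omega>)"
  by (intro L2_mult compensated_R_L2 compensated_L2)

lemma corr_Un_right: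
  assumes "A \<in> fmeasurable M" "B \<in> fmeasurable M" "C \<in> fmeasurable M" "B \<inter> C = {}"
  shows "corr R A (B \<union> C) = corr R A B + corr R A C"
proof -
  have [measurable]: "A \<in> sets M" "B \<in> sets M" "C \<in> sets M"
    using assms by auto
  have "corr R A (B \<union> C) = (\<integral>\<omega>. compensated M A (R \<omega>) * compensated M B \<omega> + compensated M A (R \<omega>) * compensated M C \<omega> \<partial>P)"
    unfolding corr_def using AE_compensated_Un[OF assms(2-4)]
    by (intro integral_cong_AE) (auto simp: distrib_left)
  then show ?thesis
    using corr_integrable[OF assms(1,2)] corr_integrable[OF assms(1,3)] by (simp add: corr_def)
qed

lemma corr_mono_right:
  assumes "A \<in> fmeasurable M" "C \<in> fmeasurable M" "B \<in> sets M" "B \<subseteq> C"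
  shows "corr R A B \<le> corr R A C"
proof -
  have f: "B \<in> fmeasurable M" "C - B \<in> fmeasurable M"
    using fmeasurableI2[OF assms(2,4,3)] fmeasurable.Diff[OF assms(2)] by simp_all
  have "corr R A (B \<union> (C - B)) = corr R A B + corr R A (C - B)"
    by (rule corr_Un_right) (use assms f in auto)
  moreover have "B \<union> (C - B) = C"
    using assms by auto
  ultimately show ?thesis
    using corr_nonneg[OF assms(1) f(2)] by simp
qed

text \<open>As a function of \<open>C\<close> the left-hand side is visibly a measure, which prepares the Radon-Nikodym
  theorem.\<close>

lemma product_moment:
  assumes A: "A \<in> fmeasurable M" and C: "C \<in> fmeasurable M"
  shows "(\<integral>\<^sup>+\<omega>. ennreal (real (points_in A (R \<omega>))) * emeasure \<omega> C \<partial>P) = ennreal (corr R A C + measure M A * measure M C)"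
proof -
  have [measurable]: "A \<in> sets M" "C \<in> sets M"
    using assms by auto
  have NA: "(\<lambda>\<omega>. real (points_in A (R \<omega>))) \<in> L2 P"
    by (rule L2_preserving(1)[OF R points_L2[OF A]])
  have i: "integrable P (\<lambda>\<omega>. real (points_in A (R \<omega>)) * real (points_in C \<omega>))"
    by (rule L2_mult[OF NA points_L2[OF C]])
  have "(\<integral>\<^sup>+\<omega>. ennreal (real (points_in A (R \<omega>))) * emeasure \<omega> C \<partial>P) = (\<integral>\<^sup>+\<omega>. ennreal (real (points_in A (R \<omega>)) * real (points_in C \<omega>)) \<partial>P)"
    using AE_points[OF C] by (intro nn_integral_cong_AE) (auto simp: ennreal_mult ennreal_of_nat_eq_real_of_nat)
  also have "\<dots> = ennreal (\<integral>\<omega>. real (points_in A (R \<omega>)) * real (points_in C \<omega>) \<partial>P)"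
    using i by (intro nn_integral_eq_integral) auto
  also have "(\<integral>\<omega>. real (points_in A (R \<omega>)) * real (points_in C \<omega>) \<partial>P) =
      (\<integral>\<omega>. compensated M A (R \<omega>) * compensated M C \<omega> + measure M C * compensated M A (R \<omega>) + measure M A * compensated M C \<omega> + measure M A * measure M C \<partial>P)"
    by (intro Bochner_Integration.integral_cong) (auto simp: compensated_def algebra_simps)
  also have "\<dots> = corr R A C + measure M A * measure M C"
    using corr_integrable[OF A C] L2_integrable[OF compensated_R_L2[OF A]] L2_integrable[OF compensated_L2[OF C]]
      integral_compensated_R[OF A] integral_compensated[OF C] by (simp add: corr_def prob_space)
  finally show ?thesis .
qed

text \<open>The covariance with \<open>N\<^sub>A \<circ> R\<close> has a density with respect to \<open>\<mu>\<close>, by the Radon-Nikodym theorem for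
  the product moment cut down to \<open>B\<close>, whose density is larger by \<open>\<mu>(A)\<close>. If the covariance with \<open>B\<close>
  is positive, the density is bounded away from zero on a part of \<open>B\<close> of positive measure.\<close>

lemma corr_density:
  assumes A: "A \<in> fmeasurable M" and B: "B \<in> fmeasurable M" and pos: "corr R A B > 0"
  shows "\<exists>E e. E \<in> sets M \<and> E \<subseteq> B \<and> measure M E > 0 \<and> e > 0 \<and>
    (\<forall>C\<in>sets M. C \<subseteq> E \<longrightarrow> e * measure M C \<le> corr R A C)"
proof -
  interpret M: sigma_finite_measure M
    using divisible by (simp add: finely_divisible_def)
  have [measurable]: "A \<in> sets M" "B \<in> sets M"
    using A B by auto
  have Bs: "B \<subseteq> space M"
    using sets.sets_into_space[of B M] by auto
  define \<phi> where "\<phi> C = (\<integral>\<^sup>+\<omega>. ennreal (real (points_in A (R \<omega>))) * emeasure \<omega> (C \<inter> B) \<partial>P)" for C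
  define \<nu> where "\<nu> = measure_of (space M) (sets M) \<phi>"
  have CB: "C \<inter> B \<in> fmeasurable M" if "C \<in> sets M" for C
    using fmeasurable_Int_sets[OF B that] by (simp add: Int_commute)
  have \<phi>: "\<phi> C = ennreal (corr R A (C \<inter> B) + measure M A * measure M (C \<inter> B))" if "C \<in> sets M" for C
    unfolding \<phi>_def by (rule product_moment[OF A CB[OF that]])
  have ca: "countably_additive (sets M) \<phi>"
  proof (rule countably_additiveI)
    fix C :: "nat \<Rightarrow> 'a set"
    assume C: "range C \<subseteq> sets M" "disjoint_family C"
    have Cm[measurable]: "C i \<in> sets M" for i
      using C by auto
    have "(\<Sum>i. \<phi> (C i)) = (\<integral>\<^sup>+\<omega>. (\<Sum>i. ennreal (real (points_in A (R \<omega>))) * emeasure \<omega> (C i \<inter> B)) \<partial>P)"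
      unfolding \<phi>_def by (intro nn_integral_suminf[symmetric]) measurable
    also have "\<dots> = \<phi> (\<Union>i. C i)"
      unfolding \<phi>_def
    proof (rule nn_integral_cong)
      fix \<omega>
      assume "\<omega> \<in> space P"
      then have s: "sets \<omega> = sets M"
        by (rule sets_point)
      have "(\<Sum>i. emeasure \<omega> (C i \<inter> B)) = emeasure \<omega> (\<Union>i. C i \<inter> B)"
        using C s Cm by (intro suminf_emeasure) (auto simp: disjoint_family_on_def)
      then show "(\<Sum>i. ennreal (real (points_in A (R \<omega>))) * emeasure \<omega> (C i \<inter> B)) = ennreal (real (points_in A (R \<omega>))) * emeasure \<omega> (\<Union> (range C) \<inter> B)"
        by simp
    qed
    finally show "(\<Sum>i. \<phi> (C i)) = \<phi> (\<Union>i. C i)" .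
  qed
  have \<nu>: "emeasure \<nu> C = \<phi> C" if "C \<in> sets M" for C
    unfolding \<nu>_def
    by (rule emeasure_measure_of_sigma[OF sets.sigma_algebra_axioms _ ca that]) (simp add: positive_def \<phi>_def)
  have s\<nu>: "sets \<nu> = sets M"
    unfolding \<nu>_def by (simp add: sets.space_closed sets.sigma_sets_eq)
  have "absolutely_continuous M \<nu>"
    unfolding absolutely_continuous_def
  proof
    fix N
    assume N: "N \<in> null_sets M"
    then have Nm: "N \<in> sets M"
      by auto
    have "emeasure M (N \<inter> B) = 0"
      using N emeasure_mono[of "N \<inter> B" N M] by (auto simp: null_sets_def)
    then have m0: "measure M (N \<inter> B) = 0"
      by (simp add: measure_def)
    have "corr R A (N \<inter> B) \<le> norm2 P (\<lambda>\<omega>. compensated M A (R \<omega>)) * norm2 P (compensated M (N \<inter> B))"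
      unfolding corr_def using Cauchy_Schwarz_L2[OF compensated_R_L2[OF A] compensated_L2[OF CB[OF Nm]]] by linarith
    then have "corr R A (N \<inter> B) \<le> 0"
      using norm2_compensated[OF CB[OF Nm]] m0 by simp
    then have "emeasure \<nu> N = 0"
      using \<nu>[OF Nm] \<phi>[OF Nm] m0 by (simp add: ennreal_neg)
    then show "N \<in> null_sets \<nu>"
      using Nm s\<nu> by (simp add: null_sets_def)
  qed
  then obtain f where f[measurable]: "f \<in> borel_measurable M" and d: "density M f = \<nu>"
    using M.Radon_Nikodym[of \<nu>] s\<nu> by auto
  have \<nu>f: "ennreal (corr R A (C \<inter> B) + measure M A * measure M (C \<inter> B)) = (\<integral>\<^sup>+x. f x * indicator C x \<partial>M)" if "C \<in> sets M" for C
    using emeasure_density[OF f that] \<nu>[OF that] \<phi>[OF that] d by simp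
  define e where "e i = 1 / real (Suc i)" for i
  define E where "E i = {x \<in> B. ennreal (measure M A + e i) \<le> f x}" for i
  have Em: "E i \<in> sets M" for i
  proof -
    have "{x \<in> space M. x \<in> B \<and> ennreal (measure M A + e i) \<le> f x} \<in> sets M"
      by measurable
    moreover have "E i = {x \<in> space M. x \<in> B \<and> ennreal (measure M A + e i) \<le> f x}"
      using Bs by (auto simp: E_def)
    ultimately show ?thesis
      by simp
  qed
  have Ef: "E i \<in> fmeasurable M" for i
    using B Em by (intro fmeasurableI2[OF B]) (auto simp: E_def)
  have e: "e i > 0" for i
    by (simp add: e_def)
  have "\<exists>i. measure M (E i) > 0"
  proof (rule ccontr)
    assume "\<not> (\<exists>i. measure M (E i) > 0)"
    then have "measure M (E i) = 0" for i
      using measure_nonneg[of M "E i"] by (metis less_eq_real_def)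
    then have "E i \<in> null_sets M" for i
      using Ef[of i] emeasure_eq_measure2[OF Ef[of i]] by (simp add: null_sets_def fmeasurableD)
    then have "(\<Union>i. E i) \<in> null_sets M"
      by auto
    then have "AE x in M. x \<notin> (\<Union>i. E i)"
      by (rule AE_not_in)
    then have "AE x in M. f x * indicator B x \<le> ennreal (measure M A) * indicator B x"
    proof eventually_elim
      case (elim x)
      show ?case
      proof (cases "x \<in> B")
        case True
        then have lt: "f x < ennreal (measure M A + e i)" for i
          using elim by (auto simp: E_def not_le)
        have "f x \<le> ennreal (measure M A)"
        proof (rule ennreal_le_epsilon)
          fix d :: real
          assume "d > 0"
          then obtain i where "e i < d"
            unfolding e_def using reals_Archimedean[of d] by (auto simp: inverse_eq_divide)
          then have "f x \<le> ennreal (measure M A + d)"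
            using lt[of i] by (intro order.trans[OF less_imp_le[OF lt[of i]] ennreal_leI]) auto
          then show "f x \<le> ennreal (measure M A) + ennreal d"
            using \<open>d > 0\<close> by (simp add: ennreal_plus)
        qed
        then show ?thesis
          using True by simp
      qed simp
    qed
    then have "(\<integral>\<^sup>+x. f x * indicator B x \<partial>M) \<le> (\<integral>\<^sup>+x. ennreal (measure M A) * indicator B x \<partial>M)"
      by (rule nn_integral_mono_AE)
    also have "\<dots> = ennreal (measure M A * measure M B)"
      using emeasure_eq_measure2[OF B] by (simp add: nn_integral_cmult_indicator ennreal_mult)
    finally have "ennreal (corr R A B + measure M A * measure M B) \<le> ennreal (measure M A * measure M B)"
      using \<nu>f[of B] by simp
    then show False
      using pos by (simp add: ennreal_le_iff)
  qed
  then obtain i where i: "measure M (E i) > 0"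
    by auto
  have "e i * measure M C \<le> corr R A C" if C: "C \<in> sets M" "C \<subseteq> E i" for C
  proof -
    have CB': "C \<inter> B = C"
      using C(2) by (auto simp: E_def)
    then have Cf: "C \<in> fmeasurable M"
      using CB[OF C(1)] by simp
    have "ennreal ((measure M A + e i) * measure M C) = (\<integral>\<^sup>+x. ennreal (measure M A + e i) * indicator C x \<partial>M)"
      using emeasure_eq_measure2[OF Cf] C(1) e[of i] by (simp add: nn_integral_cmult_indicator ennreal_mult)
    also have "\<dots> \<le> (\<integral>\<^sup>+x. f x * indicator C x \<partial>M)"
      using C(2) by (intro nn_integral_mono) (auto simp: E_def indicator_def)
    also have "\<dots> = ennreal (corr R A C + measure M A * measure M C)"
      using \<nu>f[OF C(1)] CB' by simp
    finally have "(measure M A + e i) * measure M C \<le> corr R A C + measure M A * measure M C"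
      using corr_nonneg[OF A Cf] by (subst (asm) ennreal_le_iff) auto
    then show ?thesis
      by (simp add: algebra_simps)
  qed
  then show ?thesis
    using i e[of i] Em[of i] by (intro exI[of _ "E i"] exI[of _ "e i"]) (auto simp: E_def)
qed

text \<open>\<open>R\<close> commutes with the powers of \<open>S\<close>, which preserve the measure.\<close>

lemma corr_vimage:
  assumes A: "A \<in> fmeasurable M" and B: "B \<in> fmeasurable M"
  shows "corr R ((T ^^ m) -` A \<inter> space M) ((T ^^ m) -` B \<inter> space M) = corr R A B"
proof -
  have [measurable]: "A \<in> sets M" "B \<in> sets M" "S ^^ m \<in> measurable P P"
    using A B inverse_pair_funpow[OF S, of m] by (auto simp: inverse_pair_def)
  have pre: "(T ^^ m) -` A \<inter> space M \<in> sets M" "(T ^^ m) -` B \<inter> space M \<in> sets M"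
    using fmeasurable_vimage[OF inverse_pair_funpow[OF T], of A m] fmeasurable_vimage[OF inverse_pair_funpow[OF T], of B m] A B
    by auto
  have R_space: "R \<omega> \<in> space P" if "\<omega> \<in> space P" for \<omega>
    using measurable_space[OF R_measurable(1) that] .
  have "corr R ((T ^^ m) -` A \<inter> space M) ((T ^^ m) -` B \<inter> space M) =
      (\<integral>\<omega>. compensated M A ((S ^^ m) (R \<omega>)) * compensated M B ((S ^^ m) \<omega>) \<partial>P)"
    unfolding corr_def using compensated_suspension[OF T fmeasurableD[OF A]] compensated_suspension[OF T fmeasurableD[OF B]]
    by (intro Bochner_Integration.integral_cong) (auto simp: R_space)
  also have "\<dots> = (\<integral>\<omega>. compensated M A (R ((S ^^ m) \<omega>)) * compensated M B ((S ^^ m) \<omega>) \<partial>P)"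
    using AE_commute_funpow[OF S commute, of m] by (intro integral_cong_AE) auto
  also have "\<dots> = corr R A B"
    unfolding corr_def
    by (rule integral_preserving[OF inverse_pair_funpow[OF S], of "\<lambda>\<omega>. compensated M A (R \<omega>) * compensated M B \<omega>"]) auto
  finally show ?thesis .
qed

lemma corr_cong_right:
  assumes "A \<in> sets M" "B \<in> fmeasurable M" "C \<in> fmeasurable M" "measure M (sym_diff B C) = 0"
  shows "corr R A B = corr R A C"
proof -
  have [measurable]: "A \<in> sets M" "B \<in> sets M" "C \<in> sets M"
    using assms by auto
  have f: "B - C \<in> fmeasurable M" "C - B \<in> fmeasurable M" "B \<inter> C \<in> fmeasurable M"
    using assms by (auto intro: fmeasurable.Diff fmeasurable_Int_sets)
  have s: "sym_diff B C \<in> fmeasurable M"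
    using f by (auto intro: fmeasurable.Un)
  have "measure M (B - C) \<le> measure M (sym_diff B C)" "measure M (C - B) \<le> measure M (sym_diff B C)"
    using f s by (auto intro!: measure_mono_fmeasurable)
  then have z: "measure M (B - C) = 0" "measure M (C - B) = 0"
    using assms(4) by (auto simp: measure_le_0_iff)
  have null: "AE \<omega> in P. compensated M D \<omega> = 0" if D: "D \<in> fmeasurable M" "measure M D = 0" for D
  proof -
    have "(\<integral>\<omega>. (compensated M D \<omega>)\<^sup>2 \<partial>P) = 0"
      using integral_compensated_square[OF D(1)] D(2) by (simp add: power2_eq_square)
    then show ?thesis
      using integral_nonneg_eq_0_iff_AE[OF L2_square[OF compensated_L2[OF D(1)]]] by simp
  qed
  have u: "(B - C) \<union> (B \<inter> C) = B" "(C - B) \<union> (B \<inter> C) = C"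
    by auto
  have "AE \<omega> in P. compensated M B \<omega> = compensated M (B - C) \<omega> + compensated M (B \<inter> C) \<omega>"
    using AE_compensated_Un[OF f(1,3)] unfolding u by auto
  moreover have "AE \<omega> in P. compensated M C \<omega> = compensated M (C - B) \<omega> + compensated M (B \<inter> C) \<omega>"
    using AE_compensated_Un[OF f(2,3)] unfolding u by auto
  ultimately have "AE \<omega> in P. compensated M B \<omega> = compensated M C \<omega>"
    using null[OF f(1) z(1)] null[OF f(2) z(2)] by eventually_elim simp
  then show ?thesis
    unfolding corr_def by (intro integral_cong_AE) auto
qed

end

section \<open>Geometry of the towers\<close>

lemma column_base_1 [simp]: "column_base h s j (Suc 0) = 0"
  by (simp add: column_base_def)

lemma column_base_Suc: "i \<ge> 1 \<Longrightarrow> column_base h s j (Suc i) = column_base h s j i + (h j + s j i)"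
  by (simp add: column_base_def)

lemma column_base_gap: "1 \<le> i \<Longrightarrow> i < i' \<Longrightarrow> column_base h s j i + (h j + s j i) \<le> column_base h s j i'"
proof (induction i' rule: nat_induct)
  case (Suc i')
  then show ?case
    by (cases "i = i'") (auto simp: column_base_Suc)
qed simp

lemma column_position_unique:
  assumes "1 \<le> i" "1 \<le> i'" "k < h j + s j i" "k' < h j + s j i'"
    and "column_base h s j i + k = column_base h s j i' + k'"
  shows "i = i' \<and> k = k'"
  using assms column_base_gap[of i i' h s j] column_base_gap[of i' i h s j]
  by (cases i i' rule: linorder_cases) auto

lemma measure_le_sym_diff:
  assumes "A \<in> fmeasurable M" "B \<in> fmeasurable M"
  shows "measure M A \<le> measure M B + measure M (sym_diff A B)"
proof -
  have f: "sym_diff A B \<in> fmeasurable M"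
    using assms by (auto intro: fmeasurable.Diff fmeasurable.Un)
  have "measure M A \<le> measure M (B \<union> sym_diff A B)"
    using assms f by (intro measure_mono_fmeasurable fmeasurable.Un) auto
  also have "\<dots> \<le> measure M B + measure M (sym_diff A B)"
    using assms f by (intro measure_Un_le) auto
  finally show ?thesis .
qed

lemma measure_Int_sym_diff:
  assumes "A \<in> fmeasurable M" "B \<in> fmeasurable M" "U \<in> fmeasurable M" "V \<in> fmeasurable M"
  shows "\<bar>measure M (A \<inter> B) - measure M (U \<inter> V)\<bar> \<le> measure M (sym_diff A U) + measure M (sym_diff B V)"
proof -
  have f: "A \<inter> B \<in> fmeasurable M" "U \<inter> V \<in> fmeasurable M" "sym_diff A U \<in> fmeasurable M" "sym_diff B V \<in> fmeasurable M"
    using assms by (auto intro: fmeasurable.Diff fmeasurable.Un fmeasurable_Int_sets)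
  have "measure M (sym_diff (A \<inter> B) (U \<inter> V)) \<le> measure M (sym_diff A U \<union> sym_diff B V)"
    using assms f by (intro measure_mono_fmeasurable fmeasurable.Un) auto
  also have "\<dots> \<le> measure M (sym_diff A U) + measure M (sym_diff B V)"
    using f by (intro measure_Un_le) auto
  finally show ?thesis
    using measure_le_sym_diff[OF f(1,2)] measure_le_sym_diff[OF f(2,1)] by (simp add: Un_commute)
qed

context rank_one
begin

abbreviation "Fl \<equiv> tower_floor w a"
abbreviation "X \<equiv> tower h w a"
abbreviation "base \<equiv> column_base h s"
abbreviation "M \<equiv> rank_one_space h w a"

lemma mem_floor: "x \<in> Fl j k \<longleftrightarrow> a j k \<le> x \<and> x < a j k + w j"
  by (auto simp: tower_floor_def)

lemma base_top: "j \<ge> 1 \<Longrightarrow> base j (Suc (r j)) = h (Suc j)"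
  using height_step[of j] by (simp add: column_base_def sum.distrib sum.atLeast_Suc_atMost_Suc_shift atLeastLessThanSuc_atLeastAtMost)

lemma position_bound: "j \<ge> 1 \<Longrightarrow> i \<in> {1..r j} \<Longrightarrow> k < h j + s j i \<Longrightarrow> base j i + k < h (Suc j)"
  using column_base_gap[of i "Suc (r j)" h s j] base_top[of j] by auto

lemma height_pos: "j \<ge> 1 \<Longrightarrow> h j \<ge> 1"
proof (induction j rule: nat_induct_at_least)
  case base
  then show ?case
    using initial_height by simp
next
  case (Suc j)
  then show ?case
    using height_step[of j] cuts_pos[of j] by (simp add: Suc_le_eq)
qed

lemma floor_unique: "j \<ge> 1 \<Longrightarrow> k < h j \<Longrightarrow> k' < h j \<Longrightarrow> x \<in> Fl j k \<Longrightarrow> x \<in> Fl j k' \<Longrightarrow> k = k'"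
  using floors_disjoint[of j] by (auto simp: disjoint_family_on_def)

text \<open>The pieces of \<open>C\<^sub>j\<close> and the floors of their columns are moved by the same translation.\<close>

lemma floor_refine:
  assumes j: "j \<ge> 1" and k: "k < h j"
  shows "Fl j k = (\<Union>i\<in>{1..r j}. Fl (Suc j) (base j i + k))"
proof -
  have "x \<in> Fl j k \<longleftrightarrow> x \<in> (\<Union>i\<in>{1..r j}. Fl (Suc j) (base j i + k))" for x
  proof -
    have "x \<in> Fl j k \<longleftrightarrow> x - (a j k - a j 0) \<in> Fl j 0"
      by (auto simp: mem_floor)
    also have "\<dots> \<longleftrightarrow> (\<exists>i\<in>{1..r j}. x - (a j k - a j 0) \<in> Fl (Suc j) (base j i))"
      using base_cut[OF j] by simp
    also have "\<dots> \<longleftrightarrow> (\<exists>i\<in>{1..r j}. x \<in> Fl (Suc j) (base j i + k))"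
      using column_floors[OF j _ k] by (intro bex_cong) (auto simp: mem_floor)
    finally show ?thesis
      by simp
  qed
  then show ?thesis
    by blast
qed

lemma subfloor: "j \<ge> 1 \<Longrightarrow> k < h j \<Longrightarrow> i \<in> {1..r j} \<Longrightarrow> Fl (Suc j) (base j i + k) \<subseteq> Fl j k"
  using floor_refine[of j k] by blast

lemma subfloors_disjoint:
  assumes j: "j \<ge> 1" and K: "K \<subseteq> {..<h j}"
  shows "disjoint_family_on (\<lambda>(i, k). Fl (Suc j) (base j i + k)) ({1..r j} \<times> K)"
proof (clarsimp simp: disjoint_family_on_def)
  fix i k i' k'
  assume *: "Suc 0 \<le> i" "i \<le> r j" "k \<in> K" "Suc 0 \<le> i'" "i' \<le> r j" "k' \<in> K" "i = i' \<longrightarrow> k \<noteq> k'"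
  then have b: "k < h j" "k' < h j"
    using K by auto
  then have "base j i + k \<noteq> base j i' + k'"
    using column_position_unique[of i i' k h j s k'] * by auto
  moreover have "base j i + k < h (Suc j)" "base j i' + k' < h (Suc j)"
    using position_bound[OF j, of i k] position_bound[OF j, of i' k'] * b by auto
  ultimately show "Fl (Suc j) (base j i + k) \<inter> Fl (Suc j) (base j i' + k') = {}"
    using floors_disjoint[of "Suc j"] by (auto simp: disjoint_family_on_def)
qed

lemma floor_sets [measurable, simp]: "Fl j k \<in> sets borel"
  by (simp add: tower_floor_def)

lemma tower_sets [measurable, simp]: "X j \<in> sets borel"
  unfolding tower_def by measurable

lemma space_sets: "(\<Union>j\<in>{1..}. X j) \<in> sets borel"
  by measurable

lemma space_M: "space M = (\<Union>j\<in>{1..}. X j)"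
  by (simp add: rank_one_space_def space_restrict_space)

lemma sets_M: "A \<in> sets M \<longleftrightarrow> A \<in> sets borel \<and> A \<subseteq> space M"
  unfolding space_M rank_one_space_def using space_sets by (subst sets_restrict_space_iff) auto

lemma emeasure_M: "A \<in> sets M \<Longrightarrow> emeasure M A = emeasure lborel A"
  using space_sets by (auto simp: rank_one_space_def sets_restrict_space_iff emeasure_restrict_space space_restrict_space)

lemma floor_subset_tower: "k < h j \<Longrightarrow> Fl j k \<subseteq> X j"
  by (auto simp: tower_def)

lemma tower_subset_space: "j \<ge> 1 \<Longrightarrow> X j \<subseteq> space M"
  by (auto simp: space_M)

lemma floor_in_sets: "j \<ge> 1 \<Longrightarrow> k < h j \<Longrightarrow> Fl j k \<in> sets M"
  using floor_subset_tower[of k j] tower_subset_space[of j] by (auto simp: sets_M)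

lemma emeasure_floor: "j \<ge> 1 \<Longrightarrow> k < h j \<Longrightarrow> emeasure M (Fl j k) = ennreal (w j)"
  using floor_in_sets[of j k] length_pos[of j] by (simp add: emeasure_M) (simp add: tower_floor_def)

lemma measure_floor: "j \<ge> 1 \<Longrightarrow> k < h j \<Longrightarrow> measure M (Fl j k) = w j"
  using emeasure_floor[of j k] length_pos[of j] by (simp add: measure_def)

lemma floor_fmeasurable: "j \<ge> 1 \<Longrightarrow> k < h j \<Longrightarrow> Fl j k \<in> fmeasurable M"
  using floor_in_sets[of j k] emeasure_floor[of j k] by (simp add: fmeasurable_def)

definition floors :: "nat \<Rightarrow> nat set \<Rightarrow> real set" where
  "floors j K = (\<Union>k\<in>K. Fl j k)"

lemma floors_fmeasurable: "j \<ge> 1 \<Longrightarrow> K \<subseteq> {..<h j} \<Longrightarrow> floors j K \<in> fmeasurable M"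
  unfolding floors_def using finite_subset[of K "{..<h j}"]
  by (intro fmeasurable.finite_UN) (auto intro!: floor_fmeasurable)

lemma measure_floors: "j \<ge> 1 \<Longrightarrow> K \<subseteq> {..<h j} \<Longrightarrow> measure M (floors j K) = real (card K) * w j"
proof -
  assume *: "j \<ge> 1" "K \<subseteq> {..<h j}"
  have "disjoint_family_on (Fl j) K"
    by (rule disjoint_family_on_mono[OF *(2) floors_disjoint[OF *(1)]])
  then have pw: "pairwise (\<lambda>x y. disjnt (Fl j x) (Fl j y)) K"
    by (simp add: pairwise_def disjnt_def disjoint_family_on_def)
  have fm: "Fl j k \<in> fmeasurable M" if "k \<in> K" for k
    using that * by (intro floor_fmeasurable) auto
  have "measure M (floors j K) = (\<Sum>k\<in>K. measure M (Fl j k))"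
    unfolding floors_def using finite_subset[OF *(2)] fm pw by (intro measure_UNION') auto
  also have "\<dots> = (\<Sum>k\<in>K. w j)"
    using * by (intro sum.cong measure_floor) auto
  finally show ?thesis
    by simp
qed

lemma floors_Int:
  assumes "j \<ge> 1" "K \<subseteq> {..<h j}" "K' \<subseteq> {..<h j}"
  shows "floors j K \<inter> floors j K' = floors j (K \<inter> K')"
proof -
  have "x \<in> floors j (K \<inter> K')" if x: "x \<in> floors j K" "x \<in> floors j K'" for x
  proof -
    obtain k k' where k: "k \<in> K" "x \<in> Fl j k" "k' \<in> K'" "x \<in> Fl j k'"
      using x by (auto simp: floors_def)
    then have "k = k'"
      using assms by (intro floor_unique[of j k k' x]) auto
    then show ?thesis
      using k by (auto simp: floors_def)
  qed
  then show ?thesis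
    by (auto simp: floors_def)
qed

lemma tower_eq_floors: "X j = floors j {..<h j}"
  by (simp add: tower_def floors_def)

lemma tower_fmeasurable: "j \<ge> 1 \<Longrightarrow> X j \<in> fmeasurable M"
  by (simp add: tower_eq_floors floors_fmeasurable)

lemma measure_subfloors:
  assumes j: "j \<ge> 1" and I: "I \<subseteq> {1..r j}" and K: "K \<subseteq> {..<h j}"
  shows "measure M (\<Union>i\<in>I. \<Union>k\<in>K. Fl (Suc j) (base j i + k)) = real (card I) * real (card K) * w (Suc j)"
proof -
  have fin: "finite (I \<times> K)"
    using finite_subset[OF I] finite_subset[OF K] by auto
  have lt: "base j i + k < h (Suc j)" if "i \<in> I" "k \<in> K" for i k
    using that I K by (intro position_bound j) auto
  define D where "D = (\<lambda>(i, k). Fl (Suc j) (base j i + k))"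
  have "disjoint_family_on D (I \<times> K)"
    unfolding D_def by (rule disjoint_family_on_mono[OF _ subfloors_disjoint[OF j K]]) (use I in auto)
  then have pw: "pairwise (\<lambda>x y. disjnt (D x) (D y)) (I \<times> K)"
    by (simp add: pairwise_def disjnt_def disjoint_family_on_def)
  have fm: "D x \<in> fmeasurable M" if "x \<in> I \<times> K" for x
    using that lt by (auto simp: D_def intro!: floor_fmeasurable)
  have "(\<Union>i\<in>I. \<Union>k\<in>K. Fl (Suc j) (base j i + k)) = (\<Union>x\<in>I \<times> K. D x)"
    by (auto simp: D_def)
  then have "measure M (\<Union>i\<in>I. \<Union>k\<in>K. Fl (Suc j) (base j i + k)) = measure M (\<Union>x\<in>I \<times> K. D x)"
    by (rule arg_cong)
  also have "\<dots> = (\<Sum>x\<in>I \<times> K. measure M (D x))"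
    using fin fm pw by (rule measure_UNION')
  also have "\<dots> = (\<Sum>(i, k)\<in>I \<times> K. measure M (Fl (Suc j) (base j i + k)))"
    by (simp add: D_def case_prod_unfold)
  also have "\<dots> = (\<Sum>(i, k)\<in>I \<times> K. w (Suc j))"
    using lt by (intro sum.cong) (auto intro!: measure_floor)
  finally show ?thesis
    by (simp add: card_cartesian_product case_prod_unfold)
qed

lemma length_step: "j \<ge> 1 \<Longrightarrow> w j = real (r j) * w (Suc j)"
  using measure_subfloors[of j "{1..r j}" "{0}"] height_pos[of j] measure_floor[of j 0] floor_refine[of j 0]
  by (auto simp: Suc_le_eq)

lemma length_decreasing: "1 \<le> i \<Longrightarrow> i \<le> j \<Longrightarrow> w j \<le> w i"
proof (induction j rule: nat_induct)
  case (Suc j)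
  show ?case
  proof (cases "i = Suc j")
    case False
    then have "w j \<le> w i" "1 \<le> j"
      using Suc by auto
    moreover have "1 * w (Suc j) \<le> real (r j) * w (Suc j)"
      using cuts_pos[of j] length_pos[of "Suc j"] \<open>1 \<le> j\<close> by (intro mult_right_mono) auto
    ultimately show ?thesis
      using length_step[of j] by simp
  qed simp
qed simp

lemma length_tendsto_0: "w \<longlonglongrightarrow> 0"
proof -
  have "(\<lambda>j. w (Suc j)) \<longlonglongrightarrow> 0"
  proof (rule real_tendsto_sandwich[of "\<lambda>_. 0" _ _ "\<lambda>j. w 1 / real (r j)"])
    show "\<forall>\<^sub>F j in sequentially. 0 \<le> w (Suc j)"
      using length_pos by (intro always_eventually allI) (simp add: less_imp_le)
    show "\<forall>\<^sub>F j in sequentially. w (Suc j) \<le> w 1 / real (r j)"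
      using eventually_ge_at_top[of 1]
    proof eventually_elim
      case (elim j)
      then show ?case
        using length_decreasing[of 1 j] length_step[of j] cuts_pos[of j] by (simp add: field_simps)
    qed
    show "(\<lambda>j. w 1 / real (r j)) \<longlonglongrightarrow> 0"
      using filterlim_compose[OF filterlim_real_sequentially cuts_unbounded]
      by (intro real_tendsto_divide_at_top[OF tendsto_const])
  qed auto
  then show ?thesis
    by (rule LIMSEQ_imp_Suc)
qed

lemma refine_Suc:
  assumes j: "j \<ge> 1" and K: "K \<subseteq> {..<h j}"
  shows "\<exists>K'\<subseteq>{..<h (Suc j)}. floors j K = floors (Suc j) K'"
proof (intro exI conjI)
  let ?K = "(\<lambda>(i, k). base j i + k) ` ({1..r j} \<times> K)"
  show "?K \<subseteq> {..<h (Suc j)}"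
    using K position_bound[OF j] by fastforce
  have "floors j K = (\<Union>k\<in>K. \<Union>i\<in>{1..r j}. Fl (Suc j) (base j i + k))"
    unfolding floors_def using K floor_refine[OF j] by (intro SUP_cong refl) auto
  then show "floors j K = floors (Suc j) ?K"
    unfolding floors_def by auto
qed

text \<open>Every later tower subdivides the earlier floors.\<close>

lemma refine:
  assumes j: "j \<ge> 1" and K: "K \<subseteq> {..<h j}" and i: "j \<le> i"
  shows "\<exists>K'\<subseteq>{..<h i}. floors j K = floors i K'"
  using i
proof (induction i rule: dec_induct)
  case (step n)
  then obtain K' where "K' \<subseteq> {..<h n}" "floors j K = floors n K'"
    by auto
  then show ?case
    using refine_Suc[of n K'] j step by auto
qed (use K in auto)

lemma tower_mono:
  assumes "1 \<le> j" "j \<le> i"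
  shows "X j \<subseteq> X i"
proof -
  obtain K where "K \<subseteq> {..<h i}" "X j = floors i K"
    using refine[of j "{..<h j}" i] assms by (auto simp: tower_eq_floors)
  then show ?thesis
    unfolding tower_eq_floors floors_def by blast
qed

lemma position_exists: "x \<in> space M \<Longrightarrow> \<exists>j0\<ge>1. \<forall>j\<ge>j0. \<exists>k<h j. x \<in> Fl j k"
proof -
  assume "x \<in> space M"
  then obtain j0 where "j0 \<ge> 1" "x \<in> X j0"
    by (auto simp: space_M)
  then have "\<forall>j\<ge>j0. x \<in> X j"
    using tower_mono by blast
  then show ?thesis
    using \<open>j0 \<ge> 1\<close> unfolding tower_def by (intro exI[of _ j0]) blast
qed

text \<open>A point that has \<open>m\<close> floors above it at some stage keeps them at all later stages, because the
  floors above it stay in its column.\<close>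

lemma not_top_later:
  assumes j: "j \<ge> 1" and x: "x \<in> Fl j k" "k + m < h j" and i: "j \<le> i"
  shows "\<exists>p. p + m < h i \<and> x \<in> Fl i p"
  using i
proof (induction i rule: dec_induct)
  case (step n)
  then obtain p where p: "p + m < h n" "x \<in> Fl n p"
    by auto
  then obtain c where c: "c \<in> {1..r n}" "x \<in> Fl (Suc n) (base n c + p)"
    using floor_refine[of n p] j step by auto
  then have "base n c + (p + m) < h (Suc n)"
    using p j step position_bound[of n c "p + m"] by auto
  then show ?case
    using c by (intro exI[of _ "base n c + p"]) auto
qed (use x in auto)

lemma not_bottom_later:
  assumes j: "j \<ge> 1" and x: "x \<in> Fl j (Suc k)" "Suc k < h j" and i: "j \<le> i"
  shows "\<exists>p. Suc p < h i \<and> x \<in> Fl i (Suc p)"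
  using i
proof (induction i rule: dec_induct)
  case (step n)
  then obtain p where p: "Suc p < h n" "x \<in> Fl n (Suc p)"
    by auto
  then obtain c where c: "c \<in> {1..r n}" "x \<in> Fl (Suc n) (base n c + Suc p)"
    using floor_refine[of n "Suc p"] j step by auto
  then have "base n c + Suc p < h (Suc n)"
    using p j step position_bound[of n c "Suc p"] by auto
  then show ?case
    using c by (intro exI[of _ "base n c + p"]) auto
qed (use x in auto)

lemma iterate_translation:
  assumes j: "j \<ge> 1" and x: "x \<in> Fl j k" "k + m < h j"
  shows "(T ^^ m) x = x + (a j (k + m) - a j k)" "(T ^^ m) x \<in> Fl j (k + m)"
proof -
  have "(T ^^ m) x = x + (a j (k + m) - a j k) \<and> (T ^^ m) x \<in> Fl j (k + m)"
    using x(2)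
  proof (induction m)
    case (Suc m)
    then show ?case
      using translation[OF j, of "k + m" "(T ^^ m) x"] by (auto simp: mem_floor)
  qed (use x in auto)
  then show "(T ^^ m) x = x + (a j (k + m) - a j k)" "(T ^^ m) x \<in> Fl j (k + m)"
    by auto
qed

section \<open>The transformation is an automorphism\<close>

lemma same_floors_eq:
  assumes "\<And>j. j \<ge> j0 \<Longrightarrow> \<exists>k. x \<in> Fl j k \<and> y \<in> Fl j k"
  shows "x = y"
proof (rule ccontr)
  assume "x \<noteq> y"
  then have "\<forall>\<^sub>F j in sequentially. w j < \<bar>x - y\<bar>"
    by (intro order_tendstoD(2)[OF length_tendsto_0]) auto
  with eventually_ge_at_top[of j0] have "\<forall>\<^sub>F j in sequentially. False"
  proof eventually_elim
    case (elim j)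
    obtain k where "x \<in> Fl j k" "y \<in> Fl j k"
      using assms elim by blast
    then show ?case
      using elim by (auto simp: mem_floor)
  qed
  then show False
    by simp
qed

text \<open>\<open>T\<close> is prescribed off \<open>always_top\<close>, and its prescribed part has as its image the complement of
  \<open>always_bottom\<close>. Both sets have at most one point, since the lengths of the floors tend to zero.\<close>

definition always_top :: "real set" where
  "always_top = {x \<in> space M. \<forall>j\<ge>1. \<forall>k. Suc k < h j \<longrightarrow> x \<notin> Fl j k}"

definition always_bottom :: "real set" where
  "always_bottom = {x \<in> space M. \<forall>j\<ge>1. \<forall>k. Suc k < h j \<longrightarrow> x \<notin> Fl j (Suc k)}"

lemma always_top_unique:
  assumes "x \<in> always_top" "y \<in> always_top"
  shows "x = y"
proof -
  have *: "\<exists>j0\<ge>1. \<forall>j\<ge>j0. x \<in> Fl j (h j - 1)" if "x \<in> always_top" for x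
  proof -
    have "\<exists>j0\<ge>1. \<forall>j\<ge>j0. \<exists>k<h j. x \<in> Fl j k"
      using that by (intro position_exists) (simp add: always_top_def)
    then obtain j0 where j0: "j0 \<ge> 1" "\<And>j. j \<ge> j0 \<Longrightarrow> \<exists>k<h j. x \<in> Fl j k"
      by blast
    have "x \<in> Fl j (h j - 1)" if j: "j \<ge> j0" for j
    proof -
      obtain k where k: "k < h j" "x \<in> Fl j k"
        using j0(2)[OF j] by auto
      then have "\<not> Suc k < h j"
        using \<open>x \<in> always_top\<close> j j0(1) by (auto simp: always_top_def)
      then have "k = h j - 1"
        using k by auto
      then show ?thesis
        using k by simp
    qed
    then show ?thesis
      using j0(1) by auto
  qed
  obtain j0 j1 where "\<And>j. j \<ge> j0 \<Longrightarrow> x \<in> Fl j (h j - 1)" "\<And>j. j \<ge> j1 \<Longrightarrow> y \<in> Fl j (h j - 1)"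
    using *[OF assms(1)] *[OF assms(2)] by blast
  then show ?thesis
    by (intro same_floors_eq[of "max j0 j1"]) auto
qed

lemma always_bottom_unique:
  assumes "x \<in> always_bottom" "y \<in> always_bottom"
  shows "x = y"
proof -
  have *: "\<exists>j0\<ge>1. \<forall>j\<ge>j0. x \<in> Fl j 0" if "x \<in> always_bottom" for x
  proof -
    have "\<exists>j0\<ge>1. \<forall>j\<ge>j0. \<exists>k<h j. x \<in> Fl j k"
      using that by (intro position_exists) (simp add: always_bottom_def)
    then obtain j0 where j0: "j0 \<ge> 1" "\<And>j. j \<ge> j0 \<Longrightarrow> \<exists>k<h j. x \<in> Fl j k"
      by blast
    have "x \<in> Fl j 0" if j: "j \<ge> j0" for j
    proof -
      obtain k where k: "k < h j" "x \<in> Fl j k"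
        using j0(2)[OF j] by auto
      then have "k = 0"
        using \<open>x \<in> always_bottom\<close> j j0(1) by (cases k) (auto simp: always_bottom_def)
      then show ?thesis
        using k by simp
    qed
    then show ?thesis
      using j0(1) by auto
  qed
  obtain j0 j1 where "\<And>j. j \<ge> j0 \<Longrightarrow> x \<in> Fl j 0" "\<And>j. j \<ge> j1 \<Longrightarrow> y \<in> Fl j 0"
    using *[OF assms(1)] *[OF assms(2)] by blast
  then show ?thesis
    by (intro same_floors_eq[of "max j0 j1"]) auto
qed

lemma null_set_subsingleton:
  assumes "\<And>x y. x \<in> L \<Longrightarrow> y \<in> L \<Longrightarrow> x = y" "L \<subseteq> space M"
  shows "L \<in> null_sets M"
proof -
  have "L = {} \<or> (\<exists>x. L = {x})"
    using assms(1) by blast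
  then have "L \<in> sets borel" "emeasure lborel L = 0"
    by auto
  then show ?thesis
    using assms(2) by (simp add: null_sets_def sets_M emeasure_M)
qed

lemma null_always_top: "always_top \<in> null_sets M"
  by (rule null_set_subsingleton) (auto intro: always_top_unique simp: always_top_def)

lemma null_always_bottom: "always_bottom \<in> null_sets M"
  by (rule null_set_subsingleton) (auto intro: always_bottom_unique simp: always_bottom_def)

text \<open>The reindexing \<open>\<sigma>\<close> is the identity for \<open>T\<close> and the successor for its inverse: \<open>T\<close> is defined
  piecewise on the floors below a top floor, the inverse on the floors above a bottom floor.\<close>

lemma measurable_piecewise_translation:
  assumes pieces: "\<And>j k x. j \<ge> 1 \<Longrightarrow> Suc k < h j \<Longrightarrow> x \<in> Fl j (\<sigma> k) \<Longrightarrow> f x = x + c j k"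
    and \<sigma>: "\<And>j k. Suc k < h j \<Longrightarrow> \<sigma> k < h j"
    and L: "\<And>x y. x \<in> L \<Longrightarrow> y \<in> L \<Longrightarrow> x = y" "L = {x \<in> space M. \<forall>j\<ge>1. \<forall>k. Suc k < h j \<longrightarrow> x \<notin> Fl j (\<sigma> k)}"
    and f: "f \<in> space M \<rightarrow> space M"
  shows "f \<in> measurable M M"
proof -
  let ?I = "{(j, k). j \<ge> 1 \<and> Suc k < h j}"
  let ?C = "insert L ((\<lambda>(j, k). Fl j (\<sigma> k)) ` ?I)"
  have "f \<in> borel_measurable M"
  proof (rule measurable_piecewise_restrict[of ?C])
    show "countable ?C"
      by auto
    show "\<Omega> \<inter> space M \<in> sets M" if "\<Omega> \<in> ?C" for \<Omega>
      using that null_set_subsingleton[of L] L floor_in_sets \<sigma> by (auto simp: null_sets_def)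
    show "space M \<subseteq> \<Union>?C"
      using L(2) by auto
    show "f \<in> borel_measurable (restrict_space M \<Omega>)" if "\<Omega> \<in> ?C" for \<Omega>
    proof (cases "\<Omega> = L")
      case True
      have eq: "f x = f (SOME y. y \<in> L)" if "x \<in> L" for x
        using L(1)[OF that someI[of "\<lambda>y. y \<in> L", OF that]] by simp
      have "f \<in> borel_measurable (restrict_space M L) \<longleftrightarrow> (\<lambda>x. f (SOME y. y \<in> L)) \<in> borel_measurable (restrict_space M L)"
        by (rule measurable_cong, rule eq) (simp add: space_restrict_space)
      then show ?thesis
        using True by simp
    next
      case False
      then obtain j k where jk: "j \<ge> 1" "Suc k < h j" "\<Omega> = Fl j (\<sigma> k)"
        using \<open>\<Omega> \<in> ?C\<close> by auto
      have [measurable]: "(\<lambda>x. x + c j k) \<in> borel_measurable M"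
        using space_sets by (auto simp: rank_one_space_def intro!: measurable_restrict_space1)
      have "f \<in> borel_measurable (restrict_space M \<Omega>) \<longleftrightarrow> (\<lambda>x. x + c j k) \<in> borel_measurable (restrict_space M \<Omega>)"
        using pieces[OF jk(1,2)] jk(3) by (intro measurable_cong) (auto simp: space_restrict_space)
      then show ?thesis
        by (auto intro!: measurable_restrict_space1)
    qed
  qed
  then have "f \<in> measurable M lborel"
    by (simp add: measurable_lborel2)
  then have "f \<in> measurable M (restrict_space lborel (space M))"
    using f by (intro measurable_restrict_space2)
  moreover have "restrict_space lborel (space M) = M"
    unfolding space_M by (simp only: rank_one_space_def)
  ultimately show ?thesis
    by (simp only:)
qed

lemma T_measurable [measurable]: "T \<in> measurable M M"
  by (rule measurable_piecewise_translation[where \<sigma>="\<lambda>k. k" and c="\<lambda>j k. a j (Suc k) - a j k", OF translation _ always_top_unique always_top_def maps_space])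
    auto

lemma T_iterate_measurable [measurable]: "T ^^ m \<in> measurable M M"
  by (induction m) (auto intro: measurable_comp[unfolded comp_def] simp: comp_def id_def)

lemma emeasure_floor_vimage:
  assumes j: "j \<ge> 1" and k: "k + m < h j" and B: "B \<in> sets M"
  shows "emeasure M ((T ^^ m) -` B \<inter> Fl j k) = emeasure M (B \<inter> Fl j (k + m))"
proof -
  define c where "c = a j (k + m) - a j k"
  have "x \<in> (T ^^ m) -` B \<inter> Fl j k \<longleftrightarrow> x \<in> (+) c -` (B \<inter> Fl j (k + m))" for x
  proof (cases "x \<in> Fl j k")
    case True
    then have "(T ^^ m) x = c + x" "c + x \<in> Fl j (k + m)"
      using iterate_translation[OF j True k] by (auto simp: c_def add.commute)
    then show ?thesis
      using True by simp
  next
    case False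
    then have "c + x \<notin> Fl j (k + m)"
      by (auto simp: c_def mem_floor)
    then show ?thesis
      using False by simp
  qed
  then have "(T ^^ m) -` B \<inter> Fl j k = (+) c -` (B \<inter> Fl j (k + m))"
    by blast
  moreover have "B \<inter> Fl j (k + m) \<in> sets M"
    using B floor_in_sets[OF j k] by auto
  moreover have "(T ^^ m) -` B \<inter> Fl j k \<in> sets M"
  proof -
    have "(T ^^ m) -` B \<inter> space M \<inter> Fl j k \<in> sets M"
      using j k by (intro sets.Int measurable_sets[OF T_iterate_measurable B] floor_in_sets) auto
    moreover have "Fl j k \<subseteq> space M"
      using floor_in_sets[of j k] j k sets.sets_into_space by auto
    ultimately show ?thesis
      by (simp add: Int_assoc Int_absorb1)
  qed
  moreover have "emeasure lborel ((+) c -` C) = emeasure lborel C" if "C \<in> sets M" for C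
    using emeasure_distr[of "(+) c" lborel borel C] that lborel_distr_plus[of c] by (simp add: sets_M)
  ultimately show ?thesis
    using emeasure_M by metis
qed

text \<open>At each stage \<open>T\<close> maps the union \<open>G\<close> of the floors below the top onto the union \<open>H\<close> of the floors
  above the bottom by translations. Both unions exhaust the space up to one point.\<close>

lemma T_preserving: "distr M M T = M"
proof (rule measure_eqI)
  fix A
  assume "A \<in> sets (distr M M T)"
  then have A[measurable]: "A \<in> sets M"
    by simp
  define G where "G j = floors j {k. Suc k < h j}" for j
  define H where "H j = floors j {k. 0 < k \<and> k < h j}" for j
  have Gm: "G (Suc j) \<in> sets M" and Hm: "H (Suc j) \<in> sets M" for j
    unfolding G_def H_def by (auto intro!: fmeasurableD floors_fmeasurable)
  have Ginc: "incseq (\<lambda>j. G (Suc j))"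
  proof (rule incseq_SucI, rule subsetI)
    fix j x
    assume "x \<in> G (Suc j)"
    then obtain k where "k + 1 < h (Suc j)" "x \<in> Fl (Suc j) k"
      by (auto simp: G_def floors_def)
    then show "x \<in> G (Suc (Suc j))"
      using not_top_later[of "Suc j" x k 1 "Suc (Suc j)"] by (auto simp: G_def floors_def)
  qed
  have Hinc: "incseq (\<lambda>j. H (Suc j))"
  proof (rule incseq_SucI, rule subsetI)
    fix j x
    assume "x \<in> H (Suc j)"
    then obtain k where "Suc k < h (Suc j)" "x \<in> Fl (Suc j) (Suc k)"
      by (auto simp: H_def floors_def gr0_conv_Suc)
    then show "x \<in> H (Suc (Suc j))"
      using not_bottom_later[of "Suc j" x k "Suc (Suc j)"] by (auto simp: H_def floors_def)
  qed
  have Gun: "(\<Union>j. G (Suc j)) = space M - always_top"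
  proof
    show "(\<Union>j. G (Suc j)) \<subseteq> space M - always_top"
      using Gm sets.sets_into_space by (fastforce simp: G_def floors_def always_top_def)
    show "space M - always_top \<subseteq> (\<Union>j. G (Suc j))"
    proof
      fix x
      assume "x \<in> space M - always_top"
      then obtain j k where "j \<ge> 1" "Suc k < h j" "x \<in> Fl j k"
        by (auto simp: always_top_def)
      then show "x \<in> (\<Union>j. G (Suc j))"
        by (intro UN_I[of "j - 1"]) (auto simp: G_def floors_def)
    qed
  qed
  have Hun: "(\<Union>j. H (Suc j)) = space M - always_bottom"
  proof
    show "(\<Union>j. H (Suc j)) \<subseteq> space M - always_bottom"
    proof
      fix x
      assume "x \<in> (\<Union>j. H (Suc j))"
      then obtain j k where "Suc k < h (Suc j)" "x \<in> Fl (Suc j) (Suc k)"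
        by (auto simp: H_def floors_def gr0_conv_Suc)
      moreover have "x \<in> space M"
        using \<open>x \<in> (\<Union>j. H (Suc j))\<close> Hm sets.sets_into_space by blast
      ultimately show "x \<in> space M - always_bottom"
        unfolding always_bottom_def by fastforce
    qed
    show "space M - always_bottom \<subseteq> (\<Union>j. H (Suc j))"
    proof
      fix x
      assume "x \<in> space M - always_bottom"
      then obtain j k where "j \<ge> 1" "Suc k < h j" "x \<in> Fl j (Suc k)"
        by (auto simp: always_bottom_def)
      then show "x \<in> (\<Union>j. H (Suc j))"
        by (intro UN_I[of "j - 1"]) (auto simp: H_def floors_def)
    qed
  qed
  have step: "emeasure M (T -` A \<inter> G (Suc j)) = emeasure M (A \<inter> H (Suc j))" for j
  proof -
    let ?j = "Suc j" and ?K = "{k. Suc k < h (Suc j)}"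
    have fin: "finite ?K"
      by (rule finite_subset[of _ "{..<h (Suc j)}"]) auto
    have sp: "Fl ?j k \<subseteq> space M" if "k < h ?j" for k
      using floor_in_sets[of ?j k] that sets.sets_into_space by auto
    have d: "disjoint_family_on (Fl ?j) {..<h ?j}"
      by (rule floors_disjoint) simp
    have m1: "T -` A \<inter> Fl ?j k \<in> sets M" if "k \<in> ?K" for k
    proof -
      have "T -` A \<inter> space M \<inter> Fl ?j k \<in> sets M"
        using that by (intro sets.Int measurable_sets[OF T_measurable A] floor_in_sets) auto
      then show ?thesis
        using that sp[of k] by (simp add: Int_assoc Int_absorb1)
    qed
    have "emeasure M (T -` A \<inter> G ?j) = emeasure M (\<Union>k\<in>?K. T -` A \<inter> Fl ?j k)"
      by (auto simp: G_def floors_def intro!: arg_cong[where f="emeasure M"])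
    also have "\<dots> = (\<Sum>k\<in>?K. emeasure M (T -` A \<inter> Fl ?j k))"
    proof (rule sum_emeasure[symmetric])
      show "disjoint_family_on (\<lambda>k. T -` A \<inter> Fl ?j k) ?K"
        by (rule disjoint_family_on_bisimulation[OF disjoint_family_on_mono[OF _ d]]) auto
    qed (use fin m1 in auto)
    also have "\<dots> = (\<Sum>k\<in>?K. emeasure M (A \<inter> Fl ?j (Suc k)))"
      using emeasure_floor_vimage[of ?j _ 1 A] A by (intro sum.cong) auto
    also have "\<dots> = emeasure M (\<Union>k\<in>?K. A \<inter> Fl ?j (Suc k))"
    proof (rule sum_emeasure)
      show "(\<lambda>k. A \<inter> Fl ?j (Suc k)) ` ?K \<subseteq> sets M"
        using A floor_in_sets[of ?j] by auto
      have "disjoint_family_on (\<lambda>k. Fl ?j (Suc k)) ?K"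
        using d by (auto simp: disjoint_family_on_def)
      then show "disjoint_family_on (\<lambda>k. A \<inter> Fl ?j (Suc k)) ?K"
        by (rule disjoint_family_on_bisimulation) auto
    qed (use fin in auto)
    also have "(\<Union>k\<in>?K. A \<inter> Fl ?j (Suc k)) = A \<inter> H ?j"
      by (auto simp: H_def floors_def gr0_conv_Suc)
    finally show ?thesis .
  qed
  have "emeasure (distr M M T) A = emeasure M (T -` A \<inter> space M)"
    by (simp add: emeasure_distr)
  also have "\<dots> = emeasure M (T -` A \<inter> space M - always_top)"
    using null_always_top measurable_sets[OF T_measurable A] by (simp add: emeasure_Diff_null_set)
  also have "T -` A \<inter> space M - always_top = (\<Union>j. T -` A \<inter> G (Suc j))"
    using Gun by auto
  also have "emeasure M (\<Union>j. T -` A \<inter> G (Suc j)) = (SUP j. emeasure M (T -` A \<inter> G (Suc j)))"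
  proof (rule SUP_emeasure_incseq[symmetric])
    show "incseq (\<lambda>j. T -` A \<inter> G (Suc j))"
      using Ginc by (auto simp: incseq_def)
    have "T -` A \<inter> space M \<inter> G (Suc j) \<in> sets M" for j
      by (intro sets.Int measurable_sets[OF T_measurable A] Gm)
    moreover have "T -` A \<inter> space M \<inter> G (Suc j) = T -` A \<inter> G (Suc j)" for j
      using sets.sets_into_space[OF Gm[of j]] by auto
    ultimately have "T -` A \<inter> G (Suc j) \<in> sets M" for j
      by simp
    then show "range (\<lambda>j. T -` A \<inter> G (Suc j)) \<subseteq> sets M"
      by auto
  qed
  also have "\<dots> = (SUP j. emeasure M (A \<inter> H (Suc j)))"
    by (simp add: step)
  also have "\<dots> = emeasure M (\<Union>j. A \<inter> H (Suc j))"
    using Hm Hinc by (intro SUP_emeasure_incseq) (auto simp: incseq_def)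
  also have "(\<Union>j. A \<inter> H (Suc j)) = A - always_bottom"
    using Hun sets.sets_into_space[OF A] by auto
  also have "emeasure M (A - always_bottom) = emeasure M A"
    using null_always_bottom by (intro emeasure_Diff_null_set) auto
  finally show "emeasure (distr M M T) A = emeasure M A" .
qed simp

text \<open>Two points can be compared at a common stage at which neither lies in the top floor.\<close>

lemma T_inj: "inj_on T (space M - always_top)"
proof (rule inj_onI)
  fix x y
  assume x: "x \<in> space M - always_top" and y: "y \<in> space M - always_top" and eq: "T x = T y"
  obtain j k where jk: "j \<ge> 1" "Suc k < h j" "x \<in> Fl j k"
    using x by (auto simp: always_top_def)
  obtain j' k' where jk': "j' \<ge> 1" "Suc k' < h j'" "y \<in> Fl j' k'"
    using y by (auto simp: always_top_def)
  define i where "i = max j j'"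
  have i: "i \<ge> 1"
    using jk by (simp add: i_def)
  obtain p q where p: "p + 1 < h i" "x \<in> Fl i p" and q: "q + 1 < h i" "y \<in> Fl i q"
    using not_top_later[of j x k 1 i] not_top_later[of j' y k' 1 i] jk jk' by (auto simp: i_def)
  have "T x \<in> Fl i (p + 1)" "T y \<in> Fl i (q + 1)"
    using iterate_translation(2)[OF i p(2,1)] iterate_translation(2)[OF i q(2,1)] by auto
  then have "p = q"
    using floor_unique[OF i p(1) q(1), of "T x"] eq by simp
  then show "x = y"
    using iterate_translation(1)[OF i p(2,1)] iterate_translation(1)[OF i q(2,1)] eq by simp
qed

definition T_inv :: "real \<Rightarrow> real" where
  "T_inv y = (if y \<in> T ` (space M - always_top) then the_inv_into (space M - always_top) T y else y)"

lemma T_inv_T: "x \<in> space M - always_top \<Longrightarrow> T_inv (T x) = x"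
  by (simp add: T_inv_def the_inv_into_f_f[OF T_inj])

lemma T_inv_translation:
  assumes "j \<ge> 1" "Suc k < h j" "y \<in> Fl j (Suc k)"
  shows "T_inv y = y + (a j k - a j (Suc k))" "T (T_inv y) = y"
proof -
  define x where "x = y + (a j k - a j (Suc k))"
  have x: "x \<in> Fl j k"
    using assms(3) by (auto simp: x_def mem_floor)
  have "x \<in> space M - always_top"
    using x assms floor_in_sets[of j k] sets.sets_into_space[of "Fl j k" M] by (auto simp: always_top_def)
  moreover have "T x = y"
    using translation[OF assms(1,2) x] by (simp add: x_def)
  ultimately show "T_inv y = y + (a j k - a j (Suc k))" "T (T_inv y) = y"
    using T_inv_T[of x] by (auto simp: x_def)
qed

lemma T_inv_measurable: "T_inv \<in> measurable M M"
proof (rule measurable_piecewise_translation[where \<sigma>=Suc and c="\<lambda>j k. a j k - a j (Suc k)", OF T_inv_translation(1) _ always_bottom_unique always_bottom_def])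
  show "T_inv \<in> space M \<rightarrow> space M"
    using the_inv_into_into[OF T_inj, of _ "space M"] by (auto simp: T_inv_def)
qed auto

lemma T_pair: "inverse_pair M T T_inv"
proof -
  have 1: "AE x in M. T_inv (T x) = x"
    using AE_not_in[OF null_always_top] AE_space by eventually_elim (auto intro: T_inv_T)
  have 2: "AE x in M. T (T_inv x) = x"
    using AE_not_in[OF null_always_bottom] AE_space
    by eventually_elim (auto simp: always_bottom_def intro: T_inv_translation(2))
  have [measurable]: "T_inv \<in> measurable M M"
    by (rule T_inv_measurable)
  have "distr M M T_inv = M"
  proof (rule measure_eqI)
    fix A
    assume "A \<in> sets (distr M M T_inv)"
    then have A[measurable]: "A \<in> sets M"
      by simp
    have "emeasure (distr M M T_inv) A = emeasure (distr M M T) (T_inv -` A \<inter> space M)"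
      by (simp add: T_preserving emeasure_distr)
    also have "\<dots> = emeasure M (T -` (T_inv -` A \<inter> space M) \<inter> space M)"
      by (rule emeasure_distr) measurable
    also have "\<dots> = emeasure M A"
      using 1 sets.sets_into_space[OF A] measurable_space[OF T_measurable] by (intro emeasure_eq_AE) auto
    finally show "emeasure (distr M M T_inv) A = emeasure M A" .
  qed simp
  then show ?thesis
    using 1 2 T_preserving by (simp add: inverse_pair_def)
qed

section \<open>Approximation by floors\<close>

lemma sigma_finite_M: "sigma_finite_measure M"
  unfolding rank_one_space_def using space_sets by (intro sigma_finite_measure_restrict_space sigma_finite_lborel) simp

text \<open>The unions of floors inside the tower of stage \<open>i\<close>; the stage of the floors varies so that the
  family is closed under unions.\<close>

definition floor_algebra :: "nat \<Rightarrow> real set set" where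
  "floor_algebra i = {B. \<exists>j K. i \<le> j \<and> K \<subseteq> {..<h j} \<and> floors j K \<subseteq> X i \<and> B = floors j K}"

lemma floor_algebraI: "i \<le> j \<Longrightarrow> K \<subseteq> {..<h j} \<Longrightarrow> floors j K \<subseteq> X i \<Longrightarrow> floors j K \<in> floor_algebra i"
  by (auto simp: floor_algebra_def)

lemma floor_algebra_common:
  assumes i: "i \<ge> 1" and B: "B \<in> floor_algebra i"
  shows "\<exists>j0\<ge>i. \<forall>j\<ge>j0. \<exists>K\<subseteq>{..<h j}. B = floors j K"
proof -
  obtain j0 K where "i \<le> j0" "K \<subseteq> {..<h j0}" "B = floors j0 K"
    using B by (auto simp: floor_algebra_def)
  then show ?thesis
    using refine[of j0 K] i by (intro exI[of _ j0]) auto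
qed

text \<open>The part of an open set inside the tower is a countable union of floors, because the lengths of
  the floors tend to zero. So the sigma-algebra of approximable sets contains all Borel subsets of
  the tower.\<close>

lemma floor_algebra_sigma:
  assumes i: "i \<ge> 1" and S: "S \<in> sets borel" "S \<subseteq> X i" and e: "e > 0"
  shows "\<exists>B\<in>floor_algebra i. measure M (sym_diff S B) < e"
proof -
  define N where "N = restrict_space lborel (X i)"
  have N: "space N = X i" "sets N = {S. S \<in> sets borel \<and> S \<subseteq> X i}"
    by (auto simp: N_def space_restrict_space sets_restrict_space_iff)
  have NM: "measure N S = measure M S" if "S \<in> sets N" for S
  proof -
    have "S \<in> sets M"
      using that N tower_subset_space[OF i] by (auto simp: sets_M)
    then show ?thesis
      using that N(2) emeasure_restrict_space[of "X i" lborel S] by (simp add: N_def emeasure_M measure_def)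
  qed
  have fin: "finite_measure N"
  proof
    have "emeasure N (space N) = emeasure M (X i)"
      using fmeasurableD[OF tower_fmeasurable[OF i]] N(1) by (simp add: N_def emeasure_restrict_space emeasure_M)
    then show "emeasure N (space N) \<noteq> \<infinity>"
      using tower_fmeasurable[OF i] by (auto simp: fmeasurable_def)
  qed
  let ?A = "{S \<in> sets N. \<forall>e>0. \<exists>B\<in>floor_algebra i. measure N (sym_diff S B) < e \<and> measure N (sym_diff S B) < e}"
  have sub: "floor_algebra i \<subseteq> sets N"
    unfolding floor_algebra_def N(2) floors_def using finite_subset by (fastforce intro!: sets.finite_UN)
  have UX: "X i \<in> floor_algebra i" 
    using floor_algebraI[of i i "{..<h i}"] tower_eq_floors[of i] by simp
  have "sigma_algebra (space N) ?A"
  proof (rule approximable_sigma_algebra[OF fin fin refl sub])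
    show "{} \<in> floor_algebra i"
      unfolding floor_algebra_def by (auto simp: floors_def intro!: exI[of _ i] exI[of _ "{}"])
    fix B
    assume B: "B \<in> floor_algebra i"
    obtain j0 where j0: "j0 \<ge> i" "\<And>j. j \<ge> j0 \<Longrightarrow> \<exists>K\<subseteq>{..<h j}. B = floors j K"
      using floor_algebra_common[OF i B] by blast
    show "space N - B \<in> floor_algebra i"
    proof -
      obtain K where K: "K \<subseteq> {..<h j0}" "B = floors j0 K"
        using j0 by auto
      obtain L where L: "L \<subseteq> {..<h j0}" "X i = floors j0 L"
        using refine[of i "{..<h i}" j0] i j0(1) by (auto simp: tower_eq_floors)
      have "floors j0 L - floors j0 K = floors j0 (L - K)"
      proof -
        have "floors j0 (L - K) \<inter> floors j0 K = floors j0 ((L - K) \<inter> K)"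
          using i j0(1) K(1) L(1) by (intro floors_Int) auto
        also have "(L - K) \<inter> K = {}"
          by auto
        finally have "floors j0 (L - K) \<inter> floors j0 K = {}"
          by (simp add: floors_def)
        moreover have "floors j0 L \<subseteq> floors j0 (L - K) \<union> floors j0 K" "floors j0 (L - K) \<subseteq> floors j0 L"
          by (auto simp: floors_def)
        ultimately show ?thesis
          by blast
      qed
      then have "space N - B = floors j0 (L - K)"
        using K L N by simp
      moreover have "floors j0 (L - K) \<subseteq> X i"
        unfolding L(2) by (auto simp: floors_def)
      ultimately show ?thesis
        using j0(1) L(1) by (simp only:) (rule floor_algebraI, auto)
    qed
    fix C
    assume C: "C \<in> floor_algebra i"
    obtain j1 where j1: "j1 \<ge> i" "\<And>j. j \<ge> j1 \<Longrightarrow> \<exists>K\<subseteq>{..<h j}. C = floors j K"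
      using floor_algebra_common[OF i C] by blast
    define j where "j = max j0 j1"
    obtain K L where KL: "K \<subseteq> {..<h j}" "B = floors j K" "L \<subseteq> {..<h j}" "C = floors j L"
      using j0(2)[of j] j1(2)[of j] by (auto simp: j_def)
    have "B \<union> C = floors j (K \<union> L)"
      using KL by (auto simp: floors_def)
    moreover have "B \<union> C \<subseteq> X i"
      using B C by (auto simp: floor_algebra_def)
    moreover have "i \<le> j"
      using j0(1) by (simp add: j_def)
    ultimately show "B \<union> C \<in> floor_algebra i"
      using KL by (simp only:) (rule floor_algebraI, auto)
  qed
  then interpret A: sigma_algebra "space N" ?A .
  define N' where "N' = sigma (space N) ?A"
  have N': "space N' = X i" "sets N' = ?A"
    using A.space_closed A.sets_measure_of_eq N(1) by (auto simp: N'_def space_measure_of_conv)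
  have "(\<lambda>x. x) \<in> borel_measurable N'"
  proof (rule borel_measurableI)
    fix G :: "real set"
    assume G: "open G"
    let ?I = "{(j, k). i \<le> j \<and> k < h j \<and> Fl j k \<subseteq> G \<inter> X i}"
    have "G \<inter> X i \<subseteq> (\<Union>(j, k)\<in>?I. Fl j k)"
    proof
      fix x
      assume x: "x \<in> G \<inter> X i"
      then obtain d where d: "d > 0" "ball x d \<subseteq> G"
        using G by (auto simp: open_contains_ball)
      have "\<forall>\<^sub>F j in sequentially. w j < d \<and> i \<le> j"
        using d(1) by (intro eventually_conj order_tendstoD(2)[OF length_tendsto_0] eventually_ge_at_top)
      then obtain j where j: "w j < d" "i \<le> j"
        by (auto simp: eventually_sequentially)
      obtain L where L: "L \<subseteq> {..<h j}" "X i = floors j L"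
        using refine[of i "{..<h i}" j] i j by (auto simp: tower_eq_floors)
      then obtain k where k: "k \<in> L" "x \<in> Fl j k"
        using x by (auto simp: floors_def)
      have "Fl j k \<subseteq> ball x d"
        using k(2) j(1) by (auto simp: mem_floor dist_real_def)
      then have "(j, k) \<in> ?I"
        using d(2) j(2) L k(1) by (auto simp: floors_def)
      then show "x \<in> (\<Union>(j, k)\<in>?I. Fl j k)"
        using k(2) by auto
    qed
    then have "(\<lambda>x. x) -` G \<inter> space N' = (\<Union>p\<in>?I. (\<lambda>(j, k). Fl j k) p)"
      by (auto simp: N')
    also have "\<dots> \<in> ?A"
    proof (rule A.countable_UN'')
      show "countable ?I"
        by auto
      fix p
      assume "p \<in> ?I"
      then have "(\<lambda>(j, k). Fl j k) p \<in> floor_algebra i"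
        by (auto simp: floor_algebra_def floors_def intro!: exI[of _ "fst p"] exI[of _ "{snd p}"])
      then show "(\<lambda>(j, k). Fl j k) p \<in> ?A"
        using sub by (auto intro!: bexI[of _ "(\<lambda>(j, k). Fl j k) p"])
    qed
    finally show "(\<lambda>x. x) -` G \<inter> space N' \<in> sets N'"
      by (simp only: N')
  qed
  then have "(\<lambda>x. x) -` S \<inter> space N' \<in> sets N'"
    using S(1) by (rule measurable_sets)
  then have "S \<in> ?A"
    using S(2) by (simp add: N' Int_absorb2)
  then obtain B where "B \<in> floor_algebra i" "measure N (sym_diff S B) < e" "sym_diff S B \<in> sets N"
    using e sub by blast
  then show ?thesis
    using NM by (intro bexI[of _ B]) auto
qed

lemma tower_exhausts:
  assumes A: "A \<in> fmeasurable M"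
  shows "(\<lambda>j. measure M (A - X (Suc j))) \<longlonglongrightarrow> 0"
proof -
  have Am: "A \<in> sets M" "emeasure M A \<noteq> \<infinity>"
    using A by (auto simp: fmeasurable_def)
  have s: "X (Suc j) \<in> sets M" for j
    using tower_fmeasurable[of "Suc j"] by auto
  have "(\<lambda>j. measure M (A - X (Suc j))) \<longlonglongrightarrow> measure M (\<Inter>j. A - X (Suc j))"
  proof (rule Lim_measure_decseq)
    show "range (\<lambda>j. A - X (Suc j)) \<subseteq> sets M"
      using Am s by auto
    show "decseq (\<lambda>j. A - X (Suc j))"
      using tower_mono by (fastforce simp: decseq_def)
    show "emeasure M (A - X (Suc j)) \<noteq> \<infinity>" for j
      using Am s emeasure_mono[of "A - X (Suc j)" A M] by (auto simp: top_unique)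
  qed
  moreover have "(\<Inter>j. A - X (Suc j)) = {}"
  proof -
    have "x \<notin> A" if "\<And>j. x \<notin> X (Suc j)" for x
    proof
      assume "x \<in> A"
      then have "x \<in> space M"
        using sets.sets_into_space[OF Am(1)] by auto
      then obtain j where "j \<ge> 1" "x \<in> X j"
        by (auto simp: space_M)
      then show False
        using that[of "j - 1"] by simp
    qed
    then show ?thesis
      by auto
  qed
  ultimately show ?thesis
    by (simp only: measure_empty)
qed

lemma floor_approximation:
  assumes A: "A \<in> fmeasurable M" and e: "e > 0"
  shows "\<exists>j0\<ge>1. \<forall>j\<ge>j0. \<exists>K\<subseteq>{..<h j}. measure M (sym_diff A (floors j K)) < e"
proof -
  obtain i where i: "measure M (A - X (Suc i)) < e / 2"
    using order_tendstoD(2)[OF tower_exhausts[OF A], of "e / 2"] e by (auto simp: eventually_sequentially)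
  let ?A = "A \<inter> X (Suc i)"
  have Xs: "X (Suc i) \<in> fmeasurable M"
    by (intro tower_fmeasurable) simp
  have "?A \<in> sets borel"
    using A Xs by (auto simp: sets_M fmeasurable_def)
  then obtain B where B: "B \<in> floor_algebra (Suc i)" "measure M (sym_diff ?A B) < e / 2"
    using floor_algebra_sigma[of "Suc i" ?A "e / 2"] e by auto
  obtain j0 where j0: "j0 \<ge> Suc i" "\<And>j. j \<ge> j0 \<Longrightarrow> \<exists>K\<subseteq>{..<h j}. B = floors j K"
    using floor_algebra_common[OF _ B(1)] by auto
  have Bf: "B \<in> fmeasurable M"
    using B(1) by (auto simp: floor_algebra_def intro!: floors_fmeasurable)
  have f: "A - X (Suc i) \<in> fmeasurable M" "sym_diff ?A B \<in> fmeasurable M"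
    using A Bf Xs by (auto intro!: fmeasurable.Un fmeasurable.Diff intro: fmeasurable_Int_sets)
  have "measure M (sym_diff A B) \<le> measure M ((A - X (Suc i)) \<union> sym_diff ?A B)"
    using fmeasurable.Un[OF f] A Bf by (intro measure_mono_fmeasurable) auto
  also have "\<dots> \<le> measure M (A - X (Suc i)) + measure M (sym_diff ?A B)"
    using f by (intro measure_Un_le) auto
  also have "\<dots> < e"
    using i B(2) by simp
  finally have "measure M (sym_diff A B) < e" .
  then have "\<exists>K\<subseteq>{..<h j}. measure M (sym_diff A (floors j K)) < e" if "j \<ge> j0" for j
    using j0(2)[OF that] by blast
  then show ?thesis
    using j0(1) by (intro exI[of _ j0]) auto
qed

lemma floor_approximation_eventually:
  assumes "A \<in> fmeasurable M" "e > 0"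
  shows "\<forall>\<^sub>F j in sequentially. j \<ge> 1 \<and> (\<exists>K\<subseteq>{..<h j}. measure M (sym_diff A (floors j K)) < e)"
proof -
  obtain j0 where "j0 \<ge> 1" "\<And>j. j \<ge> j0 \<Longrightarrow> \<exists>K\<subseteq>{..<h j}. measure M (sym_diff A (floors j K)) < e"
    using floor_approximation[OF assms] by blast
  then show ?thesis
    unfolding eventually_sequentially by (intro exI[of _ j0]) auto
qed

text \<open>Cut by the floors of a late stage: the part outside the tower is small as a whole, and each part
  inside a floor is small because the floor is.\<close>

lemma finely_divisible_M: "finely_divisible M"
  unfolding finely_divisible_def
proof (intro conjI ballI allI impI)
  show "sigma_finite_measure M"
    by (rule sigma_finite_M)
  fix C and e :: real
  assume C: "C \<in> fmeasurable M" and e: "e > 0"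
  have "(\<lambda>j. w (Suc j) * measure M C + (measure M (C - X (Suc j)))\<^sup>2) \<longlonglongrightarrow> 0 * measure M C + 0\<^sup>2"
    by (intro tendsto_intros tower_exhausts[OF C] LIMSEQ_Suc[OF length_tendsto_0])
  then have "\<forall>\<^sub>F j in sequentially. w (Suc j) * measure M C + (measure M (C - X (Suc j)))\<^sup>2 < e"
    using e by (intro order_tendstoD(2)) auto
  then obtain j where j: "w (Suc j) * measure M C + (measure M (C - X (Suc j)))\<^sup>2 < e"
    by (auto simp: eventually_sequentially)
  define D where "D k = (if k < h (Suc j) then C \<inter> Fl (Suc j) k else C - X (Suc j))" for k
  have Xs: "X (Suc j) \<in> fmeasurable M"
    by (intro tower_fmeasurable) simp
  have Df: "D k \<in> fmeasurable M" for k
    using C Xs by (auto simp: D_def intro!: fmeasurable_Int_sets[OF C] floor_in_sets intro: fmeasurable.Diff)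
  have dis: "disjoint_family_on D {..<h (Suc j)}"
    by (rule disjoint_family_on_bisimulation[OF floors_disjoint[of "Suc j"]]) (auto simp: D_def)
  have dis': "disjoint_family_on D {..<Suc (h (Suc j))}"
    using dis by (auto simp: disjoint_family_on_def D_def tower_def less_Suc_eq)
  have "(\<Sum>k<h (Suc j). (measure M (D k))\<^sup>2) \<le> (\<Sum>k<h (Suc j). w (Suc j) * measure M (D k))"
  proof (rule sum_mono)
    fix k
    assume k: "k \<in> {..<h (Suc j)}"
    have "measure M (D k) \<le> measure M (Fl (Suc j) k)"
      using k Df[of k] by (intro measure_mono_fmeasurable) (auto simp: D_def intro!: floor_fmeasurable)
    then have "measure M (D k) \<le> w (Suc j)"
      using k measure_floor[of "Suc j" k] by auto
    then show "(measure M (D k))\<^sup>2 \<le> w (Suc j) * measure M (D k)"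
      by (simp add: power2_eq_square mult_right_mono)
  qed
  also have "\<dots> = w (Suc j) * measure M (\<Union>k<h (Suc j). D k)"
    using dis Df by (subst measure_UNION') (auto simp: sum_distrib_left pairwise_def disjnt_def disjoint_family_on_def)
  also have "\<dots> \<le> w (Suc j) * measure M C"
  proof -
    have "(\<Union>k<h (Suc j). D k) \<in> sets M"
      using Df by (intro sets.finite_UN) auto
    moreover have "(\<Union>k<h (Suc j). D k) \<subseteq> C"
      by (auto simp: D_def split: if_splits)
    ultimately show ?thesis
      using length_pos[of "Suc j"] C by (intro mult_left_mono measure_mono_fmeasurable) auto
  qed
  finally have "(\<Sum>k<Suc (h (Suc j)). (measure M (D k))\<^sup>2) < e"
    using j by (simp add: D_def)
  moreover have "C = (\<Union>k<Suc (h (Suc j)). D k)"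
    by (auto simp: D_def tower_def less_Suc_eq split: if_splits)
  ultimately show "\<exists>D n. (\<forall>k<n. D k \<in> fmeasurable M) \<and> disjoint_family_on D {..<n::nat}
      \<and> C = (\<Union>k<n. D k) \<and> (\<Sum>k<n. (measure M (D k))\<^sup>2) < e"
    using Df dis' by blast
qed

text \<open>A weak form of the Lebesgue density theorem: if all floors in an approximating union had a small
  share in \<open>E\<close>, the union would be a bad approximation.\<close>

lemma dense_floor:
  assumes E: "E \<in> fmeasurable M" "measure M E > 0"
  shows "\<forall>\<^sub>F j in sequentially. j \<ge> 1 \<and> (\<exists>k<h j. measure M (E \<inter> Fl j k) > 9 / 10 * w j)"
proof -
  \<comment> \<open>An error of \<open>\<mu>(E) / 20\<close> is too small for a share of at most \<open>9 / 10\<close> in every floor.\<close>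
  have "measure M E / 20 > 0"
    using E by simp
  from floor_approximation_eventually[OF E(1) this] show ?thesis
  proof eventually_elim
    case (elim j)
    then obtain K where K: "K \<subseteq> {..<h j}" "measure M (sym_diff E (floors j K)) < measure M E / 20" and j: "j \<ge> 1"
      by auto
    have Uf: "floors j K \<in> fmeasurable M" "E \<inter> floors j K \<in> fmeasurable M"
      using floors_fmeasurable[OF j K(1)] E by (auto intro: fmeasurable_Int_sets)
    have s: "sym_diff E (floors j K) \<in> fmeasurable M"
      using Uf E by (auto intro!: fmeasurable.Un fmeasurable.Diff)
    have 1: "measure M (floors j K) \<le> measure M E + measure M E / 20"
      using measure_le_sym_diff[OF Uf(1) E(1)] K(2) by (simp add: Un_commute)
    have 2: "measure M E \<le> measure M (E \<inter> floors j K) + measure M E / 20"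
      using measure_Int_sym_diff[OF E(1) E(1) E(1) Uf(1)] K(2) by simp
    show ?case
    proof (rule ccontr)
      assume "\<not> (j \<ge> 1 \<and> (\<exists>k<h j. measure M (E \<inter> Fl j k) > 9 / 10 * w j))"
      then have small: "measure M (E \<inter> Fl j k) \<le> 9 / 10 * w j" if "k \<in> K" for k
      proof -
        have "k < h j"
          using that K(1) by auto
        then show ?thesis
          using \<open>\<not> _\<close> j by (meson not_less)
      qed
      have "measure M (E \<inter> floors j K) = measure M (\<Union>k\<in>K. E \<inter> Fl j k)"
        by (rule arg_cong[where f="measure M"]) (auto simp: floors_def)
      also have "\<dots> \<le> (\<Sum>k\<in>K. measure M (E \<inter> Fl j k))"
        using K(1) finite_subset[OF K(1)] E j floor_in_sets[OF j]
        by (intro measure_UNION_le) (auto intro!: sets.Int)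
      also have "\<dots> \<le> (\<Sum>k\<in>K. 9 / 10 * w j)"
        by (intro sum_mono small)
      also have "\<dots> = 9 / 10 * measure M (floors j K)"
        using measure_floors[OF j K(1)] by simp
      finally show False
        using 1 2 E(2) by simp
    qed
  qed
qed

section \<open>Shifts by the height of a tower\<close>

text \<open>Without spacers the column has height \<open>h\<^sub>j\<close>, so that power of \<open>T\<close> moves it into the next column.\<close>

lemma column_shift_stay:
  assumes j: "j \<ge> 1" and i: "i \<in> {1..r j}" "i < r j" "s j i = 0" and k: "k < h j"
    and x: "x \<in> Fl (Suc j) (base j i + k)"
  shows "(T ^^ h j) x \<in> Fl j k"
proof -
  have p: "base j i + k + h j = base j (Suc i) + k"
    using i column_base_Suc[of i h s j] by simp
  have "base j (Suc i) + k < h (Suc j)"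
    using i k by (intro position_bound j) auto
  then have "(T ^^ h j) x \<in> Fl (Suc j) (base j (Suc i) + k)"
    using iterate_translation(2)[of "Suc j" x "base j i + k" "h j"] x p by simp
  then show ?thesis
    using subfloor[of j k "Suc i"] j k i by auto
qed

text \<open>With \<open>h\<^sub>j\<close> spacers the same power moves the column exactly onto its spacers.\<close>

lemma column_shift_leave:
  assumes j: "j \<ge> 1" and i: "i \<in> {1..r j}" "s j i = h j" and k: "k < h j"
    and x: "x \<in> Fl (Suc j) (base j i + k)"
  shows "(T ^^ h j) x \<notin> X j"
proof -
  have "base j i + (h j + k) < h (Suc j)"
    using i k by (intro position_bound j) auto
  then have "(T ^^ h j) x \<in> Fl (Suc j) (base j i + (h j + k))"
    using iterate_translation(2)[of "Suc j" x "base j i + k" "h j"] x by (simp add: add_ac)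
  then show ?thesis
    using added_floors[OF j i(1), of "h j + k"] i k by auto
qed

definition half_stage :: "nat \<Rightarrow> bool" where
  "half_stage j \<longleftrightarrow> j \<ge> 1 \<and> (\<forall>i\<in>{1..r j div 2}. s j i = 0) \<and> (\<forall>i\<in>{Suc (r j div 2)..r j}. s j i = h j)"

definition flat_stage :: "nat \<Rightarrow> bool" where
  "flat_stage j \<longleftrightarrow> j \<ge> 1 \<and> (\<forall>i\<in>{1..r j}. s j i = 0)"

lemma mem_floors_refine:
  assumes "j \<ge> 1" "K \<subseteq> {..<h j}" "x \<in> floors j K"
  obtains i k where "i \<in> {1..r j}" "k \<in> K" "x \<in> Fl (Suc j) (base j i + k)" "x \<in> Fl j k"
proof -
  obtain k where k: "k \<in> K" "x \<in> Fl j k"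
    using assms(3) by (auto simp: floors_def)
  then show ?thesis
    using floor_refine[of j k] assms(1,2) that by blast
qed

text \<open>The points of the first half of the columns stay in their floor and those of the second half leave
  the tower.\<close>

lemma half_step:
  assumes j: "half_stage j" and K: "K \<subseteq> {..<h j}" "L \<subseteq> {..<h j}"
  shows "measure M (((T ^^ h j) -` floors j K \<inter> space M) \<inter> floors j L) = real (r j div 2) / real (r j) * measure M (floors j K \<inter> floors j L)"
proof -
  have j1: "j \<ge> 1"
    using j by (simp add: half_stage_def)
  have r: "r j \<ge> 1"
    using cuts_pos[OF j1] .
  have sub: "floors j K \<subseteq> X j"
    using K by (auto simp: tower_eq_floors floors_def)
  have eq: "((T ^^ h j) -` floors j K \<inter> space M) \<inter> floors j L = (\<Union>i\<in>{1..r j div 2}. \<Union>k\<in>K \<inter> L. Fl (Suc j) (base j i + k))"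
  proof (intro set_eqI iffI)
    fix x
    assume x: "x \<in> ((T ^^ h j) -` floors j K \<inter> space M) \<inter> floors j L"
    then obtain i k where ik: "i \<in> {1..r j}" "k \<in> L" "x \<in> Fl (Suc j) (base j i + k)"
      using mem_floors_refine[OF j1 K(2)] by blast
    have k: "k < h j"
      using ik(2) K(2) by auto
    have i: "i \<le> r j div 2"
    proof (rule ccontr)
      assume "\<not> i \<le> r j div 2"
      then have "s j i = h j"
        using j ik(1) by (auto simp: half_stage_def)
      then show False
        using column_shift_leave[OF j1 ik(1) _ k ik(3)] x sub by auto
    qed
    then have "(T ^^ h j) x \<in> Fl j k"
      using j ik r by (intro column_shift_stay[OF j1 ik(1) _ _ k ik(3)]) (auto simp: half_stage_def)
    moreover obtain k' where "k' \<in> K" "(T ^^ h j) x \<in> Fl j k'"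
      using x by (auto simp: floors_def)
    ultimately have "k \<in> K"
      using floor_unique[OF j1 k, of k' "(T ^^ h j) x"] K(1) by auto
    then show "x \<in> (\<Union>i\<in>{1..r j div 2}. \<Union>k\<in>K \<inter> L. Fl (Suc j) (base j i + k))"
      using ik i by auto
  next
    fix x
    assume "x \<in> (\<Union>i\<in>{1..r j div 2}. \<Union>k\<in>K \<inter> L. Fl (Suc j) (base j i + k))"
    then obtain i k where ik: "i \<in> {1..r j div 2}" "k \<in> K" "k \<in> L" "x \<in> Fl (Suc j) (base j i + k)"
      by auto
    have i: "i \<in> {1..r j}" "i < r j"
      using ik(1) r by auto
    have k: "k < h j"
      using ik(2) K by auto
    have "(T ^^ h j) x \<in> Fl j k"
      using j ik(1) by (intro column_shift_stay[OF j1 i _ k ik(4)]) (auto simp: half_stage_def)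
    moreover have "x \<in> Fl j k"
      using subfloor[OF j1 k i(1)] ik(4) by auto
    ultimately show "x \<in> ((T ^^ h j) -` floors j K \<inter> space M) \<inter> floors j L"
      using ik floor_in_sets[OF j1 k] sets.sets_into_space by (auto simp: floors_def)
  qed
  have I: "{1..r j div 2} \<subseteq> {1..r j}" and KL: "K \<inter> L \<subseteq> {..<h j}"
    using K by auto
  have "measure M (((T ^^ h j) -` floors j K \<inter> space M) \<inter> floors j L) = real (r j div 2) * real (card (K \<inter> L)) * w (Suc j)"
    unfolding eq using measure_subfloors[OF j1 I KL] by simp
  also have "\<dots> = real (r j div 2) / real (r j) * (real (card (K \<inter> L)) * w j)"
    using length_step[OF j1] r by simp
  also have "\<dots> = real (r j div 2) / real (r j) * measure M (floors j K \<inter> floors j L)"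
    using measure_floors[OF j1 KL] floors_Int[OF j1 K] by simp
  finally show ?thesis .
qed

text \<open>Only the last column, a share of \<open>1 / r\<^sub>j\<close> of each floor, can leave.\<close>

lemma flat_step:
  assumes j: "flat_stage j" and K: "K \<subseteq> {..<h j}"
  shows "measure M (floors j K) - measure M (floors j K) / real (r j) \<le> measure M (((T ^^ h j) -` floors j K \<inter> space M) \<inter> floors j K)"
proof -
  have j1: "j \<ge> 1"
    using j by (simp add: flat_stage_def)
  have r: "r j \<ge> 1"
    using cuts_pos[OF j1] .
  have sub: "(\<Union>i\<in>{1..r j - 1}. \<Union>k\<in>K. Fl (Suc j) (base j i + k)) \<subseteq> ((T ^^ h j) -` floors j K \<inter> space M) \<inter> floors j K"
  proof
    fix x
    assume "x \<in> (\<Union>i\<in>{1..r j - 1}. \<Union>k\<in>K. Fl (Suc j) (base j i + k))"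
    then obtain i k where ik: "i \<in> {1..r j - 1}" "k \<in> K" "x \<in> Fl (Suc j) (base j i + k)"
      by auto
    have i: "i \<in> {1..r j}" "i < r j"
      using ik(1) r by auto
    have k: "k < h j"
      using ik(2) K by auto
    have "(T ^^ h j) x \<in> Fl j k"
      using j i by (intro column_shift_stay[OF j1 i _ k ik(3)]) (auto simp: flat_stage_def)
    moreover have "x \<in> Fl j k"
      using subfloor[OF j1 k i(1)] ik(3) by auto
    ultimately show "x \<in> ((T ^^ h j) -` floors j K \<inter> space M) \<inter> floors j K"
      using ik floor_in_sets[OF j1 k] sets.sets_into_space by (auto simp: floors_def)
  qed
  have I: "{1..r j - 1} \<subseteq> {1..r j}"
    by auto
  have Uf: "floors j K \<in> fmeasurable M"
    by (rule floors_fmeasurable[OF j1 K])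
  have "measure M (floors j K) - measure M (floors j K) / real (r j) = real (r j - 1) * real (card K) * w (Suc j)"
    using measure_floors[OF j1 K] length_step[OF j1] r by (simp add: of_nat_diff field_simps)
  also have "\<dots> = measure M (\<Union>i\<in>{1..r j - 1}. \<Union>k\<in>K. Fl (Suc j) (base j i + k))"
    using measure_subfloors[OF j1 I K] by simp
  also have "\<dots> \<le> measure M (((T ^^ h j) -` floors j K \<inter> space M) \<inter> floors j K)"
  proof (rule measure_mono_fmeasurable[OF sub])
    show "(\<Union>i\<in>{1..r j - 1}. \<Union>k\<in>K. Fl (Suc j) (base j i + k)) \<in> sets M"
      using finite_subset[OF K] K position_bound[OF j1]
      by (intro sets.finite_UN) (fastforce intro!: floor_in_sets)+
    show "((T ^^ h j) -` floors j K \<inter> space M) \<inter> floors j K \<in> fmeasurable M"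
      using Uf by (intro fmeasurable_Int_sets fmeasurable_vimage[OF inverse_pair_funpow[OF T_pair]]) auto
  qed
  finally show ?thesis .
qed

lemma vimage_sym_diff_measure:
  assumes "A \<in> fmeasurable M" "B \<in> fmeasurable M"
  shows "measure M (sym_diff ((T ^^ m) -` A \<inter> space M) ((T ^^ m) -` B \<inter> space M)) = measure M (sym_diff A B)"
proof -
  have "sym_diff A B \<in> sets M"
    using assms by auto
  then have "measure M ((T ^^ m) -` sym_diff A B \<inter> space M) = measure M (sym_diff A B)"
    unfolding measure_def by (simp only: measure_vimage_preserving[OF inverse_pair_funpow[OF T_pair]])
  moreover have "(T ^^ m) -` sym_diff A B \<inter> space M = sym_diff ((T ^^ m) -` A \<inter> space M) ((T ^^ m) -` B \<inter> space M)"
    by auto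
  ultimately show ?thesis
    by simp
qed

lemma cuts_tendsto: "filterlim \<phi> at_top sequentially \<Longrightarrow> (\<lambda>i. c / real (r (\<phi> i))) \<longlonglongrightarrow> 0"
  using filterlim_compose[OF filterlim_real_sequentially filterlim_compose[OF cuts_unbounded]]
  by (intro real_tendsto_divide_at_top[OF tendsto_const]) blast

text \<open>For unions of floors the previous lemma gives the limit; the error of approximating \<open>A\<close> and \<open>B\<close> by
  such unions is not increased by the measure-preserving powers of \<open>T\<close>.\<close>

lemma half_limit:
  assumes \<phi>: "filterlim \<phi> at_top sequentially" "\<And>i. half_stage (\<phi> i)"
    and A: "A \<in> fmeasurable M" and B: "B \<in> fmeasurable M"
  shows "(\<lambda>i. measure M (((T ^^ h (\<phi> i)) -` A \<inter> space M) \<inter> B)) \<longlonglongrightarrow> measure M (A \<inter> B) / 2"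
proof (rule tendstoI)
  fix e :: real
  assume e: "e > 0"
  define d where "d = min 1 (e / 8)"
  have d: "d > 0" "d \<le> 1" "d \<le> e / 8"
    using e by (auto simp: d_def)
  have "\<forall>\<^sub>F j in sequentially. (\<exists>K\<subseteq>{..<h j}. measure M (sym_diff A (floors j K)) < d) \<and> (\<exists>K\<subseteq>{..<h j}. measure M (sym_diff B (floors j K)) < d)"
    using floor_approximation_eventually[OF A d(1)] floor_approximation_eventually[OF B d(1)] by eventually_elim auto
  then have 1: "\<forall>\<^sub>F i in sequentially. (\<exists>K\<subseteq>{..<h (\<phi> i)}. measure M (sym_diff A (floors (\<phi> i) K)) < d) \<and> (\<exists>K\<subseteq>{..<h (\<phi> i)}. measure M (sym_diff B (floors (\<phi> i) K)) < d)"
    by (rule eventually_compose_filterlim[OF _ \<phi>(1)])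
  have 2: "\<forall>\<^sub>F i in sequentially. (measure M A + 1) / real (r (\<phi> i)) < e / 2"
    using e by (intro order_tendstoD(2)[OF cuts_tendsto[OF \<phi>(1)]]) auto
  from 1 2 show "\<forall>\<^sub>F i in sequentially. dist (measure M (((T ^^ h (\<phi> i)) -` A \<inter> space M) \<inter> B)) (measure M (A \<inter> B) / 2) < e"
  proof eventually_elim
    case (elim i)
    define j where "j = \<phi> i"
    have j: "half_stage j" "j \<ge> 1"
      using \<phi>(2)[of i] by (auto simp: j_def half_stage_def)
    obtain K L where KL: "K \<subseteq> {..<h j}" "measure M (sym_diff A (floors j K)) < d" "L \<subseteq> {..<h j}" "measure M (sym_diff B (floors j L)) < d"
      using elim(1) by (auto simp: j_def)
    have Uf: "floors j K \<in> fmeasurable M" "floors j L \<in> fmeasurable M"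
      using floors_fmeasurable[OF j(2)] KL by auto
    have r: "r j \<ge> 1"
      using cuts_pos[OF j(2)] .
    note pf = fmeasurable_vimage[OF inverse_pair_funpow[OF T_pair, of "h j"]]
    have a: "\<bar>measure M (((T ^^ h j) -` A \<inter> space M) \<inter> B) - measure M (((T ^^ h j) -` floors j K \<inter> space M) \<inter> floors j L)\<bar> \<le> 2 * d"
      using measure_Int_sym_diff[OF pf[OF A] B pf[OF Uf(1)] Uf(2)] KL(2,4) vimage_sym_diff_measure[OF A Uf(1), of "h j"] by linarith
    have b: "\<bar>measure M (A \<inter> B) - measure M (floors j K \<inter> floors j L)\<bar> \<le> 2 * d"
      using measure_Int_sym_diff[OF A B Uf] KL(2,4) by linarith
    define m where "m = measure M (floors j K \<inter> floors j L)"
    have "m \<le> measure M (floors j K)"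
      unfolding m_def using Uf by (intro measure_mono_fmeasurable) auto
    also have "\<dots> \<le> measure M A + 1"
      using measure_le_sym_diff[OF Uf(1) A] KL(2) d(2) by (simp add: Un_commute)
    finally have m: "0 \<le> m" "m \<le> measure M A + 1"
      by (auto simp: m_def)
    have q: "\<bar>real (r j div 2) / real (r j) - 1 / 2\<bar> \<le> 1 / real (r j)"
    proof -
      have "r j = 2 * (r j div 2) \<or> r j = 2 * (r j div 2) + 1"
        by presburger
      then have "real (r j) = 2 * real (r j div 2) \<or> real (r j) = 2 * real (r j div 2) + 1"
        by (metis of_nat_1 of_nat_add of_nat_mult of_nat_numeral)
      then show ?thesis
        using r by (auto simp: abs_if field_simps)
    qed
    have "real (r j div 2) / real (r j) * m - m / 2 = (real (r j div 2) / real (r j) - 1 / 2) * m"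
      by (simp add: left_diff_distrib)
    then have "\<bar>real (r j div 2) / real (r j) * m - m / 2\<bar> = \<bar>real (r j div 2) / real (r j) - 1 / 2\<bar> * m"
      using m(1) by (simp only: abs_mult abs_of_nonneg)
    also have "\<dots> \<le> 1 / real (r j) * (measure M A + 1)"
      using q m by (intro mult_mono) auto
    also have "\<dots> < e / 2"
      using elim(2) by (simp add: j_def)
    finally have "\<bar>measure M (((T ^^ h j) -` floors j K \<inter> space M) \<inter> floors j L) - m / 2\<bar> < e / 2"
      using half_step[OF j(1) KL(1,3)] by (simp add: m_def)
    then show ?case
      using a b d(3) unfolding dist_real_def j_def[symmetric] m_def by linarith
  qed
qed

lemma flat_limit:
  assumes \<phi>: "filterlim \<phi> at_top sequentially" "\<And>i. flat_stage (\<phi> i)"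
    and A: "A \<in> fmeasurable M"
  shows "(\<lambda>i. measure M (((T ^^ h (\<phi> i)) -` A \<inter> space M) \<inter> A)) \<longlonglongrightarrow> measure M A"
proof (rule tendstoI)
  fix e :: real
  assume e: "e > 0"
  define d where "d = min 1 (e / 8)"
  have d: "d > 0" "d \<le> 1" "d \<le> e / 8"
    using e by (auto simp: d_def)
  have 1: "\<forall>\<^sub>F i in sequentially. (\<exists>K\<subseteq>{..<h (\<phi> i)}. measure M (sym_diff A (floors (\<phi> i) K)) < d)"
    using eventually_compose_filterlim[OF floor_approximation_eventually[OF A d(1)] \<phi>(1)] by eventually_elim auto
  have 2: "\<forall>\<^sub>F i in sequentially. (measure M A + 1) / real (r (\<phi> i)) < e / 2"
    using e by (intro order_tendstoD(2)[OF cuts_tendsto[OF \<phi>(1)]]) auto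
  from 1 2 show "\<forall>\<^sub>F i in sequentially. dist (measure M (((T ^^ h (\<phi> i)) -` A \<inter> space M) \<inter> A)) (measure M A) < e"
  proof eventually_elim
    case (elim i)
    define j where "j = \<phi> i"
    have j: "flat_stage j" "j \<ge> 1"
      using \<phi>(2)[of i] by (auto simp: j_def flat_stage_def)
    obtain K where K: "K \<subseteq> {..<h j}" "measure M (sym_diff A (floors j K)) < d"
      using elim(1) by (auto simp: j_def)
    have Uf: "floors j K \<in> fmeasurable M"
      using floors_fmeasurable[OF j(2)] K by auto
    note pf = fmeasurable_vimage[OF inverse_pair_funpow[OF T_pair, of "h j"]]
    have a: "\<bar>measure M (((T ^^ h j) -` A \<inter> space M) \<inter> A) - measure M (((T ^^ h j) -` floors j K \<inter> space M) \<inter> floors j K)\<bar> \<le> 2 * d"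
      using measure_Int_sym_diff[OF pf[OF A] A pf[OF Uf(1)] Uf(1)] K(2) vimage_sym_diff_measure[OF A Uf(1), of "h j"] by linarith
    have b: "measure M A \<le> measure M (floors j K) + d" "measure M (floors j K) \<le> measure M A + 1"
      using measure_le_sym_diff[OF A Uf] measure_le_sym_diff[OF Uf A] K(2) d(2) by (auto simp: Un_commute)
    have "measure M (floors j K) / real (r j) \<le> (measure M A + 1) / real (r j)"
      using b by (intro divide_right_mono) auto
    then have c: "measure M (floors j K) / real (r j) < e / 2"
      using elim(2) unfolding j_def by linarith
    have "measure M (((T ^^ h j) -` A \<inter> space M) \<inter> A) \<le> measure M A"
      using A pf[OF A] by (intro measure_mono_fmeasurable) auto
    then show ?case
      using a b c d(3) flat_step[OF j(1) K(1)] unfolding dist_real_def j_def[symmetric] by linarith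
  qed
qed

end

section \<open>Expansion of the first chaos along floors\<close>

locale rank_one_poisson = rank_one h\<^sub>1 r s h w a T + poisson_process "rank_one_space h w a" P
  for h\<^sub>1 r s h w a T P
begin

text \<open>Finite additivity of the number of points.\<close>

lemma AE_compensated_floors:
  assumes j: "j \<ge> 1" and K: "K \<subseteq> {..<h j}"
  shows "AE \<omega> in P. compensated M (floors j K) \<omega> = (\<Sum>k\<in>K. compensated M (Fl j k) \<omega>)"
proof -
  have "finite K"
    using finite_subset[OF K] by simp
  then show ?thesis
    using K
  proof (induction K rule: finite_induct)
    case empty
    then show ?case
      by (simp add: floors_def compensated_def points_in_def)
  next
    case (insert k K)
    have u: "floors j (insert k K) = Fl j k \<union> floors j K" "Fl j k = floors j {k}"
      by (auto simp: floors_def)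
    have "Fl j k \<inter> floors j K = {}"
      using floors_Int[OF j, of "{k}" K] insert unfolding u(2) by (auto simp: floors_def)
    then have "AE \<omega> in P. compensated M (Fl j k \<union> floors j K) \<omega> = compensated M (Fl j k) \<omega> + compensated M (floors j K) \<omega>"
      using insert by (intro AE_compensated_Un floor_fmeasurable floors_fmeasurable j) auto
    moreover have "AE \<omega> in P. compensated M (floors j K) \<omega> = (\<Sum>k\<in>K. compensated M (Fl j k) \<omega>)"
      using insert by auto
    ultimately show ?case
      unfolding u(1) by eventually_elim (use insert in simp)
  qed
qed

text \<open>Replacing \<open>B\<close> by a union of floors changes \<open>N\<^sub>B - \<mu>(B)\<close> by the square root of the measure of the
  symmetric difference in norm.\<close>

lemma floor_combination:
  assumes "H \<in> lspan (compensated M ` fmeasurable M)" "e > 0"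
  shows "\<forall>\<^sub>F j in sequentially. j \<ge> 1 \<and> (\<exists>c. norm2 P (\<lambda>\<omega>. H \<omega> - (\<Sum>k<h j. c k * compensated M (Fl j k) \<omega>)) < e)"
  using assms
proof (induction arbitrary: e rule: lspan.induct)
  case zero
  show ?case
    using eventually_ge_at_top[of 1]
    by eventually_elim (use zero in \<open>auto intro!: exI[of _ "\<lambda>_. 0"] simp: norm2_def\<close>)
next
  case (step f g c e)
  then obtain B where B: "B \<in> fmeasurable M" "f = compensated M B"
    by auto
  have W: "compensated M ` fmeasurable M \<subseteq> L2 P"
    by (auto simp: compensated_L2)
  have fL: "f \<in> L2 P" and gL: "g \<in> L2 P"
    using B lspan_L2[OF W step(2)] by (auto simp: compensated_L2)
  define d where "d = e / 2 / (\<bar>c\<bar> + 1)"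
  have d: "d > 0" "\<bar>c\<bar> * d < e / 2"
  proof -
    show "d > 0"
      using step(4) by (simp add: d_def)
    have "\<bar>c\<bar> * d < (\<bar>c\<bar> + 1) * d"
      using \<open>d > 0\<close> by (intro mult_strict_right_mono) auto
    also have "\<dots> = e / 2"
      unfolding d_def by (rule nonzero_mult_div_cancel_left[THEN trans[OF times_divide_eq_right]]) linarith
    finally show "\<bar>c\<bar> * d < e / 2" .
  qed
  have "d\<^sup>2 > 0" "e / 2 > 0"
    using d(1) step(4) by auto
  from floor_approximation_eventually[OF B(1) this(1)] step.IH[OF this(2)] show ?case
  proof eventually_elim
    case (elim j)
    then obtain K b where K: "K \<subseteq> {..<h j}" "measure M (sym_diff B (floors j K)) < d\<^sup>2" and j: "j \<ge> 1"
      and b: "norm2 P (\<lambda>\<omega>. g \<omega> - (\<Sum>k<h j. b k * compensated M (Fl j k) \<omega>)) < e / 2"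
      by auto
    have Uf: "floors j K \<in> fmeasurable M"
      by (rule floors_fmeasurable[OF j K(1)])
    have FL: "compensated M (Fl j k) \<in> L2 P" if "k < h j" for k
      using floor_fmeasurable[OF j that] by (rule compensated_L2)
    define F where "F \<omega> = (\<Sum>k\<in>K. compensated M (Fl j k) \<omega>)" for \<omega>
    have FL': "F \<in> L2 P"
      unfolding F_def[abs_def] using K(1) FL by (intro L2_sum) auto
    have sL: "(\<lambda>\<omega>. \<Sum>k<h j. b k * compensated M (Fl j k) \<omega>) \<in> L2 P"
      using FL by (intro L2_sum L2_cmult) auto
    have "(norm2 P (\<lambda>\<omega>. f \<omega> - F \<omega>))\<^sup>2 = (norm2 P (\<lambda>\<omega>. compensated M B \<omega> - compensated M (floors j K) \<omega>))\<^sup>2"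
    proof (intro arg_cong[where f="\<lambda>x. x\<^sup>2"] norm2_cong_AE borel_measurable_diff L2_measurable[OF fL] L2_measurable[OF FL'])
      show "AE \<omega> in P. f \<omega> - F \<omega> = compensated M B \<omega> - compensated M (floors j K) \<omega>"
        using AE_compensated_floors[OF j K(1)] by eventually_elim (simp add: F_def B(2))
    qed (use B Uf in auto)
    also have "\<dots> = measure M B + measure M (floors j K) - 2 * measure M (B \<inter> floors j K)"
    proof -
      note L = compensated_L2[OF B(1)] compensated_L2[OF Uf]
      have "(norm2 P (\<lambda>\<omega>. compensated M B \<omega> - compensated M (floors j K) \<omega>))\<^sup>2 = (\<integral>\<omega>. compensated M B \<omega> * compensated M B \<omega>
          + compensated M (floors j K) \<omega> * compensated M (floors j K) \<omega> - 2 * (compensated M B \<omega> * compensated M (floors j K) \<omega>) \<partial>P)"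
        unfolding norm2_square by (intro Bochner_Integration.integral_cong) (auto simp: power2_eq_square algebra_simps)
      also have "\<dots> = measure M B + measure M (floors j K) - 2 * measure M (B \<inter> floors j K)"
        using L2_mult[OF L(1) L(1)] L2_mult[OF L(2) L(2)] L2_mult[OF L(1) L(2)]
        by (simp add: integral_compensated_mult B(1) Uf)
      finally show ?thesis .
    qed
    also have "\<dots> = measure M (sym_diff B (floors j K))"
    proof -
      have "(B - floors j K) \<inter> (floors j K - B) = {}"
        by auto
      then show ?thesis
        using measure_Un3[of "B - floors j K" M "floors j K - B"] measure_Diff_Int[OF B(1), of "floors j K"] measure_Diff_Int[OF Uf, of B] B(1) Uf
        by (simp add: Int_commute fmeasurable.Diff fmeasurableD)
    qed
    also have "\<dots> < d\<^sup>2"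
      by (rule K(2))
    finally have "norm2 P (\<lambda>\<omega>. f \<omega> - F \<omega>) < d"
      using d(1) power_less_imp_less_base[of _ 2 d] by auto
    then have "\<bar>c\<bar> * norm2 P (\<lambda>\<omega>. f \<omega> - F \<omega>) \<le> \<bar>c\<bar> * d"
      by (intro mult_left_mono) auto
    then have 1: "norm2 P (\<lambda>\<omega>. c * (f \<omega> - F \<omega>)) < e / 2"
      unfolding norm2_cmult using d(2) by linarith
    define c' where "c' k = c * (if k \<in> K then 1 else 0) + b k" for k
    have "(\<Sum>k<h j. c' k * compensated M (Fl j k) \<omega>) = c * F \<omega> + (\<Sum>k<h j. b k * compensated M (Fl j k) \<omega>)" for \<omega>
    proof -
      have "F \<omega> = (\<Sum>k<h j. if k \<in> K then compensated M (Fl j k) \<omega> else 0)"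
        unfolding F_def using K(1) by (subst sum.inter_restrict[symmetric]) (auto simp: Int_absorb1)
      then show ?thesis
        by (auto simp: c'_def distrib_right sum.distrib sum_distrib_left intro!: sum.cong)
    qed
    then have "norm2 P (\<lambda>\<omega>. c * f \<omega> + g \<omega> - (\<Sum>k<h j. c' k * compensated M (Fl j k) \<omega>)) =
        norm2 P (\<lambda>\<omega>. c * (f \<omega> - F \<omega>) + (g \<omega> - (\<Sum>k<h j. b k * compensated M (Fl j k) \<omega>)))"
      by (simp add: algebra_simps)
    also have "\<dots> \<le> norm2 P (\<lambda>\<omega>. c * (f \<omega> - F \<omega>)) + norm2 P (\<lambda>\<omega>. g \<omega> - (\<Sum>k<h j. b k * compensated M (Fl j k) \<omega>))"
      by (intro norm2_triangle L2_cmult L2_diff fL FL' gL sL)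
    also have "\<dots> < e"
      using 1 b by linarith
    finally show ?case
      using j by auto
  qed
qed

text \<open>For a fixed stage the functions \<open>N\<^sub>D - \<mu>(D)\<close> of the floors \<open>D\<close> are orthogonal with square norm
  \<open>w\<^sub>j\<close>, and the sum is the scalar product of \<open>G\<close> with the projection of \<open>F\<close> to their span. The
  projection is the best approximation, so it converges to \<open>F\<close>.\<close>

lemma parseval:
  assumes F: "F \<in> L2_closure P (compensated M ` fmeasurable M)" and G: "G \<in> L2 P"
  shows "(\<lambda>j. \<Sum>k<h j. (\<integral>\<omega>. F \<omega> * compensated M (Fl j k) \<omega> \<partial>P) * (\<integral>\<omega>. compensated M (Fl j k) \<omega> * G \<omega> \<partial>P) / w j)
    \<longlonglongrightarrow> (\<integral>\<omega>. F \<omega> * G \<omega> \<partial>P)"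
proof (rule tendstoI)
  fix e :: real
  assume e: "e > 0"
  have W: "compensated M ` fmeasurable M \<subseteq> L2 P"
    by (auto simp: compensated_L2)
  have FL: "F \<in> L2 P"
    using F by (rule L2_closure_L2)
  define d where "d = e / 2 / (norm2 P G + 1)"
  have nG: "norm2 P G + 1 > 0"
    using norm2_nonneg[of P G] by linarith
  have d: "d > 0"
    using e nG by (simp add: d_def)
  obtain H where H: "H \<in> lspan (compensated M ` fmeasurable M)" "norm2 P (\<lambda>\<omega>. F \<omega> - H \<omega>) < d"
    using L2_closureD[OF F d] by auto
  have HL: "H \<in> L2 P"
    using lspan_L2[OF W H(1)] .
  from floor_combination[OF H(1) d] show "\<forall>\<^sub>F j in sequentially. dist (\<Sum>k<h j. (\<integral>\<omega>. F \<omega> * compensated M (Fl j k) \<omega> \<partial>P) *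
      (\<integral>\<omega>. compensated M (Fl j k) \<omega> * G \<omega> \<partial>P) / w j) (\<integral>\<omega>. F \<omega> * G \<omega> \<partial>P) < e"
  proof eventually_elim
    case (elim j)
    then obtain c where j: "j \<ge> 1" and c: "norm2 P (\<lambda>\<omega>. H \<omega> - (\<Sum>k<h j. c k * compensated M (Fl j k) \<omega>)) < d"
      by auto
    let ?f = "\<lambda>k. compensated M (Fl j k)"
    have fL: "?f k \<in> L2 P" if "k < h j" for k
      using floor_fmeasurable[OF j that] by (rule compensated_L2)
    have lin: "(\<lambda>\<omega>. \<Sum>k<h j. b k * ?f k \<omega>) \<in> L2 P" for b
      using fL by (intro L2_sum L2_cmult) auto
    have int_lin: "(\<integral>\<omega>. (\<Sum>k<h j. b k * ?f k \<omega>) * K \<omega> \<partial>P) = (\<Sum>k<h j. b k * (\<integral>\<omega>. ?f k \<omega> * K \<omega> \<partial>P))" if "K \<in> L2 P" for b K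
    proof -
      have "(\<integral>\<omega>. (\<Sum>k<h j. b k * ?f k \<omega>) * K \<omega> \<partial>P) = (\<integral>\<omega>. (\<Sum>k<h j. b k * (?f k \<omega> * K \<omega>)) \<partial>P)"
        by (simp add: sum_distrib_right mult.assoc)
      also have "\<dots> = (\<Sum>k<h j. \<integral>\<omega>. b k * (?f k \<omega> * K \<omega>) \<partial>P)"
        using L2_mult[OF fL that] by (intro Bochner_Integration.integral_sum) auto
      finally show ?thesis
        by simp
    qed
    have orth: "(\<integral>\<omega>. ?f k \<omega> * ?f l \<omega> \<partial>P) = (if k = l then w j else 0)" if "k < h j" "l < h j" for k l
      using integral_compensated_mult[OF floor_fmeasurable[OF j that(1)] floor_fmeasurable[OF j that(2)]]
        measure_floor[OF j that(1)] floors_disjoint[OF j] that by (auto simp: disjoint_family_on_def)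
    have w: "w j > 0"
      using length_pos[OF j] .
    define b where "b k = (\<integral>\<omega>. F \<omega> * ?f k \<omega> \<partial>P) / w j" for k
    define Q where "Q \<omega> = (\<Sum>k<h j. b k * ?f k \<omega>)" for \<omega>
    have QL: "Q \<in> L2 P"
      unfolding Q_def[abs_def] by (rule lin)
    have FQ: "(\<integral>\<omega>. (F \<omega> - Q \<omega>) * ?f l \<omega> \<partial>P) = 0" if l: "l < h j" for l
    proof -
      have "(\<integral>\<omega>. Q \<omega> * ?f l \<omega> \<partial>P) = (\<Sum>k<h j. b k * (if k = l then w j else 0))"
        unfolding Q_def int_lin[OF fL[OF l]] using l orth by (intro sum.cong) auto
      also have "\<dots> = (\<integral>\<omega>. F \<omega> * ?f l \<omega> \<partial>P)"
        using l w by (simp add: b_def if_distrib cong: if_cong)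
      finally show ?thesis
        using L2_mult[OF FL fL[OF l]] L2_mult[OF QL fL[OF l]] by (simp add: left_diff_distrib)
    qed
    define D where "D \<omega> = (\<Sum>k<h j. (b k - c k) * ?f k \<omega>)" for \<omega>
    have DL: "D \<in> L2 P"
      unfolding D_def[abs_def] by (rule lin)
    have QD: "Q \<omega> - D \<omega> = (\<Sum>k<h j. c k * ?f k \<omega>)" for \<omega>
      by (simp add: Q_def D_def sum_subtractf[symmetric] algebra_simps)
    have "(\<integral>\<omega>. (F \<omega> - Q \<omega>) * D \<omega> \<partial>P) = (\<integral>\<omega>. D \<omega> * (F \<omega> - Q \<omega>) \<partial>P)"
      by (simp add: mult.commute)
    also have "\<dots> = (\<Sum>k<h j. (b k - c k) * (\<integral>\<omega>. ?f k \<omega> * (F \<omega> - Q \<omega>) \<partial>P))"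
      unfolding D_def by (rule int_lin[OF L2_diff[OF FL QL]])
    also have "\<dots> = 0"
      using FQ by (intro sum.neutral) (simp add: mult.commute)
    finally have "norm2 P (\<lambda>\<omega>. F \<omega> - Q \<omega>) \<le> norm2 P (\<lambda>\<omega>. (F \<omega> - Q \<omega>) + D \<omega>)"
      by (intro norm2_le_orthogonal L2_diff FL QL DL)
    also have "\<dots> = norm2 P (\<lambda>\<omega>. F \<omega> - (\<Sum>k<h j. c k * ?f k \<omega>))"
      by (simp add: QD[symmetric] algebra_simps)
    also have "\<dots> < 2 * d"
      using norm2_triangle_diff[OF FL HL lin[of c]] H(2) c by linarith
    finally have small: "norm2 P (\<lambda>\<omega>. F \<omega> - Q \<omega>) < 2 * d" .
    have "(\<Sum>k<h j. (\<integral>\<omega>. F \<omega> * ?f k \<omega> \<partial>P) * (\<integral>\<omega>. ?f k \<omega> * G \<omega> \<partial>P) / w j) = (\<integral>\<omega>. Q \<omega> * G \<omega> \<partial>P)"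
      unfolding Q_def int_lin[OF G] by (simp add: b_def)
    then have "dist (\<Sum>k<h j. (\<integral>\<omega>. F \<omega> * ?f k \<omega> \<partial>P) * (\<integral>\<omega>. ?f k \<omega> * G \<omega> \<partial>P) / w j) (\<integral>\<omega>. F \<omega> * G \<omega> \<partial>P)
        = \<bar>\<integral>\<omega>. (F \<omega> - Q \<omega>) * G \<omega> \<partial>P\<bar>"
      using L2_mult[OF FL G] L2_mult[OF QL G] by (simp add: left_diff_distrib dist_real_def abs_minus_commute)
    also have "\<dots> \<le> norm2 P (\<lambda>\<omega>. F \<omega> - Q \<omega>) * norm2 P G"
      by (rule Cauchy_Schwarz_L2[OF L2_diff[OF FL QL] G])
    also have "\<dots> \<le> norm2 P (\<lambda>\<omega>. F \<omega> - Q \<omega>) * (norm2 P G + 1)"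
      by (intro mult_left_mono) auto
    also have "\<dots> < 2 * d * (norm2 P G + 1)"
      using small nG by (intro mult_strict_right_mono) auto
    also have "\<dots> = e"
    proof -
      have "d * (norm2 P G + 1) = e / 2"
        using nG nonzero_eq_divide_eq[of "norm2 P G + 1" d "e / 2"] d_def by linarith
      then show ?thesis
        by linarith
    qed
    finally show ?case .
  qed
qed

lemma corr_floors_left:
  assumes R: "inverse_pair P R R'" and j: "j \<ge> 1" and K: "K \<subseteq> {..<h j}" and B: "B \<in> fmeasurable M"
  shows "corr R (floors j K) B = (\<Sum>k\<in>K. corr R (Fl j k) B)"
proof -
  have [measurable]: "R \<in> measurable P P" "B \<in> sets M" "floors j K \<in> sets M"
    using R B floors_fmeasurable[OF j K] by (auto simp: inverse_pair_def)
  have [measurable]: "Fl j k \<in> sets M" if "k \<in> K" for k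
    using floor_in_sets[OF j, of k] K that by auto
  have L: "(\<lambda>\<omega>. compensated M (Fl j k) (R \<omega>)) \<in> L2 P" if "k \<in> K" for k
    using K that by (intro L2_preserving(1)[OF R] compensated_L2 floor_fmeasurable[OF j]) auto
  have "AE \<omega> in P. compensated M (floors j K) (R \<omega>) = (\<Sum>k\<in>K. compensated M (Fl j k) (R \<omega>))"
    using R by (intro AE_preserving[OF _ _ AE_compensated_floors[OF j K]]) (auto simp: inverse_pair_def)
  then have "corr R (floors j K) B = (\<integral>\<omega>. (\<Sum>k\<in>K. compensated M (Fl j k) (R \<omega>) * compensated M B \<omega>) \<partial>P)"
    unfolding corr_def by (intro integral_cong_AE) (auto simp: sum_distrib_right)
  also have "\<dots> = (\<Sum>k\<in>K. corr R (Fl j k) B)"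
    unfolding corr_def using L2_mult[OF L compensated_L2[OF B]] by (intro Bochner_Integration.integral_sum) auto
  finally show ?thesis .
qed

lemma corr_floors_right:
  assumes R: "inverse_pair P R R'" and j: "j \<ge> 1" and K: "K \<subseteq> {..<h j}" and A: "A \<in> fmeasurable M"
  shows "corr R A (floors j K) = (\<Sum>k\<in>K. corr R A (Fl j k))"
proof -
  have [measurable]: "R \<in> measurable P P" "A \<in> sets M" "floors j K \<in> sets M"
    using R A floors_fmeasurable[OF j K] by (auto simp: inverse_pair_def)
  have [measurable]: "Fl j k \<in> sets M" if "k \<in> K" for k
    using floor_in_sets[OF j, of k] K that by auto
  have L: "compensated M (Fl j k) \<in> L2 P" if "k \<in> K" for k
    using K that by (intro compensated_L2 floor_fmeasurable[OF j]) auto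
  have "corr R A (floors j K) = (\<integral>\<omega>. (\<Sum>k\<in>K. compensated M A (R \<omega>) * compensated M (Fl j k) \<omega>) \<partial>P)"
    unfolding corr_def using AE_compensated_floors[OF j K] by (intro integral_cong_AE) (auto simp: sum_distrib_left)
  also have "\<dots> = (\<Sum>k\<in>K. corr R A (Fl j k))"
    unfolding corr_def using L2_mult[OF L2_preserving(1)[OF R compensated_L2[OF A]] L]
    by (intro Bochner_Integration.integral_sum) auto
  finally show ?thesis .
qed

end

section \<open>Residue classes of floors\<close>

text \<open>The divisibility makes the positions of the columns multiples of \<open>m\<close>, so a floor is only cut into
  floors of its own residue class.\<close>

locale periodic_rank_one = rank_one +
  fixes j\<^sub>0 m :: nat
  assumes j0: "j\<^sub>0 \<ge> 1" and m: "m \<ge> 2"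
    and height_dvd: "\<And>j. j \<ge> j\<^sub>0 \<Longrightarrow> m dvd h j"
    and spacer_dvd: "\<And>j i. j \<ge> j\<^sub>0 \<Longrightarrow> i \<in> {1..r j} \<Longrightarrow> m dvd s j i"
begin

lemma base_dvd: "j \<ge> j\<^sub>0 \<Longrightarrow> i \<le> Suc (r j) \<Longrightarrow> m dvd base j i"
  unfolding column_base_def by (intro dvd_sum dvd_add height_dvd spacer_dvd) auto

lemma class_refine:
  assumes i: "j\<^sub>0 \<le> i" "k < h i" and j: "i \<le> j"
  shows "\<exists>K\<subseteq>{..<h j}. Fl i k = floors j K \<and> (\<forall>p\<in>K. p mod m = k mod m)"
  using j
proof (induction j rule: dec_induct)
  case base
  show ?case
    using i by (intro exI[of _ "{k}"]) (auto simp: floors_def)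
next
  case (step j)
  then obtain K where K: "K \<subseteq> {..<h j}" "Fl i k = floors j K" "\<And>p. p \<in> K \<Longrightarrow> p mod m = k mod m"
    by auto
  have j1: "j \<ge> 1" "j \<ge> j\<^sub>0"
    using j0 i step by auto
  let ?K = "(\<lambda>(c, p). base j c + p) ` ({1..r j} \<times> K)"
  have "?K \<subseteq> {..<h (Suc j)}"
    using K(1) position_bound[OF j1(1)] by fastforce
  moreover have "Fl i k = floors (Suc j) ?K"
  proof -
    have "Fl i k = (\<Union>p\<in>K. \<Union>c\<in>{1..r j}. Fl (Suc j) (base j c + p))"
      unfolding K(2) floors_def using K(1) floor_refine[OF j1(1)] by (intro SUP_cong refl) auto
    then show ?thesis
      unfolding floors_def by auto
  qed
  moreover have "\<forall>q\<in>?K. q mod m = k mod m"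
  proof
    fix q
    assume "q \<in> ?K"
    then obtain c p where cp: "c \<in> {1..r j}" "p \<in> K" "q = base j c + p"
      by auto
    then have "m dvd base j c"
      by (intro base_dvd j1) auto
    then show "q mod m = k mod m"
      using K(3)[OF cp(2)] cp(3) by (auto elim!: dvdE)
  qed
  ultimately show ?case
    by blast
qed

lemma class_unique:
  assumes "j\<^sub>0 \<le> i" "k < h i" "i \<le> j" "p < h j" "x \<in> Fl i k" "x \<in> Fl j p"
  shows "p mod m = k mod m"
proof -
  obtain K where K: "K \<subseteq> {..<h j}" "Fl i k = floors j K" "\<And>p. p \<in> K \<Longrightarrow> p mod m = k mod m"
    using class_refine[OF assms(1-3)] by auto
  then obtain q where q: "q \<in> K" "x \<in> Fl j q"
    using assms(5) by (auto simp: floors_def)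
  have "q = p"
    using floor_unique[of j q p x] q K(1) assms j0 by auto
  then show ?thesis
    using K(3) q by auto
qed

text \<open>A point of a floor \<open>k\<close> that is not within \<open>t\<close> floors of the top is moved to the class of \<open>k + t\<close>.
  The exceptional points have measure at most \<open>t w\<^sub>j\<close> at stage \<open>j\<close>, which tends to zero.\<close>

lemma classes_never_meet:
  assumes i: "j\<^sub>0 \<le> i" "k < h i" and i': "j\<^sub>0 \<le> i'" "k' < h i'" and c: "(k + t) mod m \<noteq> k' mod m"
  shows "measure M (Fl i k \<inter> ((T ^^ t) -` Fl i' k' \<inter> space M)) = 0"
proof -
  let ?A = "Fl i k \<inter> ((T ^^ t) -` Fl i' k' \<inter> space M)"
  have bound: "measure M ?A \<le> real t * w j" if j: "j \<ge> max i i'" for j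
  proof -
    have j1: "j \<ge> 1"
      using j j0 i by auto
    let ?K = "{p. p < h j \<and> h j \<le> p + t}"
    have sub: "?A \<subseteq> floors j ?K"
    proof
      fix x
      assume x: "x \<in> ?A"
      obtain K where K: "K \<subseteq> {..<h j}" "Fl i k = floors j K" "\<And>p. p \<in> K \<Longrightarrow> p mod m = k mod m"
        using class_refine[OF i, of j] j by auto
      then obtain p where p: "p \<in> K" "x \<in> Fl j p"
        using x by (auto simp: floors_def)
      have "h j \<le> p + t"
      proof (rule ccontr)
        assume "\<not> h j \<le> p + t"
        then have lt: "p + t < h j"
          by simp
        then have "(T ^^ t) x \<in> Fl j (p + t)"
          using iterate_translation(2)[OF j1 p(2)] by auto
        then have "(p + t) mod m = k' mod m"
          using class_unique[OF i' _ lt, of "(T ^^ t) x"] x j by auto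
        then show False
          using c K(3)[OF p(1)] by (metis mod_add_left_eq)
      qed
      then show "x \<in> floors j ?K"
        using p K(1) by (auto simp: floors_def)
    qed
    have KK: "?K \<subseteq> {..<h j}"
      by auto
    have "card ?K \<le> card {h j - t..<h j}"
      by (intro card_mono) auto
    then have card: "card ?K \<le> t"
      by simp
    have "?A \<in> sets M"
      using i i' j0 by (intro sets.Int measurable_sets[OF T_iterate_measurable] floor_in_sets) auto
    then have "measure M ?A \<le> measure M (floors j ?K)"
      by (intro measure_mono_fmeasurable[OF sub] floors_fmeasurable[OF j1 KK])
    also have "\<dots> \<le> real t * w j"
      unfolding measure_floors[OF j1 KK] using card length_pos[OF j1] by (intro mult_right_mono) auto
    finally show ?thesis .
  qed
  have "(\<lambda>j. real t * w j) \<longlonglongrightarrow> real t * 0"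
    by (intro tendsto_intros length_tendsto_0)
  then have "measure M ?A \<le> real t * 0"
    by (rule LIMSEQ_le_const) (use bound in blast)
  then show ?thesis
    by (simp add: measure_le_0_iff)
qed

end

section \<open>A root would shift residue classes\<close>

locale rank_one_centralizer = periodic_rank_one h\<^sub>1 r s h w a T j\<^sub>0 m + rank_one_poisson h\<^sub>1 r s h w a T P +
    suspension_centralizer "rank_one_space h w a" P T T' n R R'
  for h\<^sub>1 r s h w a T j\<^sub>0 m P T' n R R'
begin

text \<open>The lower bound of the density is transported by the power of \<open>T\<close>. The set \<open>D\<close> itself need not be
  a preimage, but it agrees with the preimage of its image up to a null set.\<close>

lemma corr_lower_shift:
  assumes A: "A \<in> fmeasurable M" and E: "E \<in> sets M" "\<And>C. C \<in> sets M \<Longrightarrow> C \<subseteq> E \<Longrightarrow> e * measure M C \<le> corr R A C"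
    and D: "D \<in> fmeasurable M"
  shows "e * measure M (D \<inter> ((T ^^ t) -` E \<inter> space M)) \<le> corr R ((T ^^ t) -` A \<inter> space M) D"
proof -
  note Tt = inverse_pair_funpow[OF T, of t]
  have [measurable]: "T ^^ t \<in> measurable M M" "T' ^^ t \<in> measurable M M"
    using Tt by (auto simp: inverse_pair_def)
  have [measurable]: "D \<in> sets M" "E \<in> sets M"
    using D E by auto
  define C where "C = (T' ^^ t) -` D \<inter> space M"
  have C: "C \<in> fmeasurable M"
    unfolding C_def by (rule fmeasurable_vimage[OF inverse_pair_sym[OF Tt] D])
  define D' where "D' = (T ^^ t) -` C \<inter> space M"
  have D': "D' \<in> fmeasurable M"
    unfolding D'_def by (rule fmeasurable_vimage[OF Tt C])
  have "emeasure M (sym_diff D D') = emeasure M {}"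
  proof (rule emeasure_eq_AE)
    show "AE x in M. x \<in> sym_diff D D' \<longleftrightarrow> x \<in> {}"
      using inverse_pair_AE[OF Tt] AE_space
    proof eventually_elim
      case (elim x)
      have "(T ^^ t) x \<in> space M"
        using elim(2) measurable_space[of "T ^^ t" M M] by auto
      then show ?case
        using elim by (auto simp: D'_def C_def)
    qed
  qed (use D D' in auto)
  then have 0: "measure M (sym_diff D D') = 0"
    by (simp add: measure_def)
  have "e * measure M (D \<inter> ((T ^^ t) -` E \<inter> space M)) = e * measure M (C \<inter> E)"
    unfolding C_def using measure_vimage_adjoint[OF Tt, of D E] by simp
  also have "\<dots> \<le> corr R A (C \<inter> E)"
    using C E by auto
  also have "\<dots> \<le> corr R A C"
    using C E by (intro corr_mono_right[OF A]) auto
  also have "\<dots> = corr R ((T ^^ t) -` A \<inter> space M) D'"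
    unfolding D'_def by (rule corr_vimage[OF A C, symmetric])
  also have "\<dots> = corr R ((T ^^ t) -` A \<inter> space M) D"
    using fmeasurable_vimage[OF Tt A] 0 by (intro corr_cong_right[symmetric] D D') auto
  finally show ?thesis .
qed

text \<open>Suppose that the class of the image changes by different amounts. Shifting \<open>A' = Fl i2 k2\<close> by a
  power of \<open>T\<close> that moves the floor \<open>p\<close> to the floor \<open>q\<close> makes the two densities positive on a
  common set \<open>E3\<close> inside the floor \<open>p\<close>. The shifted set and \<open>A = Fl i k\<close> are in different classes,
  so they are disjoint and the covariance of their images under \<open>R\<close> is zero. But by the Parseval
  formula this covariance is at least a multiple of \<open>\<mu>(E3)\<^sup>2\<close>.\<close>

lemma dense_pair_classes:
  assumes i: "j\<^sub>0 \<le> i" "k < h i" "k' < h i" and i2: "j\<^sub>0 \<le> i2" "k2 < h i2" "k2' < h i2"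
    and E: "E \<in> sets M" "E \<subseteq> Fl i k'" "e > 0" "\<And>C. C \<in> sets M \<Longrightarrow> C \<subseteq> E \<Longrightarrow> e * measure M C \<le> corr R (Fl i k) C"
    and E2: "E2 \<in> sets M" "E2 \<subseteq> Fl i2 k2'" "e2 > 0" "\<And>C. C \<in> sets M \<Longrightarrow> C \<subseteq> E2 \<Longrightarrow> e2 * measure M C \<le> corr R (Fl i2 k2) C"
    and j: "i \<le> j" "i2 \<le> j" and pq: "p \<le> q" "q < h j"
    and d: "measure M (E \<inter> Fl j p) > 9 / 10 * w j" "measure M (E2 \<inter> Fl j q) > 9 / 10 * w j"
  shows "(k' + k2) mod m = (k2' + k) mod m"
proof (rule ccontr)
  assume neq: "(k' + k2) mod m \<noteq> (k2' + k) mod m"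
  have j1: "j \<ge> 1"
    using j j0 i by auto
  have wj: "w j > 0"
    using length_pos[OF j1] .
  define t where "t = q - p"
  have q: "p + t = q"
    using pq by (simp add: t_def)
  have "E \<inter> Fl j p \<noteq> {}" "E2 \<inter> Fl j q \<noteq> {}"
    using d wj by auto
  then have cp: "p mod m = k' mod m" and cq: "q mod m = k2' mod m"
    using class_unique[OF i(1,3) j(1), of p] class_unique[OF i2(1,3) j(2), of q] E(2) E2(2) pq by auto
  have "(k + t) mod m \<noteq> k2 mod m"
  proof
    assume "(k + t) mod m = k2 mod m"
    then have "(k + t + p) mod m = (k2 + p) mod m"
      by (metis mod_add_left_eq)
    then have "(k + q) mod m = (k2 + p) mod m"
      using q by (simp add: add_ac)
    then have "(k + k2') mod m = (k2 + k') mod m"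
      using cp cq by (metis mod_add_right_eq)
    then show False
      using neq by (simp add: add.commute)
  qed
  then have meet: "measure M (Fl i k \<inter> ((T ^^ t) -` Fl i2 k2 \<inter> space M)) = 0"
    by (rule classes_never_meet[OF i(1,2) i2(1,2)])
  note Tt = inverse_pair_funpow[OF T, of t]
  define A where "A = Fl i k"
  define A2 where "A2 = (T ^^ t) -` Fl i2 k2 \<inter> space M"
  have Af: "A \<in> fmeasurable M" "Fl i2 k2 \<in> fmeasurable M"
    using i i2 j0 by (auto simp: A_def intro!: floor_fmeasurable)
  have A2f: "A2 \<in> fmeasurable M"
    unfolding A2_def by (rule fmeasurable_vimage[OF Tt Af(2)])
  define E3 where "E3 = E \<inter> ((T ^^ t) -` E2 \<inter> space M) \<inter> Fl j p"
  have ps: "Fl j p \<in> fmeasurable M"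
    using pq by (intro floor_fmeasurable[OF j1]) auto
  have T2: "(T ^^ t) -` E2 \<inter> space M \<in> sets M"
    by (rule measurable_sets[OF T_iterate_measurable E2(1)])
  have E3m: "E3 \<in> sets M"
    using E T2 ps by (auto simp: E3_def)
  have E3pos: "measure M E3 > 0"
  proof -
    have f: "E \<inter> Fl j p \<in> fmeasurable M" "((T ^^ t) -` E2 \<inter> space M) \<inter> Fl j p \<in> fmeasurable M"
      using fmeasurable_Int_sets[OF ps E(1)] fmeasurable_Int_sets[OF ps T2] by (simp_all add: Int_commute)
    have "emeasure M (((T ^^ t) -` E2 \<inter> space M) \<inter> Fl j p) = emeasure M (E2 \<inter> Fl j q)"
    proof -
      have "((T ^^ t) -` E2 \<inter> space M) \<inter> Fl j p = (T ^^ t) -` E2 \<inter> Fl j p"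
        using sets.sets_into_space[of "Fl j p" M] ps by auto
      then show ?thesis
        using emeasure_floor_vimage[OF j1, of p t E2] q pq(2) E2(1) by simp
    qed
    then have 2: "measure M (((T ^^ t) -` E2 \<inter> space M) \<inter> Fl j p) > 9 / 10 * w j"
      using d(2) by (simp add: measure_def)
    have "measure M ((E \<inter> Fl j p) \<union> (((T ^^ t) -` E2 \<inter> space M) \<inter> Fl j p)) \<le> measure M (Fl j p)"
      using f ps by (intro measure_mono_fmeasurable) auto
    moreover have "measure M (Fl j p) = w j"
      using pq by (intro measure_floor[OF j1]) auto
    moreover have "(E \<inter> Fl j p) \<inter> (((T ^^ t) -` E2 \<inter> space M) \<inter> Fl j p) = E3"
      by (auto simp: E3_def)
    ultimately show ?thesis
      using measure_Un3[OF f] d(1) 2 wj by simp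
  qed
  \<comment> \<open>The mean density of \<open>E3\<close>; \<open>x\<^sup>2 / w \<ge> 2 lam x - lam\<^sup>2 w\<close> turns the sum of squares into a linear sum.\<close>
  define lam where "lam = measure M E3 / w j"
  define \<delta> where "\<delta> = e * e2 * ((measure M E3)\<^sup>2 / w j)"
  have \<delta>: "\<delta> > 0"
    using E(3) E2(3) E3pos wj by (simp add: \<delta>_def)
  have lower: "\<delta> \<le> (\<Sum>k<h l. corr R A (Fl l k) * corr R A2 (Fl l k) / w l)" if l: "l \<ge> j" for l
  proof -
    have l1: "l \<ge> 1"
      using l j1 by auto
    have wl: "w l > 0"
      using length_pos[OF l1] .
    obtain K where K: "K \<subseteq> {..<h l}" "Fl j p = floors l K"
      using refine[of j "{p}" l] j1 pq l by (auto simp: floors_def)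
    have finK: "finite K"
      using finite_subset[OF K(1)] by simp
    have cK: "real (card K) * w l = w j"
      using measure_floors[OF l1 K(1)] measure_floor[OF j1, of p] pq K(2) by simp
    have lf: "Fl l k \<in> fmeasurable M" if "k < h l" for k
      using that by (rule floor_fmeasurable[OF l1])
    have summand: "e * e2 * (2 * lam * measure M (E3 \<inter> Fl l k) - lam\<^sup>2 * w l) \<le> corr R A (Fl l k) * corr R A2 (Fl l k) / w l"
      if k: "k < h l" for k
    proof -
      define x where "x = measure M (E3 \<inter> Fl l k)"
      have E3k: "E3 \<inter> Fl l k \<in> fmeasurable M"
        using fmeasurable_Int_sets[OF lf[OF k] E3m] by (simp add: Int_commute)
      have "e * x \<le> corr R A (E3 \<inter> Fl l k)"
        unfolding x_def A_def using E3k by (intro E(4)) (auto simp: E3_def)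
      also have "\<dots> \<le> corr R A (Fl l k)"
        using E3k by (intro corr_mono_right[OF Af(1) lf[OF k]]) auto
      finally have 1: "e * x \<le> corr R A (Fl l k)" .
      have "x \<le> measure M (Fl l k \<inter> ((T ^^ t) -` E2 \<inter> space M))"
        unfolding x_def using E3k fmeasurable_Int_sets[OF lf[OF k] T2]
        by (intro measure_mono_fmeasurable) (auto simp: E3_def)
      then have "e2 * x \<le> e2 * measure M (Fl l k \<inter> ((T ^^ t) -` E2 \<inter> space M))"
        using E2(3) by (intro mult_left_mono) auto
      also have "\<dots> \<le> corr R A2 (Fl l k)"
        unfolding A2_def by (rule corr_lower_shift[OF Af(2) E2(1,4) lf[OF k]])
      finally have 2: "e2 * x \<le> corr R A2 (Fl l k)" .
      have "2 * lam * x - lam\<^sup>2 * w l \<le> x\<^sup>2 / w l"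
      proof -
        have "0 \<le> (x - lam * w l)\<^sup>2 / w l"
          using wl by simp
        also have "\<dots> = x\<^sup>2 / w l - 2 * lam * x + lam\<^sup>2 * w l"
          using wl by (simp add: power2_eq_square field_simps)
        finally show ?thesis
          by simp
      qed
      then have "e * e2 * (2 * lam * x - lam\<^sup>2 * w l) \<le> e * e2 * (x\<^sup>2 / w l)"
        using E(3) E2(3) by (intro mult_left_mono) auto
      also have "\<dots> = (e * x) * (e2 * x) / w l"
        by (simp add: power2_eq_square)
      also have "\<dots> \<le> corr R A (Fl l k) * corr R A2 (Fl l k) / w l"
        using 1 2 wl E(3) E2(3) corr_nonneg[OF Af(1) lf[OF k]] by (intro divide_right_mono mult_mono) (auto simp: x_def)
      finally show ?thesis
        by (simp add: x_def)
    qed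
    have "(\<Sum>k\<in>K. measure M (E3 \<inter> Fl l k)) = measure M E3"
    proof -
      have "disjoint_family_on (Fl l) K"
        by (rule disjoint_family_on_mono[OF K(1) floors_disjoint[OF l1]])
      then have pw: "pairwise (\<lambda>x y. disjnt (E3 \<inter> Fl l x) (E3 \<inter> Fl l y)) K"
        by (auto simp: pairwise_def disjnt_def disjoint_family_on_def)
      have fm: "E3 \<inter> Fl l k \<in> fmeasurable M" if "k \<in> K" for k
        using fmeasurable_Int_sets[OF lf E3m, of k] K(1) that by (auto simp: Int_commute)
      have "(\<Union>k\<in>K. E3 \<inter> Fl l k) = E3"
        using K(2) by (auto simp: E3_def floors_def)
      then show ?thesis
        using measure_UNION'[OF finK fm pw] by simp
    qed
    then have "(\<Sum>k\<in>K. e * e2 * (2 * lam * measure M (E3 \<inter> Fl l k) - lam\<^sup>2 * w l)) =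
        e * e2 * (2 * lam * measure M E3 - lam\<^sup>2 * (real (card K) * w l))"
      by (simp add: sum_distrib_left[symmetric] sum_subtractf mult.assoc)
    also have "\<dots> = \<delta>"
      unfolding cK \<delta>_def lam_def using wj by (simp add: power2_eq_square)
    finally have "\<delta> = (\<Sum>k\<in>K. e * e2 * (2 * lam * measure M (E3 \<inter> Fl l k) - lam\<^sup>2 * w l))"
      by simp
    also have "\<dots> \<le> (\<Sum>k\<in>K. corr R A (Fl l k) * corr R A2 (Fl l k) / w l)"
      using K(1) by (intro sum_mono summand) auto
    also have "\<dots> \<le> (\<Sum>k<h l. corr R A (Fl l k) * corr R A2 (Fl l k) / w l)"
      using K(1) wl corr_nonneg[OF Af(1) lf] corr_nonneg[OF A2f lf] by (intro sum_mono2) auto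
    finally show ?thesis .
  qed
  have "(\<lambda>l. \<Sum>k<h l. corr R A (Fl l k) * corr R A2 (Fl l k) / w l) \<longlonglongrightarrow> (\<integral>\<omega>. compensated M A (R \<omega>) * compensated M A2 (R \<omega>) \<partial>P)"
    using parseval[OF compensated_R_closure[OF Af(1)] compensated_R_L2[OF A2f]]
    by (simp add: corr_def mult.commute)
  also have "(\<integral>\<omega>. compensated M A (R \<omega>) * compensated M A2 (R \<omega>) \<partial>P) = measure M (A \<inter> A2)"
    using integral_preserving[OF R, of "\<lambda>\<omega>. compensated M A \<omega> * compensated M A2 \<omega>"] Af A2f integral_compensated_mult[OF Af(1) A2f]
    by (simp add: fmeasurableD)
  finally have "(\<lambda>l. \<Sum>k<h l. corr R A (Fl l k) * corr R A2 (Fl l k) / w l) \<longlonglongrightarrow> 0"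
    using meet by (simp add: A_def A2_def)
  then have "\<delta> \<le> 0"
    by (rule LIMSEQ_le_const) (use lower in blast)
  then show False
    using \<delta> by simp
qed

text \<open>Both sets on which the densities are bounded below fill most of some floor at a common stage.
  Which of the two floors is the lower one does not matter, by symmetry.\<close>

lemma corr_classes:
  assumes i: "j\<^sub>0 \<le> i" "k < h i" "k' < h i" and i2: "j\<^sub>0 \<le> i2" "k2 < h i2" "k2' < h i2"
    and c: "corr R (Fl i k) (Fl i k') \<noteq> 0" "corr R (Fl i2 k2) (Fl i2 k2') \<noteq> 0"
  shows "(k' + k2) mod m = (k2' + k) mod m"
proof -
  have i1: "i \<ge> 1" "i2 \<ge> 1"
    using i i2 j0 by auto
  note f = floor_fmeasurable[OF i1(1)] floor_fmeasurable[OF i1(2)]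
  have pos: "corr R (Fl i k) (Fl i k') > 0" "corr R (Fl i2 k2) (Fl i2 k2') > 0"
    using c corr_nonneg[OF f(1)[OF i(2)] f(1)[OF i(3)]] corr_nonneg[OF f(2)[OF i2(2)] f(2)[OF i2(3)]] by auto
  obtain E e where E: "E \<in> sets M" "E \<subseteq> Fl i k'" "measure M E > 0" "e > 0"
    "\<And>C. C \<in> sets M \<Longrightarrow> C \<subseteq> E \<Longrightarrow> e * measure M C \<le> corr R (Fl i k) C"
    using corr_density[OF f(1)[OF i(2)] f(1)[OF i(3)] pos(1)] by blast
  obtain E2 e2 where E2: "E2 \<in> sets M" "E2 \<subseteq> Fl i2 k2'" "measure M E2 > 0" "e2 > 0"
    "\<And>C. C \<in> sets M \<Longrightarrow> C \<subseteq> E2 \<Longrightarrow> e2 * measure M C \<le> corr R (Fl i2 k2) C"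
    using corr_density[OF f(2)[OF i2(2)] f(2)[OF i2(3)] pos(2)] by blast
  have Ef: "E \<in> fmeasurable M" "E2 \<in> fmeasurable M"
    using fmeasurableI2[OF f(1)[OF i(3)] E(2,1)] fmeasurableI2[OF f(2)[OF i2(3)] E2(2,1)] by auto
  have "\<forall>\<^sub>F j in sequentially. (i \<le> j \<and> i2 \<le> j) \<and> (\<exists>k<h j. measure M (E \<inter> Fl j k) > 9 / 10 * w j) \<and> (\<exists>k<h j. measure M (E2 \<inter> Fl j k) > 9 / 10 * w j)"
    using dense_floor[OF Ef(1) E(3)] dense_floor[OF Ef(2) E2(3)] eventually_ge_at_top[of i] eventually_ge_at_top[of i2]
    by eventually_elim auto
  then obtain j p q where j: "i \<le> j" "i2 \<le> j" and pq: "p < h j" "q < h j"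
    and d: "measure M (E \<inter> Fl j p) > 9 / 10 * w j" "measure M (E2 \<inter> Fl j q) > 9 / 10 * w j"
    by (auto simp: eventually_sequentially)
  show ?thesis
  proof (cases "p \<le> q")
    case True
    show ?thesis
      by (rule dense_pair_classes[OF i i2 E(1,2,4,5) E2(1,2,4,5) j True pq(2) d])
  next
    case False
    then have "(k2' + k) mod m = (k' + k2) mod m"
      by (intro dense_pair_classes[OF i2 i E2(1,2,4,5) E(1,2,4,5) j(2,1) _ pq(1) d(2,1)]) auto
    then show ?thesis
      by simp
  qed
qed

lemma corr_shift:
  "\<exists>c. \<forall>i k k'. j\<^sub>0 \<le> i \<longrightarrow> k < h i \<longrightarrow> k' < h i \<longrightarrow> corr R (Fl i k) (Fl i k') \<noteq> 0 \<longrightarrow> (int k + c) mod int m = int k' mod int m"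
proof (cases "\<exists>i k k'. j\<^sub>0 \<le> i \<and> k < h i \<and> k' < h i \<and> corr R (Fl i k) (Fl i k') \<noteq> 0")
  case True
  then obtain i k k' where i: "j\<^sub>0 \<le> i" "k < h i" "k' < h i" "corr R (Fl i k) (Fl i k') \<noteq> 0"
    by blast
  have "(int k2 + (int k' - int k)) mod int m = int k2' mod int m"
    if i2: "j\<^sub>0 \<le> i2" "k2 < h i2" "k2' < h i2" "corr R (Fl i2 k2) (Fl i2 k2') \<noteq> 0" for i2 k2 k2'
  proof -
    have "int (k' + k2) mod int m = int (k2' + k) mod int m"
      using corr_classes[OF i(1-3) i2(1-3) i(4) i2(4)] by (metis of_nat_mod)
    then have "(int (k' + k2) - int k) mod int m = (int (k2' + k) - int k) mod int m"
      by (metis mod_diff_left_eq)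
    then show ?thesis
      by (simp add: algebra_simps)
  qed
  then show ?thesis
    by blast
qed blast

lemma centralizer_power: "suspension_centralizer M P T T' n (R ^^ q) (R' ^^ q)"
proof
  show "inverse_pair P (R ^^ q) (R' ^^ q)"
    by (rule inverse_pair_funpow[OF R])
  have "AE \<omega> in P. S (R \<omega>) = R (S \<omega>)"
    using commute by eventually_elim simp
  then have "AE \<omega> in P. S ((R ^^ q) \<omega>) = (R ^^ q) (S \<omega>)"
    by (rule AE_commute_funpow[OF R])
  then show "AE \<omega> in P. (R ^^ q) (S \<omega>) = S ((R ^^ q) \<omega>)"
    by eventually_elim simp
qed (use divisible T half in auto)

text \<open>Matrix multiplication for the operators induced on the first chaos: the image of \<open>A\<close> under the
  power of \<open>R\<close> is expanded along floors, and the last factor is moved to \<open>B\<close> as the inverse of \<open>R\<close>.\<close>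

lemma corr_power_step:
  assumes A: "A \<in> fmeasurable M" and B: "B \<in> fmeasurable M"
  shows "(\<lambda>j. \<Sum>k<h j. corr (R ^^ q) A (Fl j k) * corr R (Fl j k) B / w j) \<longlonglongrightarrow> corr (R ^^ Suc q) A B"
proof -
  have Rq: "R ^^ q \<in> measurable P P"
    using inverse_pair_funpow[OF R, of q] by (auto simp: inverse_pair_def)
  have cl: "(\<lambda>\<omega>. compensated M A ((R ^^ q) \<omega>)) \<in> L2_closure P (compensated M ` fmeasurable M)"
    by (rule suspension_centralizer.compensated_R_closure[OF centralizer_power A])
  have "(\<lambda>j. \<Sum>k<h j. corr (R ^^ q) A (Fl j k) * (\<integral>\<omega>. compensated M (Fl j k) \<omega> * compensated M B (R' \<omega>) \<partial>P) / w j)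
      \<longlonglongrightarrow> (\<integral>\<omega>. compensated M A ((R ^^ q) \<omega>) * compensated M B (R' \<omega>) \<partial>P)"
    using parseval[OF cl L2_preserving(1)[OF inverse_pair_sym[OF R] compensated_L2[OF B]]] by (simp add: corr_def)
  moreover have "(\<integral>\<omega>. compensated M A ((R ^^ q) \<omega>) * compensated M B (R' \<omega>) \<partial>P) = corr (R ^^ Suc q) A B"
    using integral_adjoint[OF R, of "\<lambda>\<omega>. compensated M A ((R ^^ q) \<omega>)" "compensated M B"] A B Rq
    by (simp add: corr_def fmeasurableD funpow_swap1)
  moreover have "\<forall>\<^sub>F j in sequentially. (\<Sum>k<h j. corr (R ^^ q) A (Fl j k) * (\<integral>\<omega>. compensated M (Fl j k) \<omega> * compensated M B (R' \<omega>) \<partial>P) / w j)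
      = (\<Sum>k<h j. corr (R ^^ q) A (Fl j k) * corr R (Fl j k) B / w j)"
    using eventually_ge_at_top[of 1]
  proof eventually_elim
    case (elim j)
    have "(\<integral>\<omega>. compensated M (Fl j k) \<omega> * compensated M B (R' \<omega>) \<partial>P) = corr R (Fl j k) B" if "k < h j" for k
      using integral_adjoint[OF R, of "compensated M (Fl j k)" "compensated M B"] floor_in_sets[OF elim that] B
      by (simp add: corr_def fmeasurableD)
    then show ?case
      by (intro sum.cong) auto
  qed
  ultimately show ?thesis
    using Lim_transform_eventually by fastforce
qed

lemma corr_power_shift:
  assumes c: "\<And>i k k'. j\<^sub>0 \<le> i \<Longrightarrow> k < h i \<Longrightarrow> k' < h i \<Longrightarrow> corr R (Fl i k) (Fl i k') \<noteq> 0 \<Longrightarrow> (int k + c) mod int m = int k' mod int m"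
    and i: "j\<^sub>0 \<le> i" "k < h i" "k' < h i" "corr (R ^^ q) (Fl i k) (Fl i k') \<noteq> 0"
  shows "(int k + int q * c) mod int m = int k' mod int m"
  using i
proof (induction q arbitrary: i k k')
  case 0
  have "i \<ge> 1"
    using 0 j0 by auto
  then have "corr (R ^^ 0) (Fl i k) (Fl i k') = measure M (Fl i k \<inter> Fl i k')"
    using 0 by (simp add: corr_def integral_compensated_mult floor_fmeasurable)
  then have "Fl i k \<inter> Fl i k' \<noteq> {}"
    using 0(4) by (metis measure_empty)
  then have "k = k'"
    using floor_unique[OF \<open>i \<ge> 1\<close>] 0 by blast
  then show ?case
    by simp
next
  case (Suc q)
  have i1: "i \<ge> 1"
    using Suc.prems j0 by auto
  note f = floor_fmeasurable[OF i1 Suc.prems(2)] floor_fmeasurable[OF i1 Suc.prems(3)]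
  have "\<exists>j\<ge>i. \<exists>p<h j. corr (R ^^ q) (Fl i k) (Fl j p) \<noteq> 0 \<and> corr R (Fl j p) (Fl i k') \<noteq> 0"
  proof (rule ccontr)
    assume no: "\<not> (\<exists>j\<ge>i. \<exists>p<h j. corr (R ^^ q) (Fl i k) (Fl j p) \<noteq> 0 \<and> corr R (Fl j p) (Fl i k') \<noteq> 0)"
    have "\<forall>\<^sub>F j in sequentially. (\<Sum>p<h j. corr (R ^^ q) (Fl i k) (Fl j p) * corr R (Fl j p) (Fl i k') / w j) = 0"
      using eventually_ge_at_top[of i]
    proof eventually_elim
      case (elim j)
      then show ?case
        using no by (intro sum.neutral) auto
    qed
    then have "(\<lambda>j. \<Sum>p<h j. corr (R ^^ q) (Fl i k) (Fl j p) * corr R (Fl j p) (Fl i k') / w j) \<longlonglongrightarrow> 0"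
      by (rule tendsto_eventually)
    then show False
      using LIMSEQ_unique[OF corr_power_step[OF f, of q]] Suc.prems(4) by blast
  qed
  then obtain j p where j: "j \<ge> i" "p < h j" and c1: "corr (R ^^ q) (Fl i k) (Fl j p) \<noteq> 0" and c2: "corr R (Fl j p) (Fl i k') \<noteq> 0"
    by blast
  have j1: "j \<ge> 1" "j\<^sub>0 \<le> j"
    using j i1 Suc.prems by auto
  have pf: "Fl j p \<in> fmeasurable M"
    by (rule floor_fmeasurable[OF j1(1) j(2)])
  obtain K where K: "K \<subseteq> {..<h j}" "Fl i k = floors j K" "\<And>p. p \<in> K \<Longrightarrow> p mod m = k mod m"
    using class_refine[OF Suc.prems(1,2) j(1)] by auto
  obtain L where L: "L \<subseteq> {..<h j}" "Fl i k' = floors j L" "\<And>p. p \<in> L \<Longrightarrow> p mod m = k' mod m"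
    using class_refine[OF Suc.prems(1,3) j(1)] by auto
  have "(\<Sum>k\<in>K. corr (R ^^ q) (Fl j k) (Fl j p)) \<noteq> 0"
    using c1 corr_floors_left[OF inverse_pair_funpow[OF R] j1(1) K(1) pf] K(2) by simp
  then obtain u where u: "u \<in> K" "corr (R ^^ q) (Fl j u) (Fl j p) \<noteq> 0"
    by (rule sum.not_neutral_contains_not_neutral)
  have "(\<Sum>k\<in>L. corr R (Fl j p) (Fl j k)) \<noteq> 0"
    using c2 corr_floors_right[OF R j1(1) L(1) pf] L(2) by simp
  then obtain v where v: "v \<in> L" "corr R (Fl j p) (Fl j v) \<noteq> 0"
    by (rule sum.not_neutral_contains_not_neutral)
  have 1: "(int u + int q * c) mod int m = int p mod int m"
    using Suc.IH[OF j1(2) _ j(2) u(2)] u(1) K(1) by auto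
  have 2: "(int p + c) mod int m = int v mod int m"
    using c[OF j1(2) j(2) _ v(2)] v(1) L(1) by auto
  have "int u mod int m = int k mod int m" "int v mod int m = int k' mod int m"
    using K(3)[OF u(1)] L(3)[OF v(1)] by (metis of_nat_mod)+
  then have "(int k + int q * c + c) mod int m = int k' mod int m"
    using 1 2 by (metis mod_add_left_eq)
  then show ?case
    by (simp add: algebra_simps)
qed

text \<open>The covariance of \<open>N\<^sub>A \<circ> S\<close> and \<open>N\<^sub>B\<close> for \<open>A\<close> the floor \<open>1\<close> and \<open>B\<close> the floor \<open>0\<close> is the measure
  of a floor, so \<open>S\<close> shifts classes by \<open>-1\<close>, while the \<open>m\<close>-th power of \<open>R\<close> shifts them by a multiple
  of \<open>m\<close>.\<close>

lemma not_root: "\<not> (AE \<omega> in P. (R ^^ m) \<omega> = S \<omega>)"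
proof
  assume root: "AE \<omega> in P. (R ^^ m) \<omega> = S \<omega>"
  obtain c where c: "\<And>i k k'. j\<^sub>0 \<le> i \<Longrightarrow> k < h i \<Longrightarrow> k' < h i \<Longrightarrow> corr R (Fl i k) (Fl i k') \<noteq> 0 \<Longrightarrow> (int k + c) mod int m = int k' mod int m"
    using corr_shift by blast
  have "m \<le> h j\<^sub>0"
    using height_dvd[of j\<^sub>0] height_pos[OF j0] by (intro dvd_imp_le) auto
  then have lt: "1 < h j\<^sub>0" "0 < h j\<^sub>0"
    using m by auto
  note f = floor_fmeasurable[OF j0 lt(1)] floor_fmeasurable[OF j0 lt(2)]
  have [measurable]: "Fl j\<^sub>0 (Suc 0) \<in> sets M" "Fl j\<^sub>0 0 \<in> sets M" "S \<in> measurable P P" "R ^^ m \<in> measurable P P"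
    using f S inverse_pair_funpow[OF R, of m] by (auto simp: inverse_pair_def)
  have pre: "T -` Fl j\<^sub>0 1 \<inter> space M \<in> fmeasurable M"
    by (rule fmeasurable_vimage[OF T f(1)])
  have "corr (R ^^ m) (Fl j\<^sub>0 1) (Fl j\<^sub>0 0) = (\<integral>\<omega>. compensated M (Fl j\<^sub>0 1) (S \<omega>) * compensated M (Fl j\<^sub>0 0) \<omega> \<partial>P)"
    unfolding corr_def using root by (intro integral_cong_AE) auto
  also have "\<dots> = (\<integral>\<omega>. compensated M (T -` Fl j\<^sub>0 1 \<inter> space M) \<omega> * compensated M (Fl j\<^sub>0 0) \<omega> \<partial>P)"
    using compensated_suspension[OF T fmeasurableD[OF f(1)], of _ 1]
    by (intro Bochner_Integration.integral_cong) auto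
  also have "\<dots> = measure M ((T -` Fl j\<^sub>0 1 \<inter> space M) \<inter> Fl j\<^sub>0 0)"
    by (rule integral_compensated_mult[OF pre f(2)])
  also have "(T -` Fl j\<^sub>0 1 \<inter> space M) \<inter> Fl j\<^sub>0 0 = Fl j\<^sub>0 0"
    using iterate_translation(2)[OF j0, of _ 0 1] lt sets.sets_into_space[of "Fl j\<^sub>0 0" M] by auto
  also have "measure M (Fl j\<^sub>0 0) \<noteq> 0"
    using measure_floor[OF j0 lt(2)] length_pos[OF j0] by simp
  finally have "(int 1 + int m * c) mod int m = int 0 mod int m"
    by (intro corr_power_shift[OF c _ lt]) auto
  then show False
    using m by simp
qed

end

section \<open>Rigidity and absence of roots\<close>

lemma (in rank_one) height_at_top: "filterlim h at_top sequentially"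
proof -
  have "filterlim (\<lambda>j. h (Suc j)) at_top sequentially"
  proof (rule filterlim_at_top_mono[OF cuts_unbounded])
    show "\<forall>\<^sub>F j in sequentially. r j \<le> h (Suc j)"
      using eventually_ge_at_top[of 1]
    proof eventually_elim
      case (elim j)
      then show ?case
        using height_step[OF elim] height_pos[OF elim] by (simp add: trans_le_add1 Suc_le_eq)
    qed
  qed
  then show ?thesis
    by (rule filterlim_sequentially_Suc[THEN iffD1])
qed

lemma (in rank_one) height_step_half:
  assumes "half_stage j"
  shows "h (Suc j) = h j * (r j + (r j - r j div 2))"
proof -
  have "(\<Sum>i = 1..r j. s j i) = (\<Sum>i\<in>{Suc (r j div 2)..r j}. h j)"
    using assms by (intro sum.mono_neutral_cong_right) (auto simp: half_stage_def)
  then show ?thesis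
    using assms height_step[of j] by (simp add: half_stage_def algebra_simps)
qed

theorem theorem2:
  fixes h\<^sub>1 :: nat
    and r r' h :: "nat \<Rightarrow> nat"
    and s :: "nat \<Rightarrow> nat \<Rightarrow> nat"
    and w :: "nat \<Rightarrow> real"
    and a :: "nat \<Rightarrow> nat \<Rightarrow> real"
    and T :: "real \<Rightarrow> real"
    and P :: "real measure measure"
  assumes "h\<^sub>1 \<ge> 1"
    and "\<And>j. j \<ge> 1 \<Longrightarrow> r' j > 0"
    and "filterlim r' at_top sequentially"
    and "\<And>j. j \<ge> 1 \<Longrightarrow> r j = j * r' j"
    and "\<And>j i. j \<ge> 1 \<Longrightarrow> odd j \<Longrightarrow> 1 \<le> i \<Longrightarrow> i \<le> r j \<Longrightarrow> s j i = 0"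
    and "\<And>j i. j \<ge> 1 \<Longrightarrow> even j \<Longrightarrow> 0 < i \<Longrightarrow> real i \<le> real (r j) / 2 \<Longrightarrow> s j i = 0"
    and "\<And>j i. j \<ge> 1 \<Longrightarrow> even j \<Longrightarrow> real (r j) / 2 < real i \<Longrightarrow> i \<le> r j \<Longrightarrow> s j i = h j"
    and "rank_one h\<^sub>1 r s h w a T"
    and "poisson_measure (rank_one_space h w a) P"
  shows "rigid P (poisson_suspension (rank_one_space h w a) T) \<and>
         no_roots P (poisson_suspension (rank_one_space h w a) T)"
proof -
  interpret rank_one h\<^sub>1 r s h w a T
    by fact
  interpret poisson_process M P
    using assms(9) by (auto simp: poisson_process_def poisson_process_axioms_def poisson_measure_def)
  have half: "half_stage j" if "j \<ge> 1" "even j" for j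
  proof -
    have "s j i = 0" if "i \<in> {1..r j div 2}" for i
      using that \<open>j \<ge> 1\<close> \<open>even j\<close> by (intro assms(6)) auto
    moreover have "s j i = h j" if "i \<in> {Suc (r j div 2)..r j}" for i
      using that \<open>j \<ge> 1\<close> \<open>even j\<close> by (intro assms(7)) auto
    ultimately show ?thesis
      using \<open>j \<ge> 1\<close> by (auto simp: half_stage_def)
  qed
  have flat: "flat_stage j" if "j \<ge> 1" "odd j" for j
    using that assms(5) by (auto simp: flat_stage_def)
  have odd: "filterlim (\<lambda>i::nat. 2 * i + 1) at_top sequentially" and even: "filterlim (\<lambda>i::nat. 2 * i + 2) at_top sequentially"
    by (rule filterlim_subseq, simp add: strict_mono_def)+
  have "rigid P (poisson_suspension M T)"
  proof (rule rigid_suspension[OF T_pair finely_divisible_M])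
    show "filterlim (\<lambda>i. h (2 * i + 1)) at_top sequentially"
      by (rule filterlim_compose[OF height_at_top odd])
    show "(\<lambda>i. measure M (((T ^^ h (2 * i + 1)) -` A \<inter> space M) \<inter> A)) \<longlonglongrightarrow> measure M A" if "A \<in> fmeasurable M" for A
      by (rule flat_limit[OF odd _ that]) (simp add: flat)
  qed
  moreover have "no_roots P (poisson_suspension M T)"
    unfolding no_roots_def
  proof (intro allI impI notI, elim exE conjE)
    fix m :: nat and R
    assume m: "m \<ge> 2" and R: "automorphism P R" and root: "AE x in P. (R ^^ m) x = poisson_suspension M T x"
    obtain R' where R': "inverse_pair P R R'"
      using R by (auto simp: automorphism_iff)
    \<comment> \<open>The number of spacers is \<open>0\<close> or \<open>h\<^sub>j\<close>, so divisibility of a height is inherited by all later ones.\<close>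
    have spacers: "h j dvd s j i" if "j \<ge> 1" "i \<in> {1..r j}" for j i
      using that half[of j] flat[of j] by (cases "even j"; cases "i \<le> r j div 2") (auto simp: half_stage_def flat_stage_def)
    \<comment> \<open>At the even stage \<open>2 m\<close> both the number of columns and the number of spacer columns are multiples of \<open>m\<close>.\<close>
    have dvd: "m dvd h j" if "j \<ge> 2 * m + 1" for j
      using that
    proof (induction j rule: dec_induct)
      case base
      have "r (2 * m) div 2 = m * r' (2 * m)" "r (2 * m) = 2 * (m * r' (2 * m))"
        using assms(4)[of "2 * m"] m by simp_all
      then have "m dvd r (2 * m) + (r (2 * m) - r (2 * m) div 2)"
        by simp
      then show ?case
        using height_step_half[OF half[of "2 * m"]] m by simp
    next
      case (step j)
      then have "h j dvd h (Suc j)"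
        using height_step[of j] spacers[of j] by (auto intro!: dvd_add dvd_sum)
      then show ?case
        using step.IH by (rule dvd_trans[rotated])
    qed
    interpret rank_one_centralizer h\<^sub>1 r s h w a T "2 * m + 1" m P T_inv "\<lambda>i. h (2 * i + 2)" R R'
    proof unfold_locales
      show "2 * m + 1 \<ge> 1" "m \<ge> 2"
        using m by simp_all
      show "m dvd h j" if "j \<ge> 2 * m + 1" for j
        using that by (rule dvd)
      show "m dvd s j i" if "j \<ge> 2 * m + 1" "i \<in> {1..r j}" for j i
        using dvd[OF that(1)] spacers[of j i] that by (auto intro: dvd_trans)
      show "finely_divisible M"
        by (rule finely_divisible_M)
      show "inverse_pair M T T_inv"
        by (rule T_pair)
      show "(\<lambda>i. measure M (((T ^^ h (2 * i + 2)) -` A \<inter> space M) \<inter> B)) \<longlonglongrightarrow> measure M (A \<inter> B) / 2"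
        if "A \<in> fmeasurable M" "B \<in> fmeasurable M" for A B
        by (rule half_limit[OF even _ that]) (simp add: half)
      show "inverse_pair P R R'"
        by (rule R')
      show "AE \<omega> in P. R (poisson_suspension M T \<omega>) = poisson_suspension M T (R \<omega>)"
        by (rule AE_root_commute[OF R' root])
    qed
    show False
      using not_root root by simp
  qed
  ultimately show ?thesis
    by simp
qed

end
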